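(* Let $L\in\{1,\infty\}$, $0<p,r\le\infty$, $b\in SV(0,L)$ satisfy one of the following: $1<p<\infty$; or $p=1$, $L=1$ and $\|t^{-1/r}b(t)\|_{r,(0,1)}=\infty$; or $p=1$, $L=\infty$ and $\|t^{-1/r}b(t)\|_{r,(1,\infty)}<\infty$; or $p=\infty$ and $\|t^{-1/r}b(t)\|_{r,(0,1)}<\infty$. Let $d\in SV(0,L)$, $0<U<\infty$, $0<V\le\infty$, $0<W\le\infty$. (i) If $1<p\le\infty$ and $0<U<p$, then for all $f\in\mathfrak M(0,L)$ $$\|f\|_{(p,r;b)}\sim\big\|H^{(U,W;d)}f^{**}\big\|_{B_{p,r;b}} .$$ Moreover, $\|H^{(U,W;d)}f^{**}\|_{B_{p,r;b}}$ is an equivalent r.i. quasi-norm on $L_{(p,r;b)}$. (ii) If $1<p<V\le\infty$, then for all $f\in\mathfrak M(0,L)$ $$\|f\|_{(p,r;b)}\sim\big\|H_{(V,W;d)}f^{**}\big\|_{B_{p,r;b}} .$$ Moreover, $\|H_{(V,W;d)}f^{**}\|_{B_{p,r;b}}$ is an equivalent r.i. quasi-norm on $L_{(p,r;b)}$.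
   Context: Conventions: $1/\infty=0$. $\mathfrak M(0,L)$ is the set of complex-valued Lebesgue measurable a.e. finite functions on $(0,L)$ (identified if equal a.e.), $\mathfrak M^+(0,L)$ its subset of non-negative functions. For $0<q\le\infty$, $\|\cdot\|_{q,(a,b)}$ is the usual Lebesgue (quasi-)norm on $(a,b)$ (essential supremum if $q=\infty$). $f^*(t)=\inf\{\lambda>0:\ |\{x\in(0,L):|f(x)|>\lambda\}|\le t\}$ is the non-increasing rearrangement and $f^{**}(t)=\frac1t\int_0^tf^*(u)\,du$, $t\in(0,L)$. $F\sim G$ means $c\,G\le F\le C\,G$ with constants $0<c\le C<\infty$ independent of $f$ (both sides may be $\infty$). $SV=SV(0,L)$: positive measurable $d$ on $(0,L)$ such that for every $\varepsilon>0$ the function $t^{\varepsilon}d(t)$ is equivalent ($\sim$, pointwise with constants) to a non-decreasing function and $t^{-\varepsilon}d(t)$ is equivalent to a non-increasing function. $\|g\|_{B_{p,r;b}}=\big\|t^{\frac1p-\frac1r}b(t)|g(t)|\big\|_{r,(0,L)}$ for measurable $g$ on $(0,L)$ (possibly with value $\infty$), and $L_{(p,r;b)}=L_{(p,r;b)}(0,L)$ is the set of $f\in\mathfrak M(0,L)$ with $\|f\|_{(p,r;b)}:=\|f^{**}\|_{B_{p,r;b}}<\infty$. Averaging operators, for a function $h$ on $(0,L)$ and $t\in(0,L)$ (if $f^{**}\equiv\infty$, put $(f^{**})^*\equiv\infty$ on $(0,L)$): $$(H^{(U,W;d)}h)(t)=\big(t^{1/U}d(t)\big)^{-1}\big\|v^{\frac1U-\frac1W}d(v)h^*(v)\big\|_{W,(0,t)},$$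 $$(H_{(V,W;d)}h)(t)=\big(t^{1/V}d(t)\big)^{-1}\big\|v^{\frac1V-\frac1W}d(v)h^*(v)\big\|_{W,(t,L)}.$$ A functional $N$ is an equivalent r.i. quasi-norm on $L_{(p,r;b)}$ if $N(f)\sim\|f\|_{(p,r;b)}$ for all $f\in\mathfrak M(0,L)$, $N(f)=N(f^* )$, and for some $C\ge1$ and all $f,g,f_n\in\mathfrak M^+(0,L)$, $\lambda\ge0$: $N(f)=0\Leftrightarrow f=0$ a.e.; $N(\lambda f)=\lambda N(f)$; $N(f+g)\le C(N(f)+N(g))$; $g\le f$ a.e. implies $N(g)\le N(f)$; $0\le f_n\nearrow f$ a.e. and $\sup_nN(f_n)<\infty$ imply $N(f)<\infty$ and $N(f_n)\nearrow N(f)$; $N(\chi_\omega)<\infty$ for every bounded measurable $\omega\subset(0,L)$. *)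

theory Defs
  imports "HOL-Analysis.Analysis" "HOL-Probability.Essential_Supremum"
begin

text \<open>
  Exponents in (0,\<infinity>] are of type \<^typ>\<open>ennreal\<close>. Since \<^prop>\<open>inverse (\<infinity>::ennreal) = 0\<close>,
  the following reciprocal obeys the convention that 1/\<infinity> is 0.
\<close>

definition recip :: "ennreal \<Rightarrow> real" where
  "recip q = enn2real (inverse q)"

text \<open>Powers of elements of [0,\<infinity>], meant for exponents \<^prop>\<open>a > 0\<close> only.\<close>

definition epow :: "ennreal \<Rightarrow> real \<Rightarrow> ennreal" where
  "epow x a = (if x = \<infinity> then \<infinity> else ennreal (enn2real x powr a))"

text \<open>The Lebesgue (quasi-)norm over (a,b) of a function that is already non-negative.\<close>

definition Lnorm :: "ennreal \<Rightarrow> ereal \<Rightarrow> ereal \<Rightarrow> (real \<Rightarrow> ennreal) \<Rightarrow> ennreal" where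
  "Lnorm q a b g =
     (if q = \<infinity> then esssup (lebesgue_on (einterval a b)) g
      else epow (\<integral>\<^sup>+ v. epow (g v) (enn2real q) \<partial>lebesgue_on (einterval a b)) (recip q))"

definition sim_on :: "'a set \<Rightarrow> ('a \<Rightarrow> ennreal) \<Rightarrow> ('a \<Rightarrow> ennreal) \<Rightarrow> bool" where
  "sim_on A F G \<longleftrightarrow>
     (\<exists>c C::real. 0 < c \<and> c \<le> C \<and>
        (\<forall>x\<in>A. ennreal c * G x \<le> F x \<and> F x \<le> ennreal C * G x))"

text \<open>
  Complex-valued measurable functions on (0,L). Values outside (0,L) are irrelevant.
  An a.e. finite function has an everywhere finite representative, so nothing
  needs to be said about finiteness.
\<close>

definition MM :: "ereal \<Rightarrow> (real \<Rightarrow> complex) set" where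
  "MM L = borel_measurable (lebesgue_on (einterval 0 L))"

definition MMplus :: "ereal \<Rightarrow> (real \<Rightarrow> ennreal) set" where
  "MMplus L = {g \<in> borel_measurable (lebesgue_on (einterval 0 L)).
                 AE x in lebesgue_on (einterval 0 L). g x < \<infinity>}"

definition modulus :: "(real \<Rightarrow> complex) \<Rightarrow> real \<Rightarrow> ennreal" where
  "modulus f x = ennreal (cmod (f x))"

definition SV :: "ereal \<Rightarrow> (real \<Rightarrow> real) set" where
  "SV L = {d \<in> borel_measurable (lebesgue_on (einterval 0 L)).
     (\<forall>t\<in>einterval 0 L. 0 < d t) \<and>
     (\<forall>\<epsilon>>0.
        (\<exists>\<phi>. mono_on (einterval 0 L) \<phi> \<and>
           sim_on (einterval 0 L) (\<lambda>t. ennreal (t powr \<epsilon> * d t)) \<phi>) \<and>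
        (\<exists>\<psi>. antimono_on (einterval 0 L) \<psi> \<and>
           sim_on (einterval 0 L) (\<lambda>t. ennreal (t powr (- \<epsilon>) * d t)) \<psi>))}"

text \<open>
  The non-increasing rearrangement on (0,L) of a function with values in [0,\<infinity>];
  that of a complex-valued function \<open>f\<close> is \<open>rearr L (modulus f)\<close>. The infimum of the empty
  set is \<infinity>, so the rearrangement of the constant \<infinity> is \<infinity> on (0,L).
\<close>

definition rearr :: "ereal \<Rightarrow> (real \<Rightarrow> ennreal) \<Rightarrow> real \<Rightarrow> ennreal" where
  "rearr L g t =
     (INF s\<in>{s::real. 0 < s \<and>
        emeasure lebesgue {x \<in> einterval 0 L. ennreal s < g x} \<le> ennreal t}. ennreal s)"

definition maxrearr :: "ereal \<Rightarrow> (real \<Rightarrow> ennreal) \<Rightarrow> real \<Rightarrow> ennreal" where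
  "maxrearr L g t = (\<integral>\<^sup>+ u. rearr L g u \<partial>lebesgue_on (einterval 0 t)) / ennreal t"

definition Bnorm ::
  "ereal \<Rightarrow> ennreal \<Rightarrow> ennreal \<Rightarrow> (real \<Rightarrow> real) \<Rightarrow> (real \<Rightarrow> ennreal) \<Rightarrow> ennreal" where
  "Bnorm L p r b g = Lnorm r 0 L (\<lambda>t. ennreal (t powr (recip p - recip r) * b t) * g t)"

definition LKnorm ::
  "ereal \<Rightarrow> ennreal \<Rightarrow> ennreal \<Rightarrow> (real \<Rightarrow> real) \<Rightarrow> (real \<Rightarrow> ennreal) \<Rightarrow> ennreal" where
  "LKnorm L p r b g = Bnorm L p r b (maxrearr L g)"

definition Hup ::
  "ereal \<Rightarrow> ennreal \<Rightarrow> ennreal \<Rightarrow> (real \<Rightarrow> real) \<Rightarrow> (real \<Rightarrow> ennreal) \<Rightarrow> real \<Rightarrow> ennreal" where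
  "Hup L U W d h t =
     ennreal (inverse (t powr recip U * d t)) *
     Lnorm W 0 t (\<lambda>v. ennreal (v powr (recip U - recip W) * d v) * rearr L h v)"

definition Hlow ::
  "ereal \<Rightarrow> ennreal \<Rightarrow> ennreal \<Rightarrow> (real \<Rightarrow> real) \<Rightarrow> (real \<Rightarrow> ennreal) \<Rightarrow> real \<Rightarrow> ennreal" where
  "Hlow L V W d h t =
     ennreal (inverse (t powr recip V * d t)) *
     Lnorm W t L (\<lambda>v. ennreal (v powr (recip V - recip W) * d v) * rearr L h v)"

definition admissible :: "ereal \<Rightarrow> ennreal \<Rightarrow> ennreal \<Rightarrow> (real \<Rightarrow> real) \<Rightarrow> bool" where
  "admissible L p r b \<longleftrightarrow>
     (let w = (\<lambda>t. ennreal (t powr (- recip r) * b t)) in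
       (1 < p \<and> p < \<infinity>) \<or>
       (p = 1 \<and> L = 1 \<and> Lnorm r 0 1 w = \<infinity>) \<or>
       (p = 1 \<and> L = \<infinity> \<and> Lnorm r 1 \<infinity> w < \<infinity>) \<or>
       (p = \<infinity> \<and> Lnorm r 0 1 w < \<infinity>))"

text \<open>
  A rearrangement-invariant functional depends on \<open>f\<close> only through \<open>|f|\<close>, and the
  rearrangement of a finite function may be identically \<infinity> (for example that of
  \<open>f(x) = x\<close> on (0,\<infinity>)). Therefore the functional takes functions with values in
  [0,\<infinity>], and its value at a complex-valued \<open>f\<close> is \<open>N (modulus f)\<close>.
\<close>

definition equiv_ri_quasinorm ::
  "ereal \<Rightarrow> ennreal \<Rightarrow> ennreal \<Rightarrow> (real \<Rightarrow> real) \<Rightarrow> ((real \<Rightarrow> ennreal) \<Rightarrow> ennreal) \<Rightarrow> bool" where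
  "equiv_ri_quasinorm L p r b N \<longleftrightarrow>
     sim_on (MM L) (\<lambda>f. N (modulus f)) (\<lambda>f. LKnorm L p r b (modulus f)) \<and>
     (\<forall>f\<in>MM L. N (modulus f) = N (rearr L (modulus f))) \<and>
     (\<forall>f\<in>MMplus L. N f = 0 \<longleftrightarrow> (AE x in lebesgue_on (einterval 0 L). f x = 0)) \<and>
     (\<forall>f\<in>MMplus L. \<forall>k\<ge>0. N (\<lambda>x. ennreal k * f x) = ennreal k * N f) \<and>
     (\<exists>C::real. C \<ge> 1 \<and>
        (\<forall>f\<in>MMplus L. \<forall>g\<in>MMplus L. N (\<lambda>x. f x + g x) \<le> ennreal C * (N f + N g))) \<and>
     (\<forall>f\<in>MMplus L. \<forall>g\<in>MMplus L.
        (AE x in lebesgue_on (einterval 0 L). g x \<le> f x) \<longrightarrow> N g \<le> N f) \<and>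
     (\<forall>f\<in>MMplus L. \<forall>F::nat \<Rightarrow> real \<Rightarrow> ennreal.
        (\<forall>n. F n \<in> MMplus L) \<and>
        (AE x in lebesgue_on (einterval 0 L). incseq (\<lambda>n. F n x) \<and> (\<lambda>n. F n x) \<longlonglongrightarrow> f x) \<and>
        (SUP n. N (F n)) < \<infinity> \<longrightarrow>
          N f < \<infinity> \<and> incseq (\<lambda>n. N (F n)) \<and> (\<lambda>n. N (F n)) \<longlonglongrightarrow> N f) \<and>
     (\<forall>\<omega>. \<omega> \<in> sets lebesgue \<and> bounded \<omega> \<and> \<omega> \<subseteq> einterval 0 L \<longrightarrow> N (indicator \<omega>) < \<infinity>)"

end

theory Submission
  imports Defs
begin

text \<open>
  Write \<open>F\<close> for \<open>f\<^sup>*\<^sup>*\<close>: either \<open>F\<close> is identically infinite, or it is non-increasing and continuous. Since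
  \<open>t F(t)\<close> is non-decreasing, \<open>F\<^sup>*\<close> and \<open>F\<close> agree on \<open>(0,L)\<close>. Slow variation gives
  \<open>d(s) \<le> K max(s/t, t/s)\<^sup>\<epsilon> d(t)\<close>. With \<open>W\<close> entering only through a constant, this bounds the average over
  \<open>(0,t)\<close> by a multiple of the supremum over \<open>v < t\<close> of \<open>(v/t)\<^sup>\<alpha> F(v)\<close>, for some \<open>\<alpha>\<close> between \<open>1/p\<close> and \<open>1/U\<close>.
  As \<open>F\<close> is non-increasing, this is at most the supremum over \<open>k\<close> of \<open>2\<close> to the power \<open>- k \<alpha>\<close> times the dilation of
  \<open>F\<close> by \<open>2\<close> to the power \<open>- k - 1\<close>. The norm of a dilation by \<open>\<kappa>\<close> is about \<open>\<kappa>\<close> to the power \<open>- 1/p\<close>, so the norms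
  of these terms decay geometrically. The average over \<open>(t,L)\<close> is treated in the same way with an exponent between
  \<open>1/V\<close> and \<open>1/p\<close>. Conversely each average dominates \<open>F\<close>, up to a dilation by \<open>1/2\<close>, because the
  interval \<open>(t/2,t)\<close> alone contributes enough. The quasi-triangle inequality is inherited from
  \<open>(f+g)\<^sup>*(t) \<le> f\<^sup>*(t/2) + g\<^sup>*(t/2)\<close>, the Fatou property from monotone convergence.
\<close>

section \<open>Powers in [0,\<infinity>] and Lebesgue norms over a measure\<close>

text \<open>The obstacle is that \<open>r\<close> and \<open>W\<close> range over (0,\<infinity>]
  independently, so neither Minkowski's inequality nor an ordering of the two exponents is at hand
  for a classical Hardy inequality. Monotonicity of F replaces both. The pointwise bound F(v) \<le>
  (t/v)^\<alpha> S(t), with S the supremum of weighted dilations, leaves a pure power of v inside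
  the average, and scaling evaluates its norm for every \<open>W\<close> alike. A supremum is used
  instead of a sum because its q-th power is at most the sum of the q-th powers, so geometric decay
  suffices for every \<open>r\<close>. The gap between 1/p and 1/U (or 1/V) is cut into four equal
  parts \<epsilon>: one absorbs \<open>d\<close>, one makes the remaining power integrable at the
  endpoint, one absorbs \<open>b\<close> under dilation, and the last is the decay rate
  2^(-\<epsilon>). All functions keep values in [0,\<infinity>], so an identically infinite F passes
  through the estimates without separate treatment.\<close>

lemma epow_0 [simp]: "epow 0 a = 0"
  by (simp add: epow_def)

lemma epow_top [simp]: "epow \<infinity> a = \<infinity>" "epow top a = \<infinity>"
  by (simp_all add: epow_def)

lemma epow_ennreal: "0 \<le> x \<Longrightarrow> epow (ennreal x) a = ennreal (x powr a)"
  by (simp add: epow_def)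

lemma epow_mono: assumes "x \<le> y" "0 < a" shows "epow x a \<le> epow y a"
proof (cases "y = \<infinity>")
  case False
  then have "x \<noteq> \<infinity>" using assms(1) by (auto simp: top_unique)
  then show ?thesis using False assms
    by (cases x; cases y) (auto simp: epow_ennreal ennreal_le_iff powr_mono2)
qed simp

lemma epow_mult: assumes "0 < a" shows "epow (x * y) a = epow x a * epow y a"
proof (cases x; cases y)
  fix s t :: real
  assume "0 \<le> s" "x = ennreal s" "0 \<le> t" "y = ennreal t"
  then show ?thesis
    by (simp add: epow_ennreal powr_mult flip: ennreal_mult)
next
  fix s :: real
  assume "0 \<le> s" "x = ennreal s" "y = top"
  then show ?thesis
    by (cases "s = 0") (auto simp: epow_ennreal ennreal_mult_top)
next
  fix t :: real
  assume "x = top" "0 \<le> t" "y = ennreal t"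
  then show ?thesis
    by (cases "t = 0") (auto simp: epow_ennreal ennreal_top_mult)
qed simp

lemma epow_epow: "epow (epow x a) c = epow x (a * c)"
  by (cases x) (auto simp: epow_ennreal powr_powr)

lemma epow_1 [simp]: "epow x 1 = x"
  by (cases x) (auto simp: epow_ennreal)

lemma epow_inverse: "0 < a \<Longrightarrow> epow (epow x a) (1 / a) = x" "0 < a \<Longrightarrow> epow (epow x (1 / a)) a = x"
  by (simp_all add: epow_epow)

text \<open>The powers \<open>a\<close> and \<open>1 / a\<close> are monotone and mutually inverse,
  so they form a Galois connection; vanishing of powers and commutation with suprema follow from
  it.\<close>

lemma epow_le_iff: assumes "0 < a" shows "epow x a \<le> y \<longleftrightarrow> x \<le> epow y (1 / a)"
  using epow_mono[of "epow x a" y "1/a"] epow_mono[of x "epow y (1/a)" a] assms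
  by (auto simp: epow_inverse)

lemma epow_eq_0_iff: assumes "0 < a" shows "epow x a = 0 \<longleftrightarrow> x = 0"
  using epow_le_iff[OF assms, of x 0] by auto

lemma epow_SUP:
  assumes "0 < a" shows "epow (SUP i\<in>A. f i) a = (SUP i\<in>A. epow (f i) a)"
proof (rule antisym)
  show "epow (SUP i\<in>A. f i) a \<le> (SUP i\<in>A. epow (f i) a)"
    unfolding epow_le_iff[OF assms]
    by (intro SUP_least) (auto simp: epow_le_iff[OF assms, symmetric] intro: SUP_upper)
  show "(SUP i\<in>A. epow (f i) a) \<le> epow (SUP i\<in>A. f i) a"
    by (intro SUP_least epow_mono SUP_upper assms)
qed

text \<open>The bound x + y \<le> 2 max(x,y) is crude, but it holds for powers below and above 1
  alike, and only the existence of a constant matters.\<close>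

lemma epow_add_le:
  assumes "0 < a" shows "epow (x + y) a \<le> ennreal (2 powr a) * (epow x a + epow y a)"
proof -
  have "x + y \<le> ennreal 2 * max x y"
    using add_mono[of x "max x y" y "max x y"] by (simp add: mult_2)
  then have "epow (x + y) a \<le> ennreal (2 powr a) * epow (max x y) a"
    using epow_mono[OF _ assms, of "x + y" "ennreal 2 * max x y"]
    by (simp only: epow_mult[OF assms]) (simp only: epow_ennreal)
  also have "epow (max x y) a \<le> epow x a + epow y a"
    by (cases "x \<le> y") (auto simp: max_def)
  finally show ?thesis by (simp add: mult_left_mono)
qed

lemma borel_measurable_epow [measurable]:
  assumes [measurable]: "f \<in> borel_measurable M"
  shows "(\<lambda>x. epow (f x) a) \<in> borel_measurable M"
  unfolding epow_def by measurable

lemma recip_pos: assumes "0 < q" "q \<noteq> \<infinity>" shows "0 < recip q" "recip q = 1 / enn2real q" "0 < enn2real q"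
  using assms by (cases q; auto simp: recip_def inverse_ennreal field_simps)+

lemma recip_top [simp]: "recip \<infinity> = 0" "recip top = 0"
  by (simp_all add: recip_def)

lemma recip_nonneg: "0 \<le> recip q"
  by (simp add: recip_def)

lemma recip_less: assumes "0 < p" "p < q" shows "recip q < recip p"
proof (cases q)
  case (real y)
  then obtain x where x: "p = ennreal x" "0 < x"
    using assms by (cases p) auto
  then show ?thesis using real assms
    by (auto simp: recip_def inverse_ennreal ennreal_less_iff)
next
  case top
  then show ?thesis using recip_pos[of p] assms by auto
qed

lemma recip_1: "recip 1 = 1"
  by (simp add: recip_def)

text \<open>If y < x then y is finite and is itself a violating test value. Together with
  \<open>less_rearr_iff\<close> this reduces inequalities between rearrangements to inequalities
  between distribution functions.\<close>

lemma ennreal_le_reals: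
  assumes "\<And>s. 0 \<le> s \<Longrightarrow> ennreal s < x \<Longrightarrow> ennreal s < y"
  shows "x \<le> y"
proof (rule ccontr)
  assume "\<not> x \<le> y"
  then have "y < x" by simp
  then obtain s where "y = ennreal s" "0 \<le> s" by (cases y) auto
  with assms[of s] \<open>y < x\<close> show False by auto
qed

text \<open>\<open>Lnorm\<close> over an arbitrary measure space, so that the norm facts apply
  equally to \<open>lebesgue_on\<close> of intervals, half-lines and intersections.\<close>

definition Lq :: "ennreal \<Rightarrow> 'a measure \<Rightarrow> ('a \<Rightarrow> ennreal) \<Rightarrow> ennreal" where
  "Lq q M g = (if q = \<infinity> then esssup M g
      else epow (\<integral>\<^sup>+ v. epow (g v) (enn2real q) \<partial>M) (recip q))"

lemma Lnorm_eq_Lq: "Lnorm q a c g = Lq q (lebesgue_on (einterval a c)) g"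
  by (simp add: Lnorm_def Lq_def)

lemma Lq_finite:
  assumes "0 < q" "q \<noteq> \<infinity>"
  shows "Lq q M g = epow (\<integral>\<^sup>+ v. epow (g v) (enn2real q) \<partial>M) (1 / enn2real q)"
  using recip_pos[OF assms] assms by (simp add: Lq_def)

lemma epow_Lq:
  assumes "0 < q" "q \<noteq> \<infinity>"
  shows "epow (Lq q M g) (enn2real q) = (\<integral>\<^sup>+ v. epow (g v) (enn2real q) \<partial>M)"
  using recip_pos[OF assms] by (simp add: Lq_finite[OF assms] epow_inverse)

lemma Lq_mono_AE:
  assumes "0 < q" "AE x in M. g x \<le> h x" "g \<in> borel_measurable M"
  shows "Lq q M g \<le> Lq q M h"
proof (cases "q = \<infinity>")
  case True
  then show ?thesis using assms by (simp add: Lq_def esssup_AE_mono)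
next
  case False
  show ?thesis
    using assms recip_pos[OF assms(1) False]
    by (auto simp: Lq_finite[OF assms(1) False] intro!: epow_mono nn_integral_mono_AE)
qed

lemma Lq_mono:
  assumes "0 < q" "\<And>x. x \<in> space M \<Longrightarrow> g x \<le> h x" "g \<in> borel_measurable M"
  shows "Lq q M g \<le> Lq q M h"
  using assms by (intro Lq_mono_AE) auto

lemma Lq_cong:
  assumes "\<And>x. x \<in> space M \<Longrightarrow> g x = h x"
  shows "Lq q M g = Lq q M h"
proof (cases "q = \<infinity>")
  case True
  \<comment> \<open>\<open>esssup\<close> takes a default value on non-measurable functions, so it
    must first be known that both functions fall into the same case.\<close>
  have "g \<in> borel_measurable M \<longleftrightarrow> h \<in> borel_measurable M"
    using assms by (rule measurable_cong)
  then have "esssup M g = esssup M h"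
    using assms
    by (cases "g \<in> borel_measurable M") (auto simp: esssup_non_measurable intro!: esssup_AE_cong)
  then show ?thesis using True by (simp add: Lq_def)
next
  case False
  then show ?thesis using assms by (simp add: Lq_def cong: nn_integral_cong)
qed

lemma Lq_le_const:
  assumes "q = \<infinity>" "g \<in> borel_measurable M" "\<And>x. x \<in> space M \<Longrightarrow> g x \<le> c"
  shows "Lq q M g \<le> c"
  using assms by (auto simp: Lq_def intro!: esssup_I)

lemma Lq_zero [simp]: assumes "0 < q" shows "Lq q M (\<lambda>x. 0) = 0"
proof (cases "q = \<infinity>")
  case True
  then have "Lq q M (\<lambda>x. 0) \<le> 0" by (intro Lq_le_const) auto
  then show ?thesis by simp
next
  case False
  then show ?thesis using assms by (simp add: Lq_finite)
qed

lemma Lq_eq_0_iff: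
  assumes "0 < q" "g \<in> borel_measurable M"
  shows "Lq q M g = 0 \<longleftrightarrow> (AE x in M. g x = 0)"
proof (cases "q = \<infinity>")
  case True
  have "esssup M g = 0 \<longleftrightarrow> (AE x in M. g x = 0)"
    using esssup_AE[of g M] esssup_I[OF assms(2), of 0] by auto
  then show ?thesis using True by (simp add: Lq_def)
next
  case False
  then show ?thesis
    using recip_pos[OF assms(1) False] assms
    by (simp add: Lq_finite epow_eq_0_iff nn_integral_0_iff_AE)
qed

lemma Lq_cmult:
  assumes q: "0 < q" and k: "0 \<le> k" and [measurable]: "g \<in> borel_measurable M"
  shows "Lq q M (\<lambda>x. ennreal k * g x) = ennreal k * Lq q M g"
proof (cases "q = \<infinity>")
  case True
  \<comment> \<open>One inequality for all factors and functions is enough: applied to the factor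
    1/k and the function k g it gives the reverse one.\<close>
  have le: "Lq q M (\<lambda>x. ennreal k * g x) \<le> ennreal k * Lq q M g"
    if [measurable]: "g \<in> borel_measurable M" for k g
    using esssup_AE[of g M] True by (auto simp: Lq_def intro!: esssup_I elim!: eventually_mono mult_left_mono)
  show ?thesis
  proof (cases "k = 0")
    case True then show ?thesis using q by simp
  next
    case False
    have inv: "ennreal (1/k) * (ennreal k * x) = x" "ennreal k * (ennreal (1/k) * x) = x" for x
      using False k by (simp_all add: mult.assoc[symmetric] ennreal_mult[symmetric])
    have "Lq q M g \<le> ennreal (1/k) * Lq q M (\<lambda>x. ennreal k * g x)"
      using le[of "\<lambda>x. ennreal k * g x" "1/k"] by (simp add: inv)
    from mult_left_mono[OF this, of "ennreal k"] have "ennreal k * Lq q M g \<le> Lq q M (\<lambda>x. ennreal k * g x)"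
      by (simp add: inv)
    with le[of g k] show ?thesis by (simp add: antisym)
  qed
next
  case False
  note * = recip_pos[OF q False]
  show ?thesis
    using * by (simp add: Lq_finite[OF q False] epow_mult nn_integral_cmult epow_inverse)
qed

lemma Lq_SUP:
  assumes q: "0 < q" and [measurable]: "\<And>n. G n \<in> borel_measurable M"
    and inc: "\<And>x. x \<in> space M \<Longrightarrow> incseq (\<lambda>n. G n x)"
  shows "Lq q M (\<lambda>x. SUP n::nat. G n x) = (SUP n. Lq q M (G n))"
proof (cases "q = \<infinity>")
  case True
  have "esssup M (\<lambda>x. SUP n. G n x) \<le> (SUP n. esssup M (G n))"
  proof (rule esssup_I)
    have "AE x in M. \<forall>n. G n x \<le> esssup M (G n)"
      by (simp add: AE_all_countable esssup_AE)
    then show "AE x in M. (SUP n. G n x) \<le> (SUP n. esssup M (G n))"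
      by eventually_elim (intro SUP_mono, auto)
  qed measurable
  moreover have "(SUP n. esssup M (G n)) \<le> esssup M (\<lambda>x. SUP n. G n x)"
    by (intro SUP_least esssup_mono) (auto intro: SUP_upper)
  ultimately show ?thesis using True by (simp add: Lq_def antisym)
next
  case False
  note * = recip_pos[OF q False]
  have "(\<integral>\<^sup>+ x. (SUP n. epow (G n x) (enn2real q)) \<partial>M) = (SUP n. \<integral>\<^sup>+ x. epow (G n x) (enn2real q) \<partial>M)"
    by (rule nn_integral_monotone_convergence_SUP_AE)
      (use inc * in \<open>auto simp: incseq_Suc_iff intro!: epow_mono AE_I2\<close>)
  then show ?thesis using * by (simp add: Lq_finite[OF q False] epow_SUP)
qed

lemma Lq_add_le:
  assumes q: "0 < q"
  obtains C where "0 < C"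
    "\<And>(M::'a measure) g h. g \<in> borel_measurable M \<Longrightarrow> h \<in> borel_measurable M \<Longrightarrow>
       Lq q M (\<lambda>x. g x + h x) \<le> ennreal C * (Lq q M g + Lq q M h)"
proof (cases "q = \<infinity>")
  case True
  have "Lq q M (\<lambda>x. g x + h x) \<le> ennreal 1 * (Lq q M g + Lq q M h)"
    if [measurable]: "g \<in> borel_measurable M" "h \<in> borel_measurable M" for g h and M :: "'a measure"
  proof -
    have "AE x in M. g x + h x \<le> esssup M g + esssup M h"
      using esssup_AE[of g M] esssup_AE[of h M] by eventually_elim (rule add_mono)
    then show ?thesis using True by (auto simp: Lq_def intro!: esssup_I)
  qed
  then show ?thesis using that[of 1] by simp
next
  case False
  note * = recip_pos[OF q False]
  let ?q = "enn2real q"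
  \<comment> \<open>The factor 2 is the constant 2^q of the inner power after taking the q-th root;
    2^(1/q) is the price of splitting the outer root.\<close>
  let ?C = "2 powr (1 / ?q) * 2"
  have "Lq q M (\<lambda>x. g x + h x) \<le> ennreal ?C * (Lq q M g + Lq q M h)"
    if [measurable]: "g \<in> borel_measurable M" "h \<in> borel_measurable M" for g h and M :: "'a measure"
  proof -
    have "(\<integral>\<^sup>+ x. epow (g x + h x) ?q \<partial>M) \<le> (\<integral>\<^sup>+ x. ennreal (2 powr ?q) * (epow (g x) ?q + epow (h x) ?q) \<partial>M)"
      using * by (intro nn_integral_mono epow_add_le)
    also have "\<dots> = ennreal (2 powr ?q) * ((\<integral>\<^sup>+ x. epow (g x) ?q \<partial>M) + (\<integral>\<^sup>+ x. epow (h x) ?q \<partial>M))"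
      by (simp add: nn_integral_cmult nn_integral_add)
    finally have "Lq q M (\<lambda>x. g x + h x) \<le> epow (ennreal (2 powr ?q) * ((\<integral>\<^sup>+ x. epow (g x) ?q \<partial>M) + (\<integral>\<^sup>+ x. epow (h x) ?q \<partial>M))) (1 / ?q)"
      using * by (simp add: Lq_finite[OF q False] epow_mono)
    also have "\<dots> = ennreal 2 * epow ((\<integral>\<^sup>+ x. epow (g x) ?q \<partial>M) + (\<integral>\<^sup>+ x. epow (h x) ?q \<partial>M)) (1 / ?q)"
      using * by (subst epow_mult, simp, subst epow_ennreal) (simp_all add: powr_powr)
    also have "\<dots> \<le> ennreal 2 * (ennreal (2 powr (1 / ?q)) * (Lq q M g + Lq q M h))"
      using * by (intro mult_left_mono) (auto simp: Lq_finite[OF q False] intro!: epow_add_le)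
    also have "\<dots> = ennreal ?C * (Lq q M g + Lq q M h)"
      by (simp only: mult.assoc[symmetric] ennreal_mult[symmetric] powr_ge_zero zero_le_numeral mult.commute)
    finally show ?thesis .
  qed
  then show ?thesis using that[of ?C] by simp
qed

text \<open>For finite \<open>q\<close> the q-th power of the supremum is dominated by the sum of
  the q-th powers, which is a geometric series of ratio \<theta>^q; for \<open>q\<close> infinite
  each term is already bounded by \<open>A\<close>. The constant depends on \<open>q\<close> and
  \<theta> alone.\<close>

lemma Lq_SUP_geometric:
  assumes q: "0 < q" and th: "0 < \<theta>" "\<theta> < 1"
  obtains C where "0 < C"
    "\<And>(M::'a measure) G A. (\<And>k::nat. G k \<in> borel_measurable M) \<Longrightarrow>
       (\<And>k. Lq q M (G k) \<le> ennreal (\<theta> ^ k) * A) \<Longrightarrow> Lq q M (\<lambda>x. SUP k. G k x) \<le> ennreal C * A"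
proof (cases "q = \<infinity>")
  case True
  have "Lq q M (\<lambda>x. SUP k. G k x) \<le> ennreal 1 * A"
    if [measurable]: "\<And>k::nat. G k \<in> borel_measurable M"
      and le: "\<And>k. Lq q M (G k) \<le> ennreal (\<theta> ^ k) * A" for A G and M :: "'a measure"
  proof -
    have "Lq q M (G k) \<le> A" for k
    proof -
      have "ennreal (\<theta> ^ k) * A \<le> 1 * A"
        using th by (intro mult_right_mono) (auto simp: power_le_one)
      with le[of k] show ?thesis by simp
    qed
    then have "AE x in M. G k x \<le> A" for k
      using esssup_AE[of "G k" M] True by (auto simp: Lq_def elim!: eventually_mono intro: order_trans)
    then have "AE x in M. \<forall>k. G k x \<le> A" by (simp add: AE_all_countable)
    then have "AE x in M. (SUP k. G k x) \<le> A" by eventually_elim (auto intro: SUP_least)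
    then show ?thesis using True by (auto simp: Lq_def intro!: esssup_I)
  qed
  then show ?thesis using that[of 1] by simp
next
  case False
  note * = recip_pos[OF q False]
  let ?q = "enn2real q"
  define \<eta> where "\<eta> = \<theta> powr ?q"
  have eta: "0 < \<eta>" "\<eta> < 1"
    using th * powr_less_mono2[of ?q \<theta> 1] by (auto simp: \<eta>_def)
  let ?C = "(1 / (1 - \<eta>)) powr (1 / ?q)"
  have "Lq q M (\<lambda>x. SUP k. G k x) \<le> ennreal ?C * A"
    if [measurable]: "\<And>k::nat. G k \<in> borel_measurable M"
      and le: "\<And>k. Lq q M (G k) \<le> ennreal (\<theta> ^ k) * A" for A G and M :: "'a measure"
  proof -
    have "(\<integral>\<^sup>+ x. epow (SUP k. G k x) ?q \<partial>M) \<le> (\<integral>\<^sup>+ x. (\<Sum>k. epow (G k x) ?q) \<partial>M)"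
    proof (rule nn_integral_mono)
      fix x
      have "epow (G k x) ?q \<le> (\<Sum>k. epow (G k x) ?q)" for k
        using sum_le_suminf[of "\<lambda>k. epow (G k x) ?q" "{k}"] by simp
      then show "epow (SUP k. G k x) ?q \<le> (\<Sum>k. epow (G k x) ?q)"
        using * by (simp add: epow_SUP SUP_least)
    qed
    also have "\<dots> = (\<Sum>k. \<integral>\<^sup>+ x. epow (G k x) ?q \<partial>M)"
      by (rule nn_integral_suminf) measurable
    also have "\<dots> \<le> (\<Sum>k. ennreal (\<eta> ^ k) * epow A ?q)"
    proof (intro suminf_le)
      fix k
      have "(\<integral>\<^sup>+ x. epow (G k x) ?q \<partial>M) \<le> epow (ennreal (\<theta> ^ k) * A) ?q"
        using * le[of k] by (simp add: epow_Lq[OF q False, symmetric] epow_mono)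
      also have "\<dots> = ennreal (\<eta> ^ k) * epow A ?q"
        using * th by (simp add: epow_mult epow_ennreal \<eta>_def powr_power powr_powr mult.commute
            flip: powr_realpow)
      finally show "(\<integral>\<^sup>+ x. epow (G k x) ?q \<partial>M) \<le> ennreal (\<eta> ^ k) * epow A ?q" .
    qed simp_all
    also have "\<dots> = (\<Sum>k. ennreal (\<eta> ^ k)) * epow A ?q"
      by (rule ennreal_suminf_multc)
    also have "(\<Sum>k. ennreal (\<eta> ^ k)) = ennreal (1 / (1 - \<eta>))"
      using geometric_sums[of \<eta>] eta by (intro suminf_ennreal_eq) auto
    finally have "Lq q M (\<lambda>x. SUP k. G k x) \<le> epow (ennreal (1 / (1 - \<eta>)) * epow A ?q) (1 / ?q)"
      using * by (simp add: Lq_finite[OF q False] epow_mono)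
    also have "\<dots> = ennreal ?C * A"
      using * eta by (simp add: epow_mult epow_ennreal epow_inverse)
    finally show ?thesis .
  qed
  then show ?thesis using that[of ?C] eta by simp
qed

section \<open>Rearrangements\<close>

lemma einterval_0_iff: "t \<in> einterval 0 L \<longleftrightarrow> 0 < t \<and> ereal t < L"
  by (auto simp: einterval_iff)

lemma einterval_0_ereal: "einterval 0 (ereal t) = {0<..<t}"
  by (auto simp: einterval_iff)

lemma einterval_down: "t \<in> einterval 0 L \<Longrightarrow> 0 < s \<Longrightarrow> s \<le> t \<Longrightarrow> s \<in> einterval 0 L"
  by (auto simp: einterval_0_iff intro: le_less_trans[of "ereal s" "ereal t"])

lemma sets_einterval [measurable, simp]: "einterval a c \<in> sets lebesgue"
  by simp

lemma space_lebesgue_on_einterval [simp]: "space (lebesgue_on (einterval a c)) = einterval a c"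
  by (simp add: space_restrict_space)

lemma measurable_lebesgue_onI:
  assumes "f \<in> borel_measurable (borel :: real measure)"
  shows "f \<in> borel_measurable (lebesgue_on A)"
  using assms by (intro measurable_restrict_space1 measurable_completion) simp

lemma measurable_lebesgue_on_subset:
  assumes "f \<in> borel_measurable (lebesgue_on B)" "A \<subseteq> B"
  shows "f \<in> borel_measurable (lebesgue_on A)"
  using assms by (rule measurable_restrict_mono)

text \<open>Superlevel sets of a monotone function on an interval are intervals, whichever the
  direction of monotonicity; this criterion therefore serves both directions below.\<close>

lemma borel_measurable_interval_levels:
  fixes f :: "real \<Rightarrow> ennreal"
  assumes "\<And>y. is_interval {x\<in>A. y < f x}"
  shows "f \<in> borel_measurable (lebesgue_on A)"
proof (rule borel_measurableI_greater)
  fix y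
  have "{x\<in>A. y < f x} \<in> sets borel"
    using assms by (rule real_interval_borel_measurable)
  then have "{x\<in>A. y < f x} \<in> sets lebesgue" by simp
  then show "{x \<in> space (lebesgue_on A). y < f x} \<in> sets (lebesgue_on A)"
    by (auto simp: space_restrict_space sets_restrict_space intro!: image_eqI[of _ _ "{x\<in>A. y < f x}"])
qed

lemma is_interval_einterval: "is_interval (einterval a c)"
  unfolding is_interval_1
proof safe
  fix s t x assume "s \<in> einterval a c" "t \<in> einterval a c" "s \<le> x" "x \<le> t"
  then have "a < ereal s" "ereal s \<le> ereal x" "ereal x \<le> ereal t" "ereal t < c"
    by (auto simp: einterval_iff)
  then show "x \<in> einterval a c"
    unfolding einterval_iff by (blast intro: less_le_trans le_less_trans)
qed

lemma antimono_on_borel_measurable: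
  fixes f :: "real \<Rightarrow> ennreal"
  assumes "is_interval A" "\<And>x y. x \<in> A \<Longrightarrow> y \<in> A \<Longrightarrow> x \<le> y \<Longrightarrow> f y \<le> f x"
  shows "f \<in> borel_measurable (lebesgue_on A)"
proof (rule borel_measurable_interval_levels)
  fix z
  show "is_interval {x\<in>A. z < f x}"
    unfolding is_interval_1
  proof safe
    fix s t x assume st: "s \<in> A" "t \<in> A" "z < f s" "z < f t" "s \<le> x" "x \<le> t"
    with assms(1) show x: "x \<in> A" unfolding is_interval_1 by blast
    show "z < f x" by (rule less_le_trans[OF st(4) assms(2)]) (use st x in auto)
  qed
qed

lemma mono_on_borel_measurable:
  fixes f :: "real \<Rightarrow> ennreal"
  assumes "is_interval A" "\<And>x y. x \<in> A \<Longrightarrow> y \<in> A \<Longrightarrow> x \<le> y \<Longrightarrow> f x \<le> f y"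
  shows "f \<in> borel_measurable (lebesgue_on A)"
proof (rule borel_measurable_interval_levels)
  fix z
  show "is_interval {x\<in>A. z < f x}"
    unfolding is_interval_1
  proof safe
    fix s t x assume st: "s \<in> A" "t \<in> A" "z < f s" "z < f t" "s \<le> x" "x \<le> t"
    with assms(1) show x: "x \<in> A" unfolding is_interval_1 by blast
    show "z < f x" by (rule less_le_trans[OF st(3) assms(2)]) (use st x in auto)
  qed
qed

lemma lebesgue_measurable_times: "(\<lambda>x::real. c * x) \<in> lebesgue \<rightarrow>\<^sub>M lebesgue"
proof -
  have "(\<lambda>x::real. c * x) = (*\<^sub>R) c" by (auto simp: fun_eq_iff)
  then show ?thesis using lebesgue_measurable_scaling[of c] by (simp only:)
qed

lemma nn_integral_lebesgue_scale:
  assumes [measurable]: "f \<in> borel_measurable lebesgue" and c: "0 < c"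
  shows "(\<integral>\<^sup>+ x. f x \<partial>lebesgue) = ennreal c * (\<integral>\<^sup>+ x. f (c * x) \<partial>lebesgue)"
proof -
  note [measurable] = lebesgue_measurable_times[of c]
  have "(\<integral>\<^sup>+ x. f x \<partial>lebesgue) = (\<integral>\<^sup>+ x. f x \<partial>density (distr lebesgue lebesgue (\<lambda>x. 0 + c * x)) (\<lambda>_. ennreal \<bar>c\<bar>))"
    using lebesgue_real_affine[of c 0] c by simp
  also have "\<dots> = ennreal c * (\<integral>\<^sup>+ x. f (c * x) \<partial>lebesgue)"
    using c by (simp add: nn_integral_density nn_integral_distr nn_integral_cmult)
  finally show ?thesis .
qed

lemma borel_measurable_lebesgue_on_scale:
  fixes f :: "real \<Rightarrow> ennreal"
  assumes "f \<in> borel_measurable (lebesgue_on A)" "A \<in> sets lebesgue" "0 < c"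
  shows "(\<lambda>x. if c * x \<in> A then f (c * x) else (0::ennreal)) \<in> borel_measurable lebesgue"
proof -
  have 1: "(\<lambda>x. if x \<in> A then f x else 0) \<in> borel_measurable lebesgue"
  proof -
    have "(\<lambda>x. if x \<in> A then f x else 0) = (\<lambda>x. f x * indicator A x)"
      by (auto simp: indicator_def)
    then show ?thesis
      using assms(1,2) borel_measurable_restrict_space_iff_ennreal[of A lebesgue f] by simp
  qed
  show ?thesis
    using measurable_compose[OF lebesgue_measurable_times 1] by simp
qed

section \<open>The distribution function and its generalised inverse, the rearrangement\<close>

definition dfun :: "ereal \<Rightarrow> (real \<Rightarrow> ennreal) \<Rightarrow> real \<Rightarrow> ennreal" where
  "dfun L g s = emeasure (lebesgue_on (einterval 0 L)) {x \<in> einterval 0 L. ennreal s < g x}"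

lemma rearr_dfun: "rearr L g t = (INF s\<in>{s. 0 < s \<and> dfun L g s \<le> ennreal t}. ennreal s)"
  unfolding rearr_def dfun_def by (subst emeasure_restrict_space) auto

lemma level_sets [measurable]:
  assumes "g \<in> borel_measurable (lebesgue_on (einterval 0 L))"
  shows "{x \<in> einterval 0 L. ennreal s < g x} \<in> sets (lebesgue_on (einterval 0 L))"
  using borel_measurable_less[OF measurable_const assms, of "ennreal s"]
  by simp

lemma dfun_antimono:
  assumes "g \<in> borel_measurable (lebesgue_on (einterval 0 L))" "s \<le> s'"
  shows "dfun L g s' \<le> dfun L g s"
  unfolding dfun_def
  using assms by (intro emeasure_mono level_sets) (auto intro: le_less_trans ennreal_leI)

lemma dfun_mono:
  assumes "h \<in> borel_measurable (lebesgue_on (einterval 0 L))"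
    "AE x in lebesgue_on (einterval 0 L). g x \<le> h x"
  shows "dfun L g s \<le> dfun L h s"
  unfolding dfun_def
  using assms by (intro emeasure_mono_AE level_sets) (auto elim!: eventually_mono)

text \<open>The level sets at s + 1/(n+1) increase to the level set at s, so continuity of the
  measure from below carries a strict inequality to a slightly higher level. This is what makes
  \<open>less_rearr_iff\<close> an equivalence.\<close>

lemma dfun_right_continuous:
  assumes g: "g \<in> borel_measurable (lebesgue_on (einterval 0 L))" and "0 \<le> s" "y < dfun L g s"
  obtains s' where "s < s'" "y < dfun L g s'"
proof -
  define A where "A n = {x \<in> einterval 0 L. ennreal (s + 1 / Suc n) < g x}" for n
  have U: "(\<Union>n. A n) = {x \<in> einterval 0 L. ennreal s < g x}"
  proof safe
    fix n x assume "x \<in> A n"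
    moreover have "ennreal s \<le> ennreal (s + 1 / Suc n)" by (intro ennreal_leI) simp
    ultimately show "x \<in> einterval 0 L" "ennreal s < g x" by (auto simp: A_def intro: le_less_trans)
  next
    fix x assume x: "x \<in> einterval 0 L" "ennreal s < g x"
    obtain s' where s': "s < s'" "ennreal s' < g x"
    proof (cases "g x")
      case (real r)
      then show ?thesis using x assms(2) dense[of s r] that by (auto simp: ennreal_less_iff)
    next
      case top
      then show ?thesis using that[of "s + 1"] by simp
    qed
    obtain n where "1 / Suc n < s' - s" using nat_approx_posE[of "s' - s"] s' by auto
    then have "ennreal (s + 1 / Suc n) \<le> ennreal s'" by (intro ennreal_leI) simp
    with s' have "ennreal (s + 1 / Suc n) < g x" by (auto intro: le_less_trans)
    then show "x \<in> (\<Union>n. A n)" using x by (auto simp: A_def)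
  qed
  have "incseq A"
    unfolding incseq_Suc_iff
  proof
    fix n
    have "ennreal (s + 1 / Suc (Suc n)) \<le> ennreal (s + 1 / Suc n)"
      by (intro ennreal_leI) (simp add: field_simps)
    then show "A n \<subseteq> A (Suc n)" by (auto simp: A_def intro: le_less_trans)
  qed
  moreover have "range A \<subseteq> sets (lebesgue_on (einterval 0 L))"
    unfolding A_def using level_sets[OF g] by blast
  ultimately have "dfun L g s = (SUP n. emeasure (lebesgue_on (einterval 0 L)) (A n))"
    unfolding dfun_def U[symmetric]
    by (rule SUP_emeasure_incseq[symmetric, rotated])
  with assms(3) obtain n where "y < emeasure (lebesgue_on (einterval 0 L)) (A n)"
    by (auto simp: less_SUP_iff)
  then show thesis by (intro that[of "s + 1 / Suc n"]) (auto simp: dfun_def A_def)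
qed

text \<open>The rearrangement is the generalised inverse of the distribution function. Strictness on
  both sides rests on right continuity: the infimum is attained, apart from the excluded level
  0.\<close>

lemma less_rearr_iff:
  assumes g: "g \<in> borel_measurable (lebesgue_on (einterval 0 L))" and s: "0 \<le> s"
  shows "ennreal s < rearr L g t \<longleftrightarrow> ennreal t < dfun L g s"
proof
  assume less: "ennreal s < rearr L g t"
  obtain s' where s': "s < s'" "ennreal s' < rearr L g t"
  proof (cases "rearr L g t")
    case (real r)
    then show ?thesis using less s dense[of s r] that by (auto simp: ennreal_less_iff)
  next
    case top
    then show ?thesis using that[of "s + 1"] by simp
  qed
  have "\<not> dfun L g s' \<le> ennreal t"
  proof
    assume "dfun L g s' \<le> ennreal t"
    then have "rearr L g t \<le> ennreal s'"
      unfolding rearr_dfun using s s' by (intro INF_lower) auto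
    with s' show False by simp
  qed
  with dfun_antimono[OF g, of s s'] s' show "ennreal t < dfun L g s" by simp
next
  assume "ennreal t < dfun L g s"
  then obtain s' where s': "s < s'" "ennreal t < dfun L g s'"
    using dfun_right_continuous[OF g s] by blast
  have "ennreal s' \<le> rearr L g t"
    unfolding rearr_dfun
  proof (intro INF_greatest ennreal_leI)
    fix a assume "a \<in> {s. 0 < s \<and> dfun L g s \<le> ennreal t}"
    then show "s' \<le> a"
      using dfun_antimono[OF g, of a s'] s' by (cases "s' \<le> a") auto
  qed
  moreover have "ennreal s < ennreal s'" using s s' by (simp add: ennreal_less_iff)
  ultimately show "ennreal s < rearr L g t" by simp
qed

lemma rearr_antimono: "s \<le> t \<Longrightarrow> rearr L g t \<le> rearr L g s"
  unfolding rearr_dfun by (intro INF_superset_mono) (auto intro: order_trans ennreal_leI)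

lemma rearr_borel_measurable: "rearr L g \<in> borel_measurable (lebesgue_on A)"
proof -
  have "rearr L g \<in> borel_measurable (lebesgue_on UNIV)"
    by (rule antimono_on_borel_measurable) (auto intro: rearr_antimono)
  then show ?thesis by (rule measurable_lebesgue_on_subset) simp
qed

lemma rearr_scaled_measurable [measurable]: "(\<lambda>u. rearr L g (t * u)) \<in> borel_measurable (lebesgue_on A)"
proof -
  have "(\<lambda>u. rearr L g (t * u)) \<in> borel_measurable (lebesgue_on UNIV)"
  proof (cases "0 \<le> t")
    case True
    then show ?thesis
      by (intro antimono_on_borel_measurable) (auto intro!: rearr_antimono mult_left_mono)
  next
    case False
    then show ?thesis
      by (intro mono_on_borel_measurable) (auto intro!: rearr_antimono mult_left_mono_neg)
  qed
  then show ?thesis by (rule measurable_lebesgue_on_subset) simp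
qed

lemma rearr_mono:
  assumes "g \<in> borel_measurable (lebesgue_on (einterval 0 L))" "h \<in> borel_measurable (lebesgue_on (einterval 0 L))"
    "AE x in lebesgue_on (einterval 0 L). g x \<le> h x"
  shows "rearr L g t \<le> rearr L h t"
  using dfun_mono[OF assms(2,3)]
  by (intro ennreal_le_reals) (auto simp: less_rearr_iff assms intro: less_le_trans)

lemma rearr_cmult:
  assumes [measurable]: "g \<in> borel_measurable (lebesgue_on (einterval 0 L))" and k: "0 < k"
  shows "rearr L (\<lambda>x. ennreal k * g x) t = ennreal k * rearr L g t"
proof -
  have inv: "ennreal (1/k) * (ennreal k * x) = x" "ennreal k * (ennreal (1/k) * x) = x" for x
    using k by (simp_all add: mult.assoc[symmetric] ennreal_mult[symmetric])
  have le: "rearr L (\<lambda>x. ennreal k * g x) t \<le> ennreal k * rearr L g t"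
    if [measurable]: "g \<in> borel_measurable (lebesgue_on (einterval 0 L))" and k: "0 < k" for k g
  proof (rule ennreal_le_reals)
    have inv: "ennreal (1/k) * (ennreal k * x) = x" "ennreal k * (ennreal (1/k) * x) = x" for x
      using k by (simp_all add: mult.assoc[symmetric] ennreal_mult[symmetric])
    have iff: "ennreal s < ennreal k * x \<longleftrightarrow> ennreal (s / k) < x" if "0 \<le> s" for s x
    proof -
      have "ennreal k * x \<le> ennreal s \<longleftrightarrow> x \<le> ennreal (s / k)"
        using k that mult_left_mono[of "ennreal k * x" "ennreal s" "ennreal (1 / k)"]
          mult_left_mono[of x "ennreal (s / k)" "ennreal k"]
        by (auto simp: inv ennreal_mult[symmetric])
      then show ?thesis by (simp flip: not_le)
    qed
    fix s assume s: "0 \<le> (s::real)" and "ennreal s < rearr L (\<lambda>x. ennreal k * g x) t"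
    then have "ennreal t < dfun L (\<lambda>x. ennreal k * g x) s"
      by (subst (asm) less_rearr_iff) auto
    also have "dfun L (\<lambda>x. ennreal k * g x) s = dfun L g (s / k)"
      unfolding dfun_def using iff[OF s] by simp
    finally show "ennreal s < ennreal k * rearr L g t"
      unfolding iff[OF s] using s k by (subst less_rearr_iff) auto
  qed
  have "rearr L g t \<le> ennreal (1 / k) * rearr L (\<lambda>x. ennreal k * g x) t"
    using le[of "\<lambda>x. ennreal k * g x" "1 / k"] k by (simp add: inv)
  from mult_left_mono[OF this, of "ennreal k"] le[of g k] k show ?thesis
    by (simp add: inv antisym)
qed

text \<open>A strict level s < sup F_n is passed by some F_n already, so the indicators of the level
  sets increase to that of the limit; monotone convergence of the distribution functions then gives
  one \<open>n\<close> for which t is exceeded.\<close>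

lemma rearr_SUP:
  assumes [measurable]: "f \<in> borel_measurable (lebesgue_on (einterval 0 L))"
    "\<And>n. F n \<in> borel_measurable (lebesgue_on (einterval 0 L))"
    and lim: "AE x in lebesgue_on (einterval 0 L). incseq (\<lambda>n. F n x) \<and> f x = (SUP n::nat. F n x)"
  shows "rearr L f t = (SUP n. rearr L (F n) t)"
proof (rule antisym)
  let ?M = "lebesgue_on (einterval 0 L)"
  have dfun_int: "dfun L g s = (\<integral>\<^sup>+ x. indicator {y. ennreal s < g y} x \<partial>?M)"
    if [measurable]: "g \<in> borel_measurable ?M" for g s
  proof -
    have "(\<integral>\<^sup>+ x. indicator {y. ennreal s < g y} x \<partial>?M) = (\<integral>\<^sup>+ x. indicator {x \<in> einterval 0 L. ennreal s < g x} x \<partial>?M)"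
      by (intro nn_integral_cong) (auto simp: indicator_def)
    then show ?thesis using level_sets[OF that] by (simp add: dfun_def)
  qed
  show "rearr L f t \<le> (SUP n. rearr L (F n) t)"
  proof (rule ennreal_le_reals)
    fix s assume s: "0 \<le> s" "ennreal s < rearr L f t"
    then have "ennreal t < dfun L f s" by (simp add: less_rearr_iff)
    also have "dfun L f s = (\<integral>\<^sup>+ x. indicator {y. ennreal s < f y} x \<partial>?M)"
      by (rule dfun_int) simp
    also have "\<dots> = (\<integral>\<^sup>+ x. (SUP n. indicator {y. ennreal s < F n y} x) \<partial>?M)"
    proof (rule nn_integral_cong_AE)
      show "AE x in ?M. indicator {y. ennreal s < f y} x = (SUP n. indicator {y. ennreal s < F n y} x :: ennreal)"
        using lim
      proof eventually_elim
        case (elim x)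
        show ?case
        proof (cases "\<exists>n. ennreal s < F n x")
          case True
          then obtain n where "ennreal s < F n x" by auto
          then have "(1::ennreal) \<le> (SUP n. indicator {y. ennreal s < F n y} x)"
            by (intro SUP_upper2[of n]) auto
          moreover have "(SUP n. indicator {y. ennreal s < F n y} x) \<le> (1::ennreal)"
            by (intro SUP_least) (auto simp: indicator_def)
          ultimately show ?thesis using True elim by (auto simp: less_SUP_iff)
        next
          case False
          then have "indicator {y. ennreal s < F n y} x = (0::ennreal)" for n by auto
          then show ?thesis using False elim by (simp add: less_SUP_iff)
        qed
      qed
    qed
    also have "\<dots> = (SUP n. \<integral>\<^sup>+ x. indicator {y. ennreal s < F n y} x \<partial>?M)"
    proof (rule nn_integral_monotone_convergence_SUP_AE)
      show "AE x in ?M. indicator {y. ennreal s < F i y} x \<le> (indicator {y. ennreal s < F (Suc i) y} x :: ennreal)" for i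
        using lim by eventually_elim (auto simp: indicator_def incseq_Suc_iff dest: less_le_trans)
    qed measurable
    finally obtain n where "ennreal t < dfun L (F n) s"
      by (auto simp: less_SUP_iff dfun_int)
    then have "ennreal s < rearr L (F n) t" using s by (simp add: less_rearr_iff)
    then show "ennreal s < (SUP n. rearr L (F n) t)" by (auto simp: less_SUP_iff)
  qed
  have "AE x in ?M. F n x \<le> f x" for n
    using lim by eventually_elim (auto intro: SUP_upper)
  then show "(SUP n. rearr L (F n) t) \<le> rearr L f t"
    by (intro SUP_least rearr_mono) auto
qed

text \<open>Where f + g exceeds a + c, either f exceeds a or g exceeds c. With a and c the two
  values at t/2, each exceptional set has measure at most t/2.\<close>

lemma rearr_add_le:
  assumes [measurable]: "f \<in> borel_measurable (lebesgue_on (einterval 0 L))"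
    "g \<in> borel_measurable (lebesgue_on (einterval 0 L))" and "0 \<le> t"
  shows "rearr L (\<lambda>x. f x + g x) t \<le> rearr L f (t / 2) + rearr L g (t / 2)"
proof (cases "rearr L f (t / 2)"; cases "rearr L g (t / 2)")
  fix a c
  assume a: "0 \<le> a" "rearr L f (t / 2) = ennreal a" and c: "0 \<le> c" "rearr L g (t / 2) = ennreal c"
  have 1: "dfun L f a \<le> ennreal (t / 2)"
    using less_rearr_iff[OF assms(1) a(1), of "t/2"] a by (simp add: not_less)
  have 2: "dfun L g c \<le> ennreal (t / 2)"
    using less_rearr_iff[OF assms(2) c(1), of "t/2"] c by (simp add: not_less)
  have "dfun L (\<lambda>x. f x + g x) (a + c) \<le> emeasure (lebesgue_on (einterval 0 L))
      ({x \<in> einterval 0 L. ennreal a < f x} \<union> {x \<in> einterval 0 L. ennreal c < g x})"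
    unfolding dfun_def
  proof (intro emeasure_mono subsetI)
    fix x assume "x \<in> {x \<in> einterval 0 L. ennreal (a + c) < f x + g x}"
    then have x: "x \<in> einterval 0 L" "ennreal a + ennreal c < f x + g x"
      using a c by auto
    have "\<not> (f x \<le> ennreal a \<and> g x \<le> ennreal c)"
      using x(2) add_mono[of "f x" "ennreal a" "g x" "ennreal c"] leD by blast
    with x(1) show "x \<in> {x \<in> einterval 0 L. ennreal a < f x} \<union> {x \<in> einterval 0 L. ennreal c < g x}"
      by (auto simp: not_le)
  qed (use level_sets[OF assms(1)] level_sets[OF assms(2)] in auto)
  also have "\<dots> \<le> dfun L f a + dfun L g c"
    unfolding dfun_def by (intro emeasure_subadditive level_sets assms)
  also have "\<dots> \<le> ennreal (t / 2) + ennreal (t / 2)" using 1 2 by (rule add_mono)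
  also have "\<dots> = ennreal t" using assms(3) by (simp add: ennreal_plus[symmetric] del: ennreal_plus)
  finally have "\<not> ennreal (a + c) < rearr L (\<lambda>x. f x + g x) t"
    using a c by (subst less_rearr_iff) (auto simp: not_less)
  then show ?thesis using a c by (simp add: not_less)
qed auto

text \<open>The set is an initial interval of length m, and m does not exceed the length of (0,L).
  It arises below as the level set of a rearrangement.\<close>

lemma emeasure_lebesgue_on_initial:
  assumes "m \<le> emeasure lebesgue (einterval 0 L)" "0 < L"
  shows "emeasure (lebesgue_on (einterval 0 L)) {x \<in> einterval 0 L. ennreal x < m} = m"
proof (cases m)
  case (real r)
  have "ereal r \<le> L"
  proof (cases L)
    case (real l)
    then have "emeasure lebesgue (einterval 0 L) = ennreal l"
      using assms(2) by (simp add: einterval_0_ereal)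
    then show ?thesis using assms(1) \<open>m = ennreal r\<close> real assms(2) by (auto simp: ennreal_le_iff2)
  qed (use assms in auto)
  then have "{x \<in> einterval 0 L. ennreal x < m} = {0<..<r}"
    using real by (auto simp: einterval_0_iff ennreal_less_iff intro: less_le_trans[of "ereal _" "ereal r"])
  moreover from this have "{0<..<r} \<subseteq> einterval 0 L" by auto
  ultimately show ?thesis using real by (simp add: emeasure_restrict_space)
next
  case top
  then show ?thesis using assms by (simp add: emeasure_restrict_space top_unique)
qed

text \<open>By \<open>less_rearr_iff\<close> the level set of the rearrangement at s consists of the
  points below \<open>dfun L g s\<close>, and its measure is that very number; hence both functions
  have the same distribution function.\<close>

lemma rearr_rearr:
  assumes g: "g \<in> borel_measurable (lebesgue_on (einterval 0 L))" and L: "0 < L"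
  shows "rearr L (rearr L g) = rearr L g"
proof
  fix t
  have "dfun L (rearr L g) s = dfun L g s" if "0 \<le> s" for s
  proof -
    have "dfun L g s \<le> emeasure lebesgue (einterval 0 L)"
      unfolding dfun_def by (subst emeasure_restrict_space, simp, blast, rule emeasure_mono) auto
    from emeasure_lebesgue_on_initial[OF this L] show ?thesis
      unfolding dfun_def[of L "rearr L g"] less_rearr_iff[OF g that] .
  qed
  then have "ennreal s < rearr L (rearr L g) t \<longleftrightarrow> ennreal s < rearr L g t" if "0 \<le> s" for s
    using that by (simp add: less_rearr_iff g rearr_borel_measurable)
  then show "rearr L (rearr L g) t = rearr L g t"
    by (intro antisym ennreal_le_reals) auto
qed

section \<open>The averaged rearrangement \<open>maxrearr\<close>\<close>

lemma maxrearr_scaled: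
  assumes "0 < t"
  shows "maxrearr L g t = (\<integral>\<^sup>+ u. rearr L g (t * u) \<partial>lebesgue_on {0<..<1})"
proof -
  let ?f = "\<lambda>x. rearr L g x * indicator {0<..<t} x"
  have m: "?f \<in> borel_measurable lebesgue"
    using rearr_borel_measurable[of L g UNIV] by (intro borel_measurable_times_ennreal borel_measurable_indicator) auto
  have "(\<integral>\<^sup>+ u. rearr L g u \<partial>lebesgue_on (einterval 0 t)) = (\<integral>\<^sup>+ u. ?f u \<partial>lebesgue)"
    by (simp add: einterval_0_ereal nn_integral_restrict_space)
  \<comment> \<open>The substitution u = t u' moves the average to the fixed interval (0,1), where
    monotonicity in t and estimates for sums can be checked under the integral sign.\<close>
  also have "\<dots> = ennreal t * (\<integral>\<^sup>+ u. ?f (t * u) \<partial>lebesgue)"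
    by (rule nn_integral_lebesgue_scale[OF m assms])
  also have "(\<integral>\<^sup>+ u. ?f (t * u) \<partial>lebesgue) = (\<integral>\<^sup>+ u. rearr L g (t * u) \<partial>lebesgue_on {0<..<1})"
    using assms by (subst nn_integral_restrict_space)
      (auto intro!: nn_integral_cong simp: indicator_def zero_less_mult_iff)
  finally show ?thesis
    using assms by (simp add: maxrearr_def ennreal_mult_divide_eq mult.commute[of "ennreal t"])
qed

lemma maxrearr_antimono: "0 < s \<Longrightarrow> s \<le> t \<Longrightarrow> maxrearr L g t \<le> maxrearr L g s"
  by (auto simp: maxrearr_scaled space_restrict_space intro!: nn_integral_mono rearr_antimono mult_right_mono)

lemma maxrearr_le_mult:
  assumes "0 < s" "s \<le> t"
  shows "maxrearr L g s \<le> ennreal (t / s) * maxrearr L g t"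
proof -
  let ?A = "\<lambda>t. \<integral>\<^sup>+ u. rearr L g u \<partial>lebesgue_on (einterval 0 (ereal t))"
  have eq: "maxrearr L g t = ennreal (1 / t) * ?A t" if "0 < t" for t :: real
    using that by (simp add: maxrearr_def divide_ennreal_def inverse_ennreal mult.commute inverse_eq_divide)
  have "?A s \<le> ?A t"
    using assms by (simp add: einterval_0_ereal nn_integral_restrict_space)
      (auto intro!: nn_integral_mono simp: indicator_def)
  then have "ennreal (1 / s) * ?A s \<le> ennreal (1 / s) * ?A t" by (rule mult_left_mono) simp
  also have "ennreal (1 / s) * ?A t = ennreal (t / s) * (ennreal (1 / t) * ?A t)"
    using assms by (simp add: mult.assoc[symmetric] ennreal_mult[symmetric])
  finally show ?thesis using assms by (simp add: eq)
qed

lemma maxrearr_borel_measurable [measurable]: "maxrearr L g \<in> borel_measurable (lebesgue_on (einterval 0 K))"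
  by (rule antimono_on_borel_measurable[OF is_interval_einterval])
    (auto simp: einterval_0_iff intro: maxrearr_antimono)

lemma maxrearr_mono:
  assumes "g \<in> borel_measurable (lebesgue_on (einterval 0 L))" "h \<in> borel_measurable (lebesgue_on (einterval 0 L))"
    "AE x in lebesgue_on (einterval 0 L). g x \<le> h x"
  shows "maxrearr L g t \<le> maxrearr L h t"
  unfolding maxrearr_def by (intro divide_right_mono_ennreal nn_integral_mono rearr_mono assms)

lemma maxrearr_cmult:
  assumes "g \<in> borel_measurable (lebesgue_on (einterval 0 L))" "0 < k"
  shows "maxrearr L (\<lambda>x. ennreal k * g x) t = ennreal k * maxrearr L g t"
proof -
  have "rearr L (\<lambda>x. ennreal k * g x) = (\<lambda>t. ennreal k * rearr L g t)"
    using rearr_cmult[OF assms] by (rule ext)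
  then show ?thesis
    by (simp add: maxrearr_def nn_integral_cmult divide_ennreal_def mult.assoc rearr_borel_measurable)
qed

lemma maxrearr_SUP:
  assumes "f \<in> borel_measurable (lebesgue_on (einterval 0 L))"
    "\<And>n. F n \<in> borel_measurable (lebesgue_on (einterval 0 L))"
    "AE x in lebesgue_on (einterval 0 L). incseq (\<lambda>n. F n x) \<and> f x = (SUP n::nat. F n x)"
  shows "maxrearr L f t = (SUP n. maxrearr L (F n) t)"
proof -
  have "AE x in lebesgue_on (einterval 0 L). F n x \<le> F (Suc n) x" for n
    using assms(3) by eventually_elim (auto simp: incseq_Suc_iff)
  then have "incseq (\<lambda>n. rearr L (F n))"
    by (auto simp: incseq_Suc_iff le_fun_def intro!: rearr_mono assms)
  then show ?thesis
    unfolding maxrearr_def rearr_SUP[OF assms] divide_ennreal_def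
    by (simp add: nn_integral_monotone_convergence_SUP rearr_borel_measurable SUP_mult_right_ennreal)
qed

text \<open>The average is in fact subadditive with constant 1, but the factor 2 follows at once
  from \<open>rearr_add_le\<close>: halving the argument at most doubles the average by
  \<open>maxrearr_le_mult\<close>.\<close>

lemma maxrearr_add_le:
  assumes "f \<in> borel_measurable (lebesgue_on (einterval 0 L))"
    "g \<in> borel_measurable (lebesgue_on (einterval 0 L))" and t: "0 < t"
  shows "maxrearr L (\<lambda>x. f x + g x) t \<le> ennreal 2 * (maxrearr L f t + maxrearr L g t)"
proof -
  have "maxrearr L (\<lambda>x. f x + g x) t
      \<le> (\<integral>\<^sup>+ u. rearr L f (t / 2 * u) + rearr L g (t / 2 * u) \<partial>lebesgue_on {0<..<1})"
    unfolding maxrearr_scaled[OF t]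
  proof (rule nn_integral_mono)
    fix u assume "u \<in> space (lebesgue_on {0<..<1::real})"
    then show "rearr L (\<lambda>x. f x + g x) (t * u) \<le> rearr L f (t / 2 * u) + rearr L g (t / 2 * u)"
      using rearr_add_le[OF assms(1,2), of "t * u"] t by (auto simp: space_restrict_space)
  qed
  also have "\<dots> = maxrearr L f (t / 2) + maxrearr L g (t / 2)"
    using t by (simp add: maxrearr_scaled nn_integral_add del: times_divide_eq_left)
  also have "\<dots> \<le> ennreal 2 * maxrearr L f t + ennreal 2 * maxrearr L g t"
    using t maxrearr_le_mult[of "t/2" t] by (intro add_mono) auto
  finally show ?thesis by (simp add: distrib_left)
qed

text \<open>Being non-increasing, F could differ from its rearrangement only at jumps, and
  \<open>maxrearr_le_mult\<close> excludes jumps. The restriction to (0,L) matters: for finite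
  \<open>L\<close> the rearrangement vanishes from \<open>L\<close> on, whereas the average need
  not.\<close>

lemma rearr_maxrearr:
  assumes t: "t \<in> einterval 0 L" and L: "0 < L"
  shows "rearr L (maxrearr L g) t = maxrearr L g t"
proof -
  let ?F = "maxrearr L g" and ?M = "lebesgue_on (einterval 0 L)"
  have t0: "0 < t" using t by (simp add: einterval_0_iff)
  have "ennreal t < dfun L ?F s \<longleftrightarrow> ennreal s < ?F t" if s: "0 \<le> s" for s
  proof
    assume less: "ennreal t < dfun L ?F s"
    \<comment> \<open>Otherwise the level set would be contained in (0,t], whose measure does not
      exceed t.\<close>
    have "\<exists>x\<in>einterval 0 L. t < x \<and> ennreal s < ?F x"
    proof (rule ccontr)
      assume *: "\<not> ?thesis"
      have "dfun L ?F s \<le> emeasure lebesgue {0<..t}"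
        unfolding dfun_def using *
        by (subst emeasure_restrict_space, simp, blast, intro emeasure_mono) (auto simp: einterval_0_iff not_less)
      with less t0 show False by simp
    qed
    then show "ennreal s < ?F t"
      using maxrearr_antimono[of t _ L g] t0 by (auto intro: less_le_trans)
  next
    assume "ennreal s < ?F t"
    \<comment> \<open>An intermediate finite value is needed because F(t) may be infinite.\<close>
    then obtain s' where s': "s < s'" "ennreal s' \<le> ?F t"
    proof (cases "?F t")
      case (real r)
      then show ?thesis using \<open>ennreal s < ?F t\<close> s that[of r] by (auto simp: ennreal_less_iff)
    next
      case top
      then show ?thesis using that[of "s + 1"] by simp
    qed
    obtain x0 where x0: "t < x0" "x0 \<in> einterval 0 L"
    proof -
      obtain x where "ereal t < ereal x" "ereal x < L"
        using t ereal_dense2[of "ereal t" L] by (auto simp: einterval_0_iff)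
      then show ?thesis using that[of x] t0 by (auto simp: einterval_0_iff)
    qed
    \<comment> \<open>The first bound keeps t + \<delta> inside (0,L); the second gives
      (t+\<delta>)/t s < s', where s + 1 avoids division by zero at s = 0 and the factor 1/2 makes
      the inequality strict.\<close>
    define \<delta> where "\<delta> = min (x0 - t) (t * (s' - s) / 2 / (s + 1))"
    have d: "0 < \<delta>" using x0 s s' t0 by (auto simp: \<delta>_def)
    have tI: "t + \<delta> \<in> einterval 0 L"
      by (rule einterval_down[OF x0(2)]) (use d t0 in \<open>auto simp: \<delta>_def\<close>)
    have "\<delta> \<le> t * (s' - s) / 2 / (s + 1)" by (simp add: \<delta>_def)
    then have "\<delta> * (s + 1) \<le> t * (s' - s) / 2"
      using s by (subst (asm) pos_le_divide_eq) auto
    also have "\<dots> < t * (s' - s)" using t0 s' by simp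
    finally have "(t + \<delta>) * s < t * s'" using d by (simp add: algebra_simps)
    then have "(t + \<delta>) / t * s < s'" using t0 by (simp add: field_simps)
    then have "ennreal ((t + \<delta>) / t) * ennreal s < ennreal s'"
      using s t0 d by (simp add: ennreal_mult[symmetric] ennreal_less_iff)
    also have "\<dots> \<le> ?F t" by fact
    also have "\<dots> \<le> ennreal ((t + \<delta>) / t) * ?F (t + \<delta>)"
      using t0 d by (intro maxrearr_le_mult) auto
    finally have **: "ennreal ((t + \<delta>) / t) * ennreal s < ennreal ((t + \<delta>) / t) * ?F (t + \<delta>)" .
    have *: "ennreal s < ?F (t + \<delta>)"
    proof (rule ccontr)
      assume "\<not> ennreal s < ?F (t + \<delta>)"
      then have "ennreal ((t + \<delta>) / t) * ?F (t + \<delta>) \<le> ennreal ((t + \<delta>) / t) * ennreal s"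
        by (intro mult_left_mono) (simp_all add: not_less)
      with ** show False by (meson leD)
    qed
    have "ennreal t < ennreal (t + \<delta>)" using t0 d by (intro ennreal_lessI) auto
    also have "\<dots> = emeasure lebesgue {0<..<t + \<delta>}" using t0 d by (simp del: ennreal_plus)
    also have "\<dots> \<le> dfun L ?F s"
    proof -
      have sub: "{0<..<t + \<delta>} \<subseteq> {x \<in> einterval 0 L. ennreal s < ?F x}"
      proof (rule subsetI)
        fix x assume "x \<in> {0<..<t + \<delta>}"
        then have x: "0 < x" "x \<le> t + \<delta>" by simp_all
        have "ennreal s < ?F x"
          using * maxrearr_antimono[OF x] by (rule less_le_trans)
        then show "x \<in> {x \<in> einterval 0 L. ennreal s < ?F x}"
          using einterval_down[OF tI x] by blast
      qed
      have "{x \<in> einterval 0 L. ennreal s < ?F x} \<in> sets lebesgue"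
        using level_sets[OF maxrearr_borel_measurable, of L s L g]
        by (auto simp: sets_restrict_space_iff)
      with sub show ?thesis
        unfolding dfun_def by (subst emeasure_restrict_space, simp, blast, intro emeasure_mono)
    qed
    finally show "ennreal t < dfun L ?F s" .
  qed
  then have "ennreal s < rearr L ?F t \<longleftrightarrow> ennreal s < ?F t" if "0 \<le> s" for s
    using that by (simp add: less_rearr_iff)
  then show ?thesis by (intro antisym ennreal_le_reals) auto
qed

section \<open>Slowly varying weights, dilations and power norms\<close>

lemma SV_measurable: "d \<in> SV L \<Longrightarrow> d \<in> borel_measurable (lebesgue_on (einterval 0 L))"
  and SV_pos: "d \<in> SV L \<Longrightarrow> t \<in> einterval 0 L \<Longrightarrow> 0 < d t"
  by (auto simp: SV_def)

text \<open>Monotonicity of the equivalent function becomes monotonicity of \<open>f\<close> up to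
  the factor C/c. The relation \<open>R\<close> is left open so that increasing and decreasing
  comparison functions are covered together.\<close>

lemma sim_on_quasi_mono:
  fixes f :: "real \<Rightarrow> real"
  assumes sim: "sim_on A (\<lambda>t. ennreal (f t)) \<phi>" and pos: "\<And>t. t \<in> A \<Longrightarrow> 0 \<le> f t"
    and R: "\<And>s t. s \<in> A \<Longrightarrow> t \<in> A \<Longrightarrow> R s t \<Longrightarrow> \<phi> s \<le> \<phi> t"
  obtains K where "0 < K" "\<And>s t. s \<in> A \<Longrightarrow> t \<in> A \<Longrightarrow> R s t \<Longrightarrow> f s \<le> K * f t"
proof -
  obtain c C :: real where c: "0 < c" "c \<le> C"
    and *: "\<And>x. x \<in> A \<Longrightarrow> ennreal c * \<phi> x \<le> ennreal (f x) \<and> ennreal (f x) \<le> ennreal C * \<phi> x"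
    using sim by (auto simp: sim_on_def)
  have "f s \<le> (C / c) * f t" if st: "s \<in> A" "t \<in> A" "R s t" for s t
  proof -
    have "ennreal c * ennreal (f s) \<le> ennreal c * (ennreal C * \<phi> t)"
    proof (rule mult_left_mono)
      have "ennreal C * \<phi> s \<le> ennreal C * \<phi> t" using R[OF st] by (rule mult_left_mono) simp
      then show "ennreal (f s) \<le> ennreal C * \<phi> t" using *[OF st(1)] by (blast intro: order_trans)
    qed simp
    also have "\<dots> = ennreal C * (ennreal c * \<phi> t)" by (simp add: mult.left_commute)
    also have "\<dots> \<le> ennreal C * ennreal (f t)" using *[OF st(2)] by (intro mult_left_mono) auto
    finally have "c * f s \<le> C * f t"
      using c pos[OF st(1)] pos[OF st(2)] by (simp add: ennreal_mult[symmetric])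
    then show ?thesis using c by (simp add: field_simps)
  qed
  then show thesis using that[of "C / c"] c by simp
qed

text \<open>A Potter-type bound: the increasing comparison function handles s \<le> t, the
  decreasing one t \<le> s. All later use of slow variation goes through this quotient.\<close>

lemma SV_quotient:
  assumes d: "d \<in> SV L" and e: "0 < \<epsilon>"
  obtains K where "0 < K" "\<And>s t. s \<in> einterval 0 L \<Longrightarrow> t \<in> einterval 0 L \<Longrightarrow>
     d s \<le> K * max (s / t) (t / s) powr \<epsilon> * d t"
proof -
  let ?I = "einterval 0 L"
  obtain \<phi> where \<phi>: "mono_on ?I \<phi>" "sim_on ?I (\<lambda>t. ennreal (t powr \<epsilon> * d t)) \<phi>"
    using d e unfolding SV_def by blast
  obtain \<psi> where \<psi>: "antimono_on ?I \<psi>" "sim_on ?I (\<lambda>t. ennreal (t powr (- \<epsilon>) * d t)) \<psi>"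
    using d e unfolding SV_def by blast
  have pos: "0 < d t" if "t \<in> ?I" for t using SV_pos[OF d that] .
  obtain K1 where K1: "0 < K1" "\<And>s t. s \<in> ?I \<Longrightarrow> t \<in> ?I \<Longrightarrow> s \<le> t \<Longrightarrow> s powr \<epsilon> * d s \<le> K1 * (t powr \<epsilon> * d t)"
  proof (rule sim_on_quasi_mono[OF \<phi>(2), where R="(\<le>)"])
    show "0 \<le> t powr \<epsilon> * d t" if "t \<in> ?I" for t using pos[OF that] by simp
    show "\<phi> s \<le> \<phi> t" if "s \<in> ?I" "t \<in> ?I" "s \<le> t" for s t
      using \<phi>(1) that by (auto simp: mono_on_def)
  qed (use that in blast)
  obtain K2 where K2: "0 < K2" "\<And>s t. s \<in> ?I \<Longrightarrow> t \<in> ?I \<Longrightarrow> t \<le> s \<Longrightarrow> s powr (-\<epsilon>) * d s \<le> K2 * (t powr (-\<epsilon>) * d t)"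
  proof (rule sim_on_quasi_mono[OF \<psi>(2), where R="(\<ge>)"])
    show "0 \<le> t powr (-\<epsilon>) * d t" if "t \<in> ?I" for t using pos[OF that] by simp
    show "\<psi> s \<le> \<psi> t" if "s \<in> ?I" "t \<in> ?I" "t \<le> s" for s t
      using \<psi>(1) that by (auto simp: monotone_on_def)
  qed (use that in blast)
  have "d s \<le> max K1 K2 * max (s / t) (t / s) powr \<epsilon> * d t" if st: "s \<in> ?I" "t \<in> ?I" for s t
  proof -
    have st0: "0 < s" "0 < t" using st by (auto simp: einterval_0_iff)
    show ?thesis
    proof (cases "s \<le> t")
      case True
      then have "s / t \<le> 1" "1 \<le> t / s" using st0 by auto
      then have m: "max (s / t) (t / s) = t / s" by simp
      have "s powr \<epsilon> * d s \<le> s powr \<epsilon> * (K1 * (t / s) powr \<epsilon> * d t)"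
        using K1(2)[OF st True] st0 by (simp add: powr_divide)
      then have "d s \<le> K1 * (t / s) powr \<epsilon> * d t" using st0 by simp
      also have "\<dots> \<le> max K1 K2 * (t / s) powr \<epsilon> * d t"
        using pos[OF st(2)] by (intro mult_right_mono) auto
      finally show ?thesis by (simp only: m)
    next
      case False
      then have "t / s \<le> 1" "1 \<le> s / t" using st0 by auto
      then have m: "max (s / t) (t / s) = s / t" by simp
      have "s powr (-\<epsilon>) * d s \<le> s powr (-\<epsilon>) * (K2 * (s / t) powr \<epsilon> * d t)"
        using K2(2)[OF st] False st0 by (simp add: powr_divide powr_minus field_simps)
      then have "d s \<le> K2 * (s / t) powr \<epsilon> * d t" using st0 by simp
      also have "\<dots> \<le> max K1 K2 * (s / t) powr \<epsilon> * d t"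
        using pos[OF st(2)] by (intro mult_right_mono) auto
      finally show ?thesis by (simp only: m)
    qed
  qed
  then show thesis using that[of "max K1 K2"] K1 by simp
qed

section \<open>Norms over subdomains and norms of power functions\<close>

lemma Lq_domain_mono:
  assumes q: "0 < q" and A: "A \<in> sets lebesgue" and B: "B \<in> sets lebesgue" and sub: "A \<subseteq> B"
    and g: "g \<in> borel_measurable (lebesgue_on B)"
  shows "Lq q (lebesgue_on A) g \<le> Lq q (lebesgue_on B) g"
proof (cases "q = \<infinity>")
  case True
  have "AE x in lebesgue_on A. g x \<le> esssup (lebesgue_on B) g"
    using esssup_AE[of g "lebesgue_on B"] A B sub
    by (auto simp: AE_restrict_space_iff elim!: eventually_mono)
  then show ?thesis
    using True measurable_lebesgue_on_subset[OF g sub] by (auto simp: Lq_def intro!: esssup_I)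
next
  case False
  have "(\<integral>\<^sup>+ x. epow (g x) (enn2real q) \<partial>lebesgue_on A) \<le> (\<integral>\<^sup>+ x. epow (g x) (enn2real q) \<partial>lebesgue_on B)"
    using A B sub by (auto simp: nn_integral_restrict_space indicator_def intro!: nn_integral_mono)
  then show ?thesis
    using recip_pos[OF q False] by (simp add: Lq_finite[OF q False] epow_mono)
qed

text \<open>Stands in for additivity of the integral over the domain; the two covering sets may
  overlap, and the constant depends on \<open>q\<close> alone.\<close>

lemma Lq_cover:
  assumes q: "0 < q"
  obtains D where "0 < D"
    "\<And>(A::real set) B C g. A \<in> sets lebesgue \<Longrightarrow> B \<in> sets lebesgue \<Longrightarrow> C \<in> sets lebesgue \<Longrightarrow> A \<subseteq> B \<union> C \<Longrightarrow>
       g \<in> borel_measurable (lebesgue_on A) \<Longrightarrow>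
       Lq q (lebesgue_on A) g \<le> ennreal D * (Lq q (lebesgue_on (A \<inter> B)) g + Lq q (lebesgue_on (A \<inter> C)) g)"
proof (cases "q = \<infinity>")
  case True
  have "Lq q (lebesgue_on A) g \<le> ennreal 1 * (Lq q (lebesgue_on (A \<inter> B)) g + Lq q (lebesgue_on (A \<inter> C)) g)"
    if S: "A \<in> sets lebesgue" "B \<in> sets lebesgue" "C \<in> sets lebesgue" "A \<subseteq> B \<union> C"
      and g: "g \<in> borel_measurable (lebesgue_on A)" for A B C :: "real set" and g
  proof -
    have "AE x in lebesgue. x \<in> A \<inter> B \<longrightarrow> g x \<le> esssup (lebesgue_on (A \<inter> B)) g"
      "AE x in lebesgue. x \<in> A \<inter> C \<longrightarrow> g x \<le> esssup (lebesgue_on (A \<inter> C)) g"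
      using esssup_AE[of g "lebesgue_on (A \<inter> B)"] esssup_AE[of g "lebesgue_on (A \<inter> C)"] S
      by (simp_all add: AE_restrict_space_iff)
    then have "AE x in lebesgue. x \<in> A \<longrightarrow> g x \<le> esssup (lebesgue_on (A \<inter> B)) g + esssup (lebesgue_on (A \<inter> C)) g"
    proof eventually_elim
      case (elim x)
      with S(4) show ?case by (auto intro: add_increasing add_increasing2)
    qed
    then have "AE x in lebesgue_on A. g x \<le> esssup (lebesgue_on (A \<inter> B)) g + esssup (lebesgue_on (A \<inter> C)) g"
      using S by (simp add: AE_restrict_space_iff)
    then show ?thesis using True g by (auto simp: Lq_def intro!: esssup_I)
  qed
  then show ?thesis using that[of 1] by simp
next
  case False
  note * = recip_pos[OF q False]
  let ?q = "enn2real q"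
  have "Lq q (lebesgue_on A) g \<le> ennreal (2 powr (1 / ?q)) * (Lq q (lebesgue_on (A \<inter> B)) g + Lq q (lebesgue_on (A \<inter> C)) g)"
    if S: "A \<in> sets lebesgue" "B \<in> sets lebesgue" "C \<in> sets lebesgue" "A \<subseteq> B \<union> C"
      and g: "g \<in> borel_measurable (lebesgue_on A)" for A B C :: "real set" and g
  proof -
    let ?J = "\<lambda>A. \<integral>\<^sup>+ x. epow (g x) ?q \<partial>lebesgue_on A"
    let ?f = "\<lambda>A x. epow (g x) ?q * indicator A x"
    have m: "?f X \<in> borel_measurable lebesgue" if "X \<in> sets lebesgue" "X \<subseteq> A" for X
      using borel_measurable_epow[OF measurable_lebesgue_on_subset[OF g that(2)]] that(1)
      by (subst (asm) borel_measurable_restrict_space_iff_ennreal) auto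
    have "?J A = (\<integral>\<^sup>+ x. ?f A x \<partial>lebesgue)" using S by (simp add: nn_integral_restrict_space)
    also have "\<dots> \<le> (\<integral>\<^sup>+ x. ?f (A \<inter> B) x + ?f (A \<inter> C) x \<partial>lebesgue)"
      using S(4) by (intro nn_integral_mono) (auto simp: indicator_def)
    also have "\<dots> = ?J (A \<inter> B) + ?J (A \<inter> C)"
      using S by (subst nn_integral_add) (auto simp: nn_integral_restrict_space intro!: m)
    finally have "Lq q (lebesgue_on A) g \<le> epow (?J (A \<inter> B) + ?J (A \<inter> C)) (1 / ?q)"
      using * by (simp add: Lq_finite[OF q False] epow_mono)
    also have "\<dots> \<le> ennreal (2 powr (1 / ?q)) * (Lq q (lebesgue_on (A \<inter> B)) g + Lq q (lebesgue_on (A \<inter> C)) g)"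
      using * unfolding Lq_finite[OF q False] by (intro epow_add_le) simp
    finally show ?thesis .
  qed
  then show ?thesis using that[of "2 powr (1 / ?q)"] by simp
qed

lemma Lq_powr_bound:
  assumes q: "0 < q" "q \<noteq> \<infinity>" and A: "A \<in> sets lebesgue" "A \<subseteq> {0<..}" "A \<subseteq> B"
    and I: "((\<lambda>v. v powr (a * enn2real q)) has_integral y) B"
  shows "Lq q (lebesgue_on A) (\<lambda>v. ennreal (v powr a)) \<le> epow (ennreal y) (1 / enn2real q)"
proof -
  note * = recip_pos[OF q]
  have "(\<integral>\<^sup>+ v. epow (ennreal (v powr a)) (enn2real q) \<partial>lebesgue_on A)
      = (\<integral>\<^sup>+ v. ennreal (v powr (a * enn2real q)) * indicator A v \<partial>lebesgue)"
    using A by (simp add: nn_integral_restrict_space epow_ennreal powr_powr)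
  also have "\<dots> \<le> (\<integral>\<^sup>+ v. ennreal (v powr (a * enn2real q)) * indicator B v \<partial>lebesgue)"
    using A by (intro nn_integral_mono) (auto simp: indicator_def)
  also have "\<dots> = ennreal y"
    using nn_integral_has_integral_lebesgue'[OF _ I] by (simp add: nn_integral_completion)
  finally show ?thesis using * by (simp add: Lq_finite[OF q] epow_mono)
qed

lemma powr_measurable_lebesgue_on [measurable]: "(\<lambda>v. ennreal (v powr a)) \<in> borel_measurable (lebesgue_on A)"
  by (rule measurable_lebesgue_onI) measurable

text \<open>Subtracting \<open>recip q\<close> in the exponent makes the norm scale exactly like
  t^e: the q-th power of the integrand has exponent e q - 1 > -1, and for \<open>q\<close> infinite
  v^e is increasing. This is how \<open>W\<close> is reduced to a constant.\<close>

lemma Lq_powr_initial: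
  assumes q: "0 < q" and e: "0 < e"
  obtains C where "0 < C" "\<And>t. 0 < t \<Longrightarrow>
    Lq q (lebesgue_on {0<..<t}) (\<lambda>v. ennreal (v powr (e - recip q))) \<le> ennreal (C * t powr e)"
proof (cases "q = \<infinity>")
  case True
  show thesis
  proof (rule that[of 1])
    fix t :: real assume "0 < t"
    then show "Lq q (lebesgue_on {0<..<t}) (\<lambda>v. ennreal (v powr (e - recip q))) \<le> ennreal (1 * t powr e)"
      using True e by (intro Lq_le_const) (auto simp: space_restrict_space intro!: ennreal_leI powr_mono2 measurable_lebesgue_onI)
  qed simp
next
  case False
  note * = recip_pos[OF q False]
  let ?q = "enn2real q"
  show thesis
  proof (rule that[of "(1 / (e * ?q)) powr (1 / ?q)"])
    fix t :: real assume t: "0 < t"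
    have eq: "(e - recip q) * ?q = e * ?q - 1" using * by (simp add: field_simps)
    have "((\<lambda>v. v powr ((e - recip q) * ?q)) has_integral (t powr (e * ?q) / (e * ?q))) {0..t}"
      unfolding eq using has_integral_powr_from_0[of "e * ?q - 1" t] * e t by simp
    then have "Lq q (lebesgue_on {0<..<t}) (\<lambda>v. ennreal (v powr (e - recip q))) \<le> epow (ennreal (t powr (e * ?q) / (e * ?q))) (1 / ?q)"
      by (rule Lq_powr_bound[OF q False, rotated 3]) auto
    also have "\<dots> = ennreal ((1 / (e * ?q)) powr (1 / ?q) * t powr e)"
      using * e t by (simp add: epow_ennreal powr_divide powr_powr)
    finally show "Lq q (lebesgue_on {0<..<t}) (\<lambda>v. ennreal (v powr (e - recip q))) \<le> \<dots>" .
  qed (use * e in simp)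
qed

lemma Lq_powr_final:
  assumes q: "0 < q" and e: "0 < e"
  obtains C where "0 < C" "\<And>t. 0 < t \<Longrightarrow>
    Lq q (lebesgue_on {t<..}) (\<lambda>v. ennreal (v powr (- e - recip q))) \<le> ennreal (C * t powr (- e))"
proof (cases "q = \<infinity>")
  case True
  show thesis
  proof (rule that[of 1])
    fix t :: real assume "0 < t"
    then show "Lq q (lebesgue_on {t<..}) (\<lambda>v. ennreal (v powr (- e - recip q))) \<le> ennreal (1 * t powr (- e))"
      using True e by (intro Lq_le_const) (auto simp: space_restrict_space intro!: ennreal_leI powr_mono2' measurable_lebesgue_onI)
  qed simp
next
  case False
  note * = recip_pos[OF q False]
  let ?q = "enn2real q"
  show thesis
  proof (rule that[of "(1 / (e * ?q)) powr (1 / ?q)"])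
    fix t :: real assume t: "0 < t"
    have eq: "(- e - recip q) * ?q = - e * ?q - 1" using * by (simp add: field_simps)
    have "((\<lambda>v. v powr ((- e - recip q) * ?q)) has_integral (t powr (- e * ?q) / (e * ?q))) {t..}"
      unfolding eq using has_integral_powr_to_inf[of "- e * ?q - 1" t] * e t by simp
    then have "Lq q (lebesgue_on {t<..}) (\<lambda>v. ennreal (v powr (- e - recip q))) \<le> epow (ennreal (t powr (- e * ?q) / (e * ?q))) (1 / ?q)"
      by (rule Lq_powr_bound[OF q False, rotated 3]) (use t in auto)
    also have "\<dots> = ennreal ((1 / (e * ?q)) powr (1 / ?q) * t powr (- e))"
      using * e t by (simp add: epow_ennreal powr_divide powr_powr)
    finally show "Lq q (lebesgue_on {t<..}) (\<lambda>v. ennreal (v powr (- e - recip q))) \<le> \<dots>" .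
  qed (use * e in simp)
qed

lemma Lq_const:
  assumes q: "0 < q" and t: "0 < t"
  shows "Lq q (lebesgue_on {t/2<..<t}) (\<lambda>_. x) = ennreal ((t / 2) powr recip q) * x"
proof -
  have m: "emeasure (lebesgue_on {t/2<..<t}) {t/2<..<t} = ennreal (t / 2)"
    using t by (simp add: emeasure_restrict_space)
  show ?thesis
  proof (cases "q = \<infinity>")
    case True
    then show ?thesis using m t by (simp add: Lq_def esssup_const space_restrict_space)
  next
    case False
    note * = recip_pos[OF q False]
    show ?thesis
      using * t by (simp add: Lq_finite[OF q False] m epow_mult epow_inverse epow_ennreal mult.commute space_restrict_space)
  qed
qed

text \<open>Extended by zero because \<kappa> t may leave (0,L) when \<kappa> > 1 and
  \<open>L\<close> is finite. In the estimates that follow, each dilation picked from a supremum has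
  \<kappa> t inside the interval.\<close>

definition dil :: "ereal \<Rightarrow> real \<Rightarrow> (real \<Rightarrow> ennreal) \<Rightarrow> real \<Rightarrow> ennreal" where
  "dil L \<kappa> G t = (if \<kappa> * t \<in> einterval 0 L then G (\<kappa> * t) else 0)"

lemma dil_measurable [measurable]:
  assumes "G \<in> borel_measurable (lebesgue_on (einterval 0 L))" "0 < \<kappa>"
  shows "dil L \<kappa> G \<in> borel_measurable (lebesgue_on A)"
  using borel_measurable_lebesgue_on_scale[OF assms(1) _ assms(2)]
  unfolding dil_def by (intro measurable_restrict_space1) auto

text \<open>Change of variables. Only an inequality is claimed, since for finite \<open>L\<close>
  and \<kappa> < 1 the points \<kappa> t do not fill (0,L).\<close>

lemma Lq_dil:
  assumes q: "0 < q" and G: "G \<in> borel_measurable (lebesgue_on (einterval 0 L))" and l: "0 < \<kappa>"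
  shows "Lq q (lebesgue_on (einterval 0 L)) (dil L \<kappa> G)
     \<le> ennreal (\<kappa> powr (- recip q)) * Lq q (lebesgue_on (einterval 0 L)) G"
proof -
  let ?I = "einterval 0 L"
  have scale: "(\<integral>\<^sup>+ x. (if x \<in> ?I then g x else 0) \<partial>lebesgue)
      = ennreal \<kappa> * (\<integral>\<^sup>+ x. (if \<kappa> * x \<in> ?I then g (\<kappa> * x) else 0) \<partial>lebesgue)"
    if g: "g \<in> borel_measurable (lebesgue_on ?I)" for g :: "real \<Rightarrow> ennreal"
    using nn_integral_lebesgue_scale[OF borel_measurable_lebesgue_on_scale[OF g _ zero_less_one] l] by (simp cong: if_cong)
  show ?thesis
  proof (cases "q = \<infinity>")
    case True
    let ?E = "esssup (lebesgue_on ?I) G"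
    \<comment> \<open>For the essential supremum one needs that scaling preserves null sets; this is
      read off from the scaled integral of the indicator of the exceptional set.\<close>
    let ?g = "\<lambda>x. indicator {x. ?E < G x} x :: ennreal"
    have gm: "?g \<in> borel_measurable (lebesgue_on ?I)" using G by measurable
    have gm': "(\<lambda>x. if \<kappa> * x \<in> ?I then ?g (\<kappa> * x) else 0) \<in> borel_measurable lebesgue"
      using borel_measurable_lebesgue_on_scale[OF gm _ l] by simp
    have "AE x in lebesgue. x \<in> ?I \<longrightarrow> G x \<le> ?E"
      using esssup_AE[of G "lebesgue_on ?I"] by (simp add: AE_restrict_space_iff)
    then have "AE x in lebesgue. (if x \<in> ?I then ?g x else 0) = 0"
      by eventually_elim (auto simp: indicator_def)
    then have "(\<integral>\<^sup>+ x. (if x \<in> ?I then ?g x else 0) \<partial>lebesgue) = (\<integral>\<^sup>+ x. 0 \<partial>(lebesgue::real measure))"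
      by (rule nn_integral_cong_AE)
    then have "(\<integral>\<^sup>+ x. (if \<kappa> * x \<in> ?I then ?g (\<kappa> * x) else 0) \<partial>lebesgue) = 0"
      using l by (simp add: scale[OF gm])
    then have "AE x in lebesgue. (if \<kappa> * x \<in> ?I then ?g (\<kappa> * x) else 0) = 0"
      using nn_integral_0_iff_AE[OF gm'] by simp
    then have "AE x in lebesgue. dil L \<kappa> G x \<le> ?E"
      by eventually_elim (auto simp: dil_def indicator_def not_less split: if_splits)
    then have "AE x in lebesgue_on ?I. dil L \<kappa> G x \<le> ?E"
      by (auto simp: AE_restrict_space_iff elim: eventually_mono)
    then show ?thesis using True l dil_measurable[OF G l] by (auto simp: Lq_def intro!: esssup_I)
  next
    case False
    note * = recip_pos[OF q False]
    let ?q = "enn2real q"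
    let ?J = "\<integral>\<^sup>+ x. epow (G x) ?q \<partial>lebesgue_on ?I"
    have "(\<integral>\<^sup>+ x. epow (dil L \<kappa> G x) ?q \<partial>lebesgue_on ?I)
        \<le> (\<integral>\<^sup>+ x. (if \<kappa> * x \<in> ?I then epow (G (\<kappa> * x)) ?q else 0) \<partial>lebesgue)"
      by (auto simp: nn_integral_restrict_space dil_def indicator_def intro!: nn_integral_mono)
    also have "\<dots> = ennreal (1 / \<kappa>) * (ennreal \<kappa> * \<dots>)"
      using l by (simp add: mult.assoc[symmetric] ennreal_mult[symmetric])
    also have "\<dots> = ennreal (1 / \<kappa>) * ?J"
      by (subst scale[symmetric]) (use G in \<open>auto simp: nn_integral_restrict_space indicator_def intro!: arg_cong2[where f="(*)"] nn_integral_cong\<close>)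
    finally have "Lq q (lebesgue_on ?I) (dil L \<kappa> G) \<le> epow (ennreal (1 / \<kappa>) * ?J) (1 / ?q)"
      using * by (simp add: Lq_finite[OF q False] epow_mono)
    also have "\<dots> = ennreal (\<kappa> powr (- recip q)) * Lq q (lebesgue_on ?I) G"
      using * l by (simp add: Lq_finite[OF q False] epow_mult epow_ennreal powr_divide powr_minus_divide)
    finally show ?thesis .
  qed
qed

section \<open>The weighted norm \<open>Bnorm\<close> and its behaviour under dilation\<close>

lemma weighted_measurable:
  assumes "b \<in> borel_measurable (lebesgue_on A)" "G \<in> borel_measurable (lebesgue_on A)"
  shows "(\<lambda>t. ennreal (t powr a * b t) * G t) \<in> borel_measurable (lebesgue_on A)"
proof -
  have [measurable]: "(\<lambda>t::real. t powr a) \<in> borel_measurable (lebesgue_on A)"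
    by (intro measurable_restrict_space1 measurable_completion) measurable
  note [measurable] = assms
  show ?thesis by measurable
qed

lemma Bnorm_eq_Lq:
  "Bnorm L p r b g = Lq r (lebesgue_on (einterval 0 L)) (\<lambda>t. ennreal (t powr (recip p - recip r) * b t) * g t)"
  by (simp add: Bnorm_def Lnorm_eq_Lq)

lemma Bnorm_measurable:
  assumes "b \<in> SV L" "G \<in> borel_measurable (lebesgue_on (einterval 0 L))"
  shows "(\<lambda>t. ennreal (t powr (recip p - recip r) * b t) * G t) \<in> borel_measurable (lebesgue_on (einterval 0 L))"
  using assms by (intro weighted_measurable SV_measurable)

lemma Bnorm_mono:
  assumes "0 < r" "b \<in> SV L" "G \<in> borel_measurable (lebesgue_on (einterval 0 L))"
    "\<And>t. t \<in> einterval 0 L \<Longrightarrow> G t \<le> H t"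
  shows "Bnorm L p r b G \<le> Bnorm L p r b H"
  unfolding Bnorm_eq_Lq using assms by (intro Lq_mono Bnorm_measurable) (auto intro: mult_left_mono)

lemma Bnorm_cong:
  assumes "\<And>t. t \<in> einterval 0 L \<Longrightarrow> G t = H t"
  shows "Bnorm L p r b G = Bnorm L p r b H"
  unfolding Bnorm_eq_Lq using assms by (intro Lq_cong) auto

lemma Bnorm_cmult:
  assumes "0 < r" "b \<in> SV L" "G \<in> borel_measurable (lebesgue_on (einterval 0 L))" "0 \<le> k"
  shows "Bnorm L p r b (\<lambda>t. ennreal k * G t) = ennreal k * Bnorm L p r b G"
  unfolding Bnorm_eq_Lq using Lq_cmult[OF assms(1,4) Bnorm_measurable[OF assms(2,3)], of p r]
  by (simp add: mult.left_commute)

lemma ennreal_times_times: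
  "0 \<le> c \<Longrightarrow> 0 \<le> y \<Longrightarrow> ennreal c * (ennreal y * x) = ennreal (c * y) * x"
  by (simp add: ennreal_mult mult.assoc)

text \<open>The power weight contributes \<kappa>^(1/r - 1/p) and the change of variables
  \<kappa>^(-1/r), so \<open>r\<close> cancels and \<kappa>^(-1/p) remains; comparing b(t) with
  b(\<kappa> t) costs the extra power \<epsilon>.\<close>

lemma Bnorm_dil:
  assumes r: "0 < r" and b: "b \<in> SV L" and e: "0 < \<epsilon>"
  obtains K where "0 < K" "\<And>\<kappa> G. 0 < \<kappa> \<Longrightarrow> G \<in> borel_measurable (lebesgue_on (einterval 0 L)) \<Longrightarrow>
    Bnorm L p r b (dil L \<kappa> G) \<le> ennreal (K * \<kappa> powr (- recip p) * max \<kappa> (1 / \<kappa>) powr \<epsilon>) * Bnorm L p r b G"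
proof -
  let ?I = "einterval 0 L"
  let ?w = "\<lambda>t. t powr (recip p - recip r) * b t"
  obtain K where K: "0 < K" "\<And>s t. s \<in> ?I \<Longrightarrow> t \<in> ?I \<Longrightarrow> b s \<le> K * max (s / t) (t / s) powr \<epsilon> * b t"
    using SV_quotient[OF b e] by blast
  show thesis
  proof (rule that[of K])
    fix \<kappa> :: real and G :: "real \<Rightarrow> ennreal"
    assume l: "0 < \<kappa>" and G: "G \<in> borel_measurable (lebesgue_on ?I)"
    let ?m = "max \<kappa> (1 / \<kappa>) powr \<epsilon>"
    let ?c = "K * \<kappa> powr (recip r - recip p) * ?m"
    let ?H = "\<lambda>t. ennreal (?w t) * G t"
    have H: "?H \<in> borel_measurable (lebesgue_on ?I)" using b G by (rule Bnorm_measurable)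
    have "Bnorm L p r b (dil L \<kappa> G) \<le> Lq r (lebesgue_on ?I) (\<lambda>t. ennreal ?c * dil L \<kappa> ?H t)"
      unfolding Bnorm_eq_Lq
    proof (rule Lq_mono[OF r])
      show "(\<lambda>t. ennreal (?w t) * dil L \<kappa> G t) \<in> borel_measurable (lebesgue_on ?I)"
        using b G l by (intro Bnorm_measurable dil_measurable)
      fix t assume "t \<in> space (lebesgue_on ?I)"
      then have t: "t \<in> ?I" by simp
      then have t0: "0 < t" by (simp add: einterval_0_iff)
      show "ennreal (?w t) * dil L \<kappa> G t \<le> ennreal ?c * dil L \<kappa> ?H t"
      proof (cases "\<kappa> * t \<in> ?I")
        case True
        have "b t \<le> K * ?m * b (\<kappa> * t)"
          using K(2)[OF t True] l t0 by (simp add: max.commute)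
        then have "?w t \<le> t powr (recip p - recip r) * (K * ?m * b (\<kappa> * t))"
          by (intro mult_left_mono) auto
        also have "\<dots> = ?c * ?w (\<kappa> * t)"
        proof -
          have "t powr (recip p - recip r) = \<kappa> powr (recip r - recip p) * (\<kappa> * t) powr (recip p - recip r)"
            using l t0 by (simp add: powr_mult powr_diff)
          then show ?thesis by (simp add: mult_ac)
        qed
        finally have "?w t \<le> ?c * ?w (\<kappa> * t)" .
        then have "ennreal (?w t) \<le> ennreal ?c * ennreal (?w (\<kappa> * t))"
          using SV_pos[OF b True] K(1) by (subst ennreal_mult[symmetric]) (auto intro!: ennreal_leI)
        then show ?thesis
          using True mult_right_mono[of "ennreal (?w t)" "ennreal ?c * ennreal (?w (\<kappa> * t))" "G (\<kappa> * t)"]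
          by (simp add: dil_def mult.assoc)
      qed (simp add: dil_def)
    qed
    also have "\<dots> = ennreal ?c * Lq r (lebesgue_on ?I) (dil L \<kappa> ?H)"
      using K by (intro Lq_cmult r dil_measurable H l) simp
    also have "\<dots> \<le> ennreal ?c * (ennreal (\<kappa> powr (- recip r)) * Lq r (lebesgue_on ?I) ?H)"
      by (intro mult_left_mono Lq_dil r H l) simp
    also have "\<dots> = ennreal (K * \<kappa> powr (- recip p) * ?m) * Bnorm L p r b G"
    proof -
      have "\<kappa> powr (recip r - recip p) * \<kappa> powr (- recip r) = \<kappa> powr (- recip p)"
        by (simp add: powr_add[symmetric])
      then have eq: "?c * \<kappa> powr (- recip r) = K * \<kappa> powr (- recip p) * ?m"
        by (simp add: mult_ac)
      show ?thesis
        unfolding Bnorm_eq_Lq eq[symmetric] using K by (intro ennreal_times_times) auto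
    qed
    finally show "Bnorm L p r b (dil L \<kappa> G) \<le> ennreal (K * \<kappa> powr (- recip p) * ?m) * Bnorm L p r b G" .
  qed (use K in simp)
qed

text \<open>Common core of both Hardy inequalities: hypothesis \<open>geo\<close> says that
  coefficient times dilation bound decays geometrically, which \<open>Lq_SUP_geometric\<close> turns
  into a bound for the supremum.\<close>

lemma Bnorm_SUP_dil:
  assumes r: "0 < r" and b: "b \<in> SV L" and e: "0 < \<epsilon>" and th: "0 < \<theta>" "\<theta> < 1" and D: "0 \<le> D"
    and lam: "\<And>k::nat. 0 < \<kappa> k" "\<And>k. 0 \<le> a k"
    and geo: "\<And>k. a k * (\<kappa> k powr (- recip p) * max (\<kappa> k) (1 / \<kappa> k) powr \<epsilon>) \<le> D * \<theta> ^ k"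
  obtains C where "0 < C" "\<And>F. F \<in> borel_measurable (lebesgue_on (einterval 0 L)) \<Longrightarrow>
    Bnorm L p r b (\<lambda>t. SUP k. ennreal (a k) * dil L (\<kappa> k) F t) \<le> ennreal C * Bnorm L p r b F"
proof -
  let ?I = "einterval 0 L"
  let ?w = "\<lambda>t. t powr (recip p - recip r) * b t"
  obtain K where K: "0 < K" "\<And>\<kappa> G. 0 < \<kappa> \<Longrightarrow> G \<in> borel_measurable (lebesgue_on ?I) \<Longrightarrow>
    Bnorm L p r b (dil L \<kappa> G) \<le> ennreal (K * \<kappa> powr (- recip p) * max \<kappa> (1 / \<kappa>) powr \<epsilon>) * Bnorm L p r b G"
    using Bnorm_dil[OF r b e] by blast
  obtain C where C: "0 < C" "\<And>M (G :: nat \<Rightarrow> real \<Rightarrow> ennreal) A. (\<And>k::nat. G k \<in> borel_measurable M) \<Longrightarrow>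
       (\<And>k. Lq r M (G k) \<le> ennreal (\<theta> ^ k) * A) \<Longrightarrow> Lq r M (\<lambda>x. SUP k. G k x) \<le> ennreal C * A"
    using Lq_SUP_geometric[OF r th] by blast
  show thesis
  \<comment> \<open>\<open>D\<close> may be 0, and the added 1 keeps the constant positive.\<close>
  proof (rule that[of "C * (K * D) + 1"])
    show "0 < C * (K * D) + 1" using C K D by (simp add: add_nonneg_pos)
    fix F :: "real \<Rightarrow> ennreal" assume F: "F \<in> borel_measurable (lebesgue_on ?I)"
    let ?G = "\<lambda>k t. ennreal (?w t) * (ennreal (a k) * dil L (\<kappa> k) F t)"
    have m: "(\<lambda>t. ennreal (a k) * dil L (\<kappa> k) F t) \<in> borel_measurable (lebesgue_on ?I)" for k
      using dil_measurable[OF F lam(1)] by measurable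
    have "Lq r (lebesgue_on ?I) (\<lambda>t. SUP k. ?G k t) \<le> ennreal C * (ennreal (K * D) * Bnorm L p r b F)"
    proof (rule C(2))
      fix k
      show "?G k \<in> borel_measurable (lebesgue_on ?I)" by (rule Bnorm_measurable[OF b m])
      have "Lq r (lebesgue_on ?I) (?G k) = ennreal (a k) * Bnorm L p r b (dil L (\<kappa> k) F)"
        using Bnorm_cmult[OF r b dil_measurable[OF F lam(1)] lam(2), of p k k] by (simp add: Bnorm_eq_Lq)
      also have "\<dots> \<le> ennreal (a k) * (ennreal (K * \<kappa> k powr (- recip p) * max (\<kappa> k) (1 / \<kappa> k) powr \<epsilon>) * Bnorm L p r b F)"
        by (intro mult_left_mono K(2) lam F) simp
      also have "\<dots> = ennreal (K * (a k * (\<kappa> k powr (- recip p) * max (\<kappa> k) (1 / \<kappa> k) powr \<epsilon>))) * Bnorm L p r b F"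
        using lam K by (subst ennreal_times_times) (simp_all add: mult_ac)
      also have "\<dots> \<le> ennreal (K * (D * \<theta> ^ k)) * Bnorm L p r b F"
        using K by (intro mult_right_mono ennreal_leI mult_left_mono geo) auto
      also have "\<dots> = ennreal (\<theta> ^ k) * (ennreal (K * D) * Bnorm L p r b F)"
        using K D th by (subst ennreal_times_times) (simp_all add: mult_ac)
      finally show "Lq r (lebesgue_on ?I) (?G k) \<le> \<dots>" .
    qed
    also have "\<dots> = ennreal (C * (K * D)) * Bnorm L p r b F"
      using C K D by (subst ennreal_times_times) simp_all
    also have "\<dots> \<le> ennreal (C * (K * D) + 1) * Bnorm L p r b F"
      using C K D by (intro mult_right_mono ennreal_leI) auto
    finally show "Bnorm L p r b (\<lambda>t. SUP k. ennreal (a k) * dil L (\<kappa> k) F t) \<le> ennreal (C * (K * D) + 1) * Bnorm L p r b F"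
      by (simp add: Bnorm_eq_Lq SUP_mult_left_ennreal)
  qed
qed

section \<open>Weighted averages and Hardy inequalities\<close>

text \<open>Common form of \<open>Hup\<close> and \<open>Hlow\<close>, with \<open>J t\<close> equal
  to (0,t) or (t,L). No rearrangement is taken, since the functions to be averaged are
  non-increasing and agree with their rearrangements on (0,L).\<close>

definition wavg ::
  "ennreal \<Rightarrow> real \<Rightarrow> (real \<Rightarrow> real) \<Rightarrow> (real \<Rightarrow> real set) \<Rightarrow> (real \<Rightarrow> ennreal) \<Rightarrow> real \<Rightarrow> ennreal" where
  "wavg W a d J h t = ennreal (inverse (t powr a * d t)) *
     Lq W (lebesgue_on (J t)) (\<lambda>v. ennreal (v powr (a - recip W) * d v) * h v)"

text \<open>The bounds on \<open>d\<close> and \<open>F\<close> together contribute (t/v)^(a-e), so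
  the integrand is dominated by v^(e - 1/W), up to factors depending on t alone. The sign of
  \<open>e\<close> is free: positive for averages over (0,t), negative for (t,L), where
  integrability is needed at the other end.\<close>

lemma wavg_le:
  assumes W: "0 < W" and K: "0 < K" "0 < C" and t: "0 < t" "0 < d t"
    and m: "(\<lambda>v. ennreal (v powr (a - recip W) * d v) * F v) \<in> borel_measurable (lebesgue_on (J t))"
    and v0: "\<And>v. v \<in> J t \<Longrightarrow> 0 < v"
    and dv: "\<And>v. v \<in> J t \<Longrightarrow> d v \<le> K * (t / v) powr e * d t"
    and F: "\<And>v. v \<in> J t \<Longrightarrow> F v \<le> ennreal ((t / v) powr (a - 2 * e)) * S"
    and pw: "Lq W (lebesgue_on (J t)) (\<lambda>v. ennreal (v powr (e - recip W))) \<le> ennreal (C * t powr e)"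
  shows "wavg W a d J F t \<le> ennreal (K * C) * S"
proof (cases S)
  case (real s)
  let ?c = "K * d t * t powr (a - e) * s"
  have "Lq W (lebesgue_on (J t)) (\<lambda>v. ennreal (v powr (a - recip W) * d v) * F v)
      \<le> Lq W (lebesgue_on (J t)) (\<lambda>v. ennreal ?c * ennreal (v powr (e - recip W)))"
  proof (rule Lq_mono[OF W _ m])
    fix v assume "v \<in> space (lebesgue_on (J t))"
    then have v: "v \<in> J t" by (simp add: space_restrict_space)
    have "ennreal (v powr (a - recip W) * d v) * F v
        \<le> ennreal (v powr (a - recip W) * (K * (t / v) powr e * d t)) * (ennreal ((t / v) powr (a - 2 * e)) * S)"
      using dv[OF v] F[OF v] by (intro mult_mono ennreal_leI mult_left_mono) auto
    also have "\<dots> = ennreal (v powr (a - recip W) * (K * (t / v) powr e * d t) * ((t / v) powr (a - 2 * e) * s))"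
      using real K t by (simp add: ennreal_mult[symmetric])
    also have "v powr (a - recip W) * (K * (t / v) powr e * d t) * ((t / v) powr (a - 2 * e) * s)
        = K * d t * s * (v powr (a - recip W) * ((t / v) powr e * (t / v) powr (a - 2 * e)))"
      by (simp add: mult_ac)
    also have "v powr (a - recip W) * ((t / v) powr e * (t / v) powr (a - 2 * e)) = t powr (a - e) * v powr (e - recip W)"
      using v0[OF v] t by (simp add: powr_def ln_div mult_exp_exp algebra_simps)
    finally show "ennreal (v powr (a - recip W) * d v) * F v \<le> ennreal ?c * ennreal (v powr (e - recip W))"
      using K t real by (simp add: ennreal_mult[symmetric] mult_ac)
  qed
  also have "\<dots> = ennreal ?c * Lq W (lebesgue_on (J t)) (\<lambda>v. ennreal (v powr (e - recip W)))"
    using K t real by (intro Lq_cmult W powr_measurable_lebesgue_on) auto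
  also have "\<dots> \<le> ennreal ?c * ennreal (C * t powr e)" by (intro mult_left_mono pw) simp
  finally have "wavg W a d J F t \<le> ennreal (inverse (t powr a * d t)) * (ennreal ?c * ennreal (C * t powr e))"
    unfolding wavg_def by (rule mult_left_mono) simp
  also have "\<dots> = ennreal (inverse (t powr a * d t) * (?c * (C * t powr e)))"
    using K t real by (simp add: ennreal_mult[symmetric])
  also have "inverse (t powr a * d t) * (?c * (C * t powr e)) = K * C * s"
  proof -
    have "t powr (a - e) * t powr e = t powr a" by (simp add: powr_add[symmetric])
    then have eq: "?c * (C * t powr e) = (t powr a * d t) * (K * C * s)" by (simp add: mult_ac)
    have canc: "inverse x * (x * y) = y" if "x \<noteq> 0" for x y :: real using that by simp
    show ?thesis unfolding eq by (rule canc) (use t in simp)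
  qed
  finally show ?thesis using K real by (simp add: ennreal_mult)
next
  case top
  then show ?thesis using K by (simp add: ennreal_mult_top)
qed

lemma dyadic:
  assumes "0 < x" "x \<le> 1"
  obtains k :: nat where "2 powr (- (real k + 1)) \<le> x" "x \<le> 2 powr (- real k)"
proof -
  define k where "k = nat \<lfloor>- log 2 x\<rfloor>"
  have "log 2 x \<le> 0" using assms by (simp add: log_le_zero_cancel_iff)
  then have "real k \<le> - log 2 x" "- log 2 x \<le> real k + 1"
    unfolding k_def by linarith+
  then have "2 powr (- (real k + 1)) \<le> 2 powr (log 2 x)" "2 powr (log 2 x) \<le> 2 powr (- real k)"
    by (intro powr_mono; simp)+
  then show thesis using assms by (intro that[of k]) simp_all
qed

lemma max_powr_inverse:
  fixes x :: real
  shows "max (2 powr x) (1 / 2 powr x) = 2 powr \<bar>x\<bar>"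
proof -
  have "1 / 2 powr x = 2 powr (- x)" by (simp add: powr_minus_divide)
  then show ?thesis by (cases "0 \<le> x") (auto simp: max_def)
qed

lemma Bnorm_wavg_initial:
  assumes r: "0 < r" and W: "0 < W" and b: "b \<in> SV L" and d: "d \<in> SV L" and a: "recip p < a"
  obtains C where "0 < C" "\<And>F. F \<in> borel_measurable (lebesgue_on (einterval 0 L)) \<Longrightarrow>
    (\<And>s t. 0 < s \<Longrightarrow> s \<le> t \<Longrightarrow> F t \<le> F s) \<Longrightarrow>
    wavg W a d (\<lambda>t. einterval 0 t) F \<in> borel_measurable (lebesgue_on (einterval 0 L)) \<Longrightarrow>
    Bnorm L p r b (wavg W a d (\<lambda>t. einterval 0 t) F) \<le> ennreal C * Bnorm L p r b F"
proof -
  let ?I = "einterval 0 L"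
  let ?J = "\<lambda>t::real. einterval 0 t"
  \<comment> \<open>Two parts of the gap are spent inside the average (on \<open>d\<close> and on
    integrability), so \<alpha> = a - 2\<epsilon> = 1/p + 2\<epsilon>; the other two serve the
    distortion by \<open>b\<close> and the geometric decay.\<close>
  define \<epsilon> where "\<epsilon> = (a - recip p) / 4"
  have e: "0 < \<epsilon>" using a by (simp add: \<epsilon>_def)
  define \<alpha> where "\<alpha> = a - 2 * \<epsilon>"
  have al: "0 \<le> \<alpha>" using a recip_nonneg[of p] by (simp add: \<alpha>_def \<epsilon>_def)
  obtain K where K: "0 < K" "\<And>s t. s \<in> ?I \<Longrightarrow> t \<in> ?I \<Longrightarrow> d s \<le> K * max (s / t) (t / s) powr \<epsilon> * d t"
    using SV_quotient[OF d e] by blast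
  obtain C1 where C1: "0 < C1" "\<And>t. 0 < t \<Longrightarrow>
    Lq W (lebesgue_on {0<..<t}) (\<lambda>v. ennreal (v powr (\<epsilon> - recip W))) \<le> ennreal (C1 * t powr \<epsilon>)"
    using Lq_powr_initial[OF W e] by blast
  \<comment> \<open>Block k collects the v with 2^(-k-1) \<le> v/t \<le> 2^(-k): there F(v) \<le>
    F(\<kappa>_k t) at the lower end, and (v/t)^\<alpha> \<le> c_k at the upper end.\<close>
  define c where "c k = 2 powr (- \<alpha> * real k)" for k
  define \<kappa> where "\<kappa> k = (2::real) powr (- (real k + 1))" for k
  have geo: "c k * (\<kappa> k powr (- recip p) * max (\<kappa> k) (1 / \<kappa> k) powr \<epsilon>) \<le> 2 powr (recip p + \<epsilon>) * (2 powr (- \<epsilon>)) ^ k" for k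
  proof -
    have "c k * (\<kappa> k powr (- recip p) * max (\<kappa> k) (1 / \<kappa> k) powr \<epsilon>)
        = 2 powr (- \<alpha> * real k + (- (real k + 1) * - recip p + \<bar>- (real k + 1)\<bar> * \<epsilon>))"
      unfolding c_def \<kappa>_def max_powr_inverse powr_powr powr_add[symmetric] ..
    also have "\<bar>- (real k + 1)\<bar> = real k + 1" by simp
    also have "- \<alpha> * real k + (- (real k + 1) * - recip p + (real k + 1) * \<epsilon>) = (recip p + \<epsilon>) + (- \<epsilon>) * real k"
      by (simp add: \<alpha>_def \<epsilon>_def field_simps)
    also have "2 powr \<dots> = 2 powr (recip p + \<epsilon>) * (2 powr (- \<epsilon>)) ^ k"
      unfolding powr_add[of 2 "recip p + \<epsilon>" "- \<epsilon> * real k"] by (simp add: powr_power mult.commute)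
    finally show ?thesis by simp
  qed
  obtain C2 where C2: "0 < C2" "\<And>F. F \<in> borel_measurable (lebesgue_on ?I) \<Longrightarrow>
    Bnorm L p r b (\<lambda>t. SUP k. ennreal (c k) * dil L (\<kappa> k) F t) \<le> ennreal C2 * Bnorm L p r b F"
    by (rule Bnorm_SUP_dil[OF r b e, of "2 powr (- \<epsilon>)" "2 powr (recip p + \<epsilon>)" \<kappa> c p])
      (use e geo in \<open>auto simp: c_def \<kappa>_def powr_minus_divide\<close>)
  show thesis
  proof (rule that[of "K * C1 * C2"])
    show "0 < K * C1 * C2" using K C1 C2 by simp
    fix F
    assume F: "F \<in> borel_measurable (lebesgue_on ?I)" and anti: "\<And>s t. 0 < s \<Longrightarrow> s \<le> t \<Longrightarrow> F t \<le> F s"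
      and m: "wavg W a d ?J F \<in> borel_measurable (lebesgue_on ?I)"
    let ?S = "\<lambda>t. SUP k. ennreal (c k) * dil L (\<kappa> k) F t"
    have "wavg W a d ?J F t \<le> ennreal (K * C1) * ?S t" if t: "t \<in> ?I" for t
    proof (rule wavg_le[where e=\<epsilon>])
      have t0: "0 < t" using t by (simp add: einterval_0_iff)
      have sub: "?J t \<subseteq> ?I" using einterval_down[OF t] by (auto simp: einterval_0_ereal)
      show "(\<lambda>v. ennreal (v powr (a - recip W) * d v) * F v) \<in> borel_measurable (lebesgue_on (?J t))"
        by (rule measurable_lebesgue_on_subset[OF weighted_measurable[OF SV_measurable[OF d] F] sub])
      show "0 < t" "0 < d t" using t0 SV_pos[OF d t] by auto
      fix v assume v: "v \<in> ?J t"
      then have vt: "0 < v" "v < t" by (auto simp: einterval_0_ereal)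
      show "0 < v" by fact
      have "v / t \<le> 1" "1 \<le> t / v" using vt by auto
      then have "max (v / t) (t / v) = t / v" by simp
      then show "d v \<le> K * (t / v) powr \<epsilon> * d t" using K(2)[of v t] v sub t by auto
      obtain k where k: "2 powr (- (real k + 1)) \<le> v / t" "v / t \<le> 2 powr (- real k)"
        using dyadic[of "v / t"] vt by auto
      have le: "\<kappa> k * t \<le> v" "0 < \<kappa> k * t" using k(1) t0 by (auto simp: \<kappa>_def field_simps)
      have kI: "\<kappa> k * t \<in> ?I" using einterval_down[of v] v sub le by auto
      \<comment> \<open>The upper dyadic bound pays for the coefficient; the lower one was used for
        \<open>le\<close> and will pay for monotonicity of \<open>F\<close>.\<close>
      have "1 \<le> (t / v) * 2 powr (- real k)" using k(2) vt t0 by (simp add: field_simps)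
      then have "1 powr \<alpha> \<le> ((t / v) * 2 powr (- real k)) powr \<alpha>" using al by (intro powr_mono2) auto
      also have "\<dots> = (t / v) powr \<alpha> * (2 powr (- real k)) powr \<alpha>" by (rule powr_mult)
      also have "(2 powr (- real k)) powr \<alpha> = c k" by (simp add: powr_powr c_def mult.commute)
      finally have one: "1 \<le> (t / v) powr \<alpha> * c k" by simp
      have "F v \<le> F (\<kappa> k * t)" using le by (intro anti) auto
      also have "\<dots> = 1 * dil L (\<kappa> k) F t" using kI by (simp add: dil_def)
      also have "\<dots> \<le> ennreal ((t / v) powr \<alpha> * c k) * dil L (\<kappa> k) F t"
        using one by (intro mult_right_mono) (auto simp: one_ennreal.rep_eq ennreal_leI simp flip: ennreal_1)
      also have "\<dots> = ennreal ((t / v) powr \<alpha>) * (ennreal (c k) * dil L (\<kappa> k) F t)"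
        by (subst ennreal_times_times) (auto simp: c_def)
      also have "\<dots> \<le> ennreal ((t / v) powr \<alpha>) * ?S t" by (intro mult_left_mono SUP_upper) auto
      finally show "F v \<le> ennreal ((t / v) powr (a - 2 * \<epsilon>)) * ?S t" by (simp add: \<alpha>_def)
    next
      show "Lq W (lebesgue_on (?J t)) (\<lambda>v. ennreal (v powr (\<epsilon> - recip W))) \<le> ennreal (C1 * t powr \<epsilon>)"
        using C1(2)[of t] t by (simp add: einterval_0_ereal einterval_0_iff)
    qed (use W K C1 in auto)
    then have "Bnorm L p r b (wavg W a d ?J F) \<le> Bnorm L p r b (\<lambda>t. ennreal (K * C1) * ?S t)"
      by (intro Bnorm_mono r b m)
    also have "\<dots> = ennreal (K * C1) * Bnorm L p r b ?S"
      using K C1 F by (intro Bnorm_cmult r b borel_measurable_SUP borel_measurable_times_ennreal dil_measurable) (auto simp: \<kappa>_def)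
    also have "\<dots> \<le> ennreal (K * C1) * (ennreal C2 * Bnorm L p r b F)"
      by (intro mult_left_mono C2(2) F) simp
    also have "\<dots> = ennreal (K * C1 * C2) * Bnorm L p r b F"
      using K C1 C2 by (subst ennreal_times_times) auto
    finally show "Bnorm L p r b (wavg W a d ?J F) \<le> ennreal (K * C1 * C2) * Bnorm L p r b F" .
  qed
qed

text \<open>Mirror image of the previous bound: large v instead of small, \<beta> = a + 2\<epsilon>
  = 1/p - 2\<epsilon> instead of \<alpha>, and dilations by factors at least 1. Here 0 \<le> a
  ensures \<beta> \<ge> 0, so that powers with exponent \<beta> are monotone.\<close>

lemma Bnorm_wavg_final:
  assumes r: "0 < r" and W: "0 < W" and b: "b \<in> SV L" and d: "d \<in> SV L" and a: "0 \<le> a" "a < recip p"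
  obtains C where "0 < C" "\<And>F. F \<in> borel_measurable (lebesgue_on (einterval 0 L)) \<Longrightarrow>
    (\<And>s t. 0 < s \<Longrightarrow> s \<le> t \<Longrightarrow> F t \<le> F s) \<Longrightarrow>
    wavg W a d (\<lambda>t. einterval t L) F \<in> borel_measurable (lebesgue_on (einterval 0 L)) \<Longrightarrow>
    Bnorm L p r b (wavg W a d (\<lambda>t. einterval t L) F) \<le> ennreal C * Bnorm L p r b F"
proof -
  let ?I = "einterval 0 L"
  let ?J = "\<lambda>t::real. einterval t L"
  define \<epsilon> where "\<epsilon> = (recip p - a) / 4"
  have e: "0 < \<epsilon>" using a by (simp add: \<epsilon>_def)
  define \<beta> where "\<beta> = a + 2 * \<epsilon>"
  have be: "0 \<le> \<beta>" using a e by (simp add: \<beta>_def)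
  obtain K where K: "0 < K" "\<And>s t. s \<in> ?I \<Longrightarrow> t \<in> ?I \<Longrightarrow> d s \<le> K * max (s / t) (t / s) powr \<epsilon> * d t"
    using SV_quotient[OF d e] by blast
  obtain C1 where C1: "0 < C1" "\<And>t. 0 < t \<Longrightarrow>
    Lq W (lebesgue_on {t<..}) (\<lambda>v. ennreal (v powr (- \<epsilon> - recip W))) \<le> ennreal (C1 * t powr (- \<epsilon>))"
    using Lq_powr_final[OF W e] by blast
  \<comment> \<open>On block k, 2^k \<le> v/t \<le> 2^(k+1). \<open>F\<close> is evaluated at the
    lower end, hence \<kappa>_k = 2^k, while (v/t)^\<beta> is bounded at the upper end, hence the
    exponent k + 1.\<close>
  define c where "c k = 2 powr (\<beta> * (real k + 1))" for k
  define \<kappa> where "\<kappa> k = (2::real) powr (real k)" for k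
  have geo: "c k * (\<kappa> k powr (- recip p) * max (\<kappa> k) (1 / \<kappa> k) powr \<epsilon>) \<le> 2 powr \<beta> * (2 powr (- \<epsilon>)) ^ k" for k
  proof -
    have "c k * (\<kappa> k powr (- recip p) * max (\<kappa> k) (1 / \<kappa> k) powr \<epsilon>)
        = 2 powr (\<beta> * (real k + 1) + (real k * - recip p + \<bar>real k\<bar> * \<epsilon>))"
      unfolding c_def \<kappa>_def max_powr_inverse powr_powr powr_add[symmetric] ..
    also have "\<beta> * (real k + 1) + (real k * - recip p + \<bar>real k\<bar> * \<epsilon>) = \<beta> + (- \<epsilon>) * real k"
      by (simp add: \<beta>_def \<epsilon>_def field_simps)
    also have "2 powr \<dots> = 2 powr \<beta> * (2 powr (- \<epsilon>)) ^ k"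
      unfolding powr_add[of 2 \<beta> "- \<epsilon> * real k"] by (simp add: powr_power mult.commute)
    finally show ?thesis by simp
  qed
  obtain C2 where C2: "0 < C2" "\<And>F. F \<in> borel_measurable (lebesgue_on ?I) \<Longrightarrow>
    Bnorm L p r b (\<lambda>t. SUP k. ennreal (c k) * dil L (\<kappa> k) F t) \<le> ennreal C2 * Bnorm L p r b F"
    by (rule Bnorm_SUP_dil[OF r b e, of "2 powr (- \<epsilon>)" "2 powr \<beta>" \<kappa> c p])
      (use e geo in \<open>auto simp: c_def \<kappa>_def powr_minus_divide\<close>)
  show thesis
  proof (rule that[of "K * C1 * C2"])
    show "0 < K * C1 * C2" using K C1 C2 by simp
    fix F
    assume F: "F \<in> borel_measurable (lebesgue_on ?I)" and anti: "\<And>s t. 0 < s \<Longrightarrow> s \<le> t \<Longrightarrow> F t \<le> F s"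
      and m: "wavg W a d ?J F \<in> borel_measurable (lebesgue_on ?I)"
    let ?S = "\<lambda>t. SUP k. ennreal (c k) * dil L (\<kappa> k) F t"
    have "wavg W a d ?J F t \<le> ennreal (K * C1) * ?S t" if t: "t \<in> ?I" for t
    proof (rule wavg_le[where e="- \<epsilon>"])
      have t0: "0 < t" using t by (simp add: einterval_0_iff)
      have J: "v \<in> ?J t \<longleftrightarrow> t < v \<and> v \<in> ?I" for v using t0 by (auto simp: einterval_iff)
      then have sub: "?J t \<subseteq> ?I" by auto
      show "(\<lambda>v. ennreal (v powr (a - recip W) * d v) * F v) \<in> borel_measurable (lebesgue_on (?J t))"
        by (rule measurable_lebesgue_on_subset[OF weighted_measurable[OF SV_measurable[OF d] F] sub])
      show "0 < t" "0 < d t" using t0 SV_pos[OF d t] by auto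
      fix v assume v: "v \<in> ?J t"
      then have vt: "0 < v" "t < v" and vI: "v \<in> ?I" using t0 by (auto simp: J)
      show "0 < v" by fact
      have "t / v \<le> 1" "1 \<le> v / t" using vt t0 by auto
      then have "max (v / t) (t / v) = v / t" by simp
      moreover have "(v / t) powr \<epsilon> = (t / v) powr (- \<epsilon>)" using vt t0 by (simp add: powr_divide powr_minus_divide)
      ultimately show "d v \<le> K * (t / v) powr (- \<epsilon>) * d t" using K(2)[OF vI t] by simp
      obtain k where k: "2 powr (- (real k + 1)) \<le> t / v" "t / v \<le> 2 powr (- real k)"
        using dyadic[of "t / v"] vt t0 by auto
      have le: "\<kappa> k * t \<le> v" "0 < \<kappa> k * t"
        using k(2) t0 vt by (auto simp: \<kappa>_def powr_minus field_simps)
      have kI: "\<kappa> k * t \<in> ?I" using einterval_down[OF vI] le by auto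
      have "2 powr (- (real k + 1)) * 2 powr (real k + 1) \<le> (t / v) * 2 powr (real k + 1)"
        by (rule mult_right_mono[OF k(1)]) simp
      then have "1 \<le> (t / v) * 2 powr (real k + 1)" by (simp add: powr_add[symmetric])
      then have "1 powr \<beta> \<le> ((t / v) * 2 powr (real k + 1)) powr \<beta>" using be by (intro powr_mono2) auto
      also have "\<dots> = (t / v) powr \<beta> * (2 powr (real k + 1)) powr \<beta>" by (rule powr_mult)
      also have "(2 powr (real k + 1)) powr \<beta> = c k" unfolding powr_powr c_def by (simp add: mult.commute)
      finally have one: "1 \<le> (t / v) powr \<beta> * c k" by simp
      have "F v \<le> F (\<kappa> k * t)" using le by (intro anti) auto
      also have "\<dots> = 1 * dil L (\<kappa> k) F t" using kI by (simp add: dil_def)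
      also have "\<dots> \<le> ennreal ((t / v) powr \<beta> * c k) * dil L (\<kappa> k) F t"
        using one by (intro mult_right_mono) (auto simp: ennreal_leI simp flip: ennreal_1)
      also have "\<dots> = ennreal ((t / v) powr \<beta>) * (ennreal (c k) * dil L (\<kappa> k) F t)"
        by (subst ennreal_times_times) (auto simp: c_def)
      also have "\<dots> \<le> ennreal ((t / v) powr \<beta>) * ?S t" by (intro mult_left_mono SUP_upper) auto
      finally show "F v \<le> ennreal ((t / v) powr (a - 2 * - \<epsilon>)) * ?S t" by (simp add: \<beta>_def)
    next
      have t0: "0 < t" using t by (simp add: einterval_0_iff)
      \<comment> \<open>Enlarging (t,L) to (t,\<infinity>) removes \<open>L\<close> from the power
        integral.\<close>
      have "Lq W (lebesgue_on (?J t)) (\<lambda>v. ennreal (v powr (- \<epsilon> - recip W)))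
          \<le> Lq W (lebesgue_on {t<..}) (\<lambda>v. ennreal (v powr (- \<epsilon> - recip W)))"
        by (intro Lq_domain_mono W powr_measurable_lebesgue_on) (auto simp: einterval_iff)
      also have "\<dots> \<le> ennreal (C1 * t powr (- \<epsilon>))" by (rule C1(2)[OF t0])
      finally show "Lq W (lebesgue_on (?J t)) (\<lambda>v. ennreal (v powr (- \<epsilon> - recip W))) \<le> ennreal (C1 * t powr (- \<epsilon>))" .
    qed (use W K C1 in auto)
    then have "Bnorm L p r b (wavg W a d ?J F) \<le> Bnorm L p r b (\<lambda>t. ennreal (K * C1) * ?S t)"
      by (intro Bnorm_mono r b m)
    also have "\<dots> = ennreal (K * C1) * Bnorm L p r b ?S"
      using K C1 F by (intro Bnorm_cmult r b borel_measurable_SUP borel_measurable_times_ennreal dil_measurable) (auto simp: \<kappa>_def)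
    also have "\<dots> \<le> ennreal (K * C1) * (ennreal C2 * Bnorm L p r b F)"
      by (intro mult_left_mono C2(2) F) simp
    also have "\<dots> = ennreal (K * C1 * C2) * Bnorm L p r b F"
      using K C1 C2 by (subst ennreal_times_times) auto
    finally show "Bnorm L p r b (wavg W a d ?J F) \<le> ennreal (K * C1 * C2) * Bnorm L p r b F" .
  qed
qed

section \<open>Lower bounds for the averages from the interval (t/2,t)\<close>

lemma powr_lower_half:
  fixes x :: real
  assumes "0 < t" "t / 2 < v" "v < t"
  shows "2 powr (- \<bar>x\<bar>) * t powr x \<le> v powr x"
proof (cases "0 \<le> x")
  case True
  then have "(t / 2) powr x \<le> v powr x" using assms by (intro powr_mono2) auto
  then show ?thesis using True assms by (simp add: powr_divide powr_minus_divide)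
next
  case False
  then have "t powr x \<le> v powr x" using assms by (intro powr_mono2') auto
  moreover have "2 powr (- \<bar>x\<bar>) * t powr x \<le> 1 * t powr x"
    by (intro mult_right_mono) (auto simp: powr_minus_divide ge_one_powr_ge_zero)
  ultimately show ?thesis by simp
qed

text \<open>On (t/2,t) both weights are comparable to their values at t, and F(v) \<ge> F(t); the
  norm of a constant over this interval is explicit.\<close>

lemma Lq_window_ge:
  assumes W: "0 < W" and d: "d \<in> SV L"
  obtains c where "0 < c" "\<And>F t. t \<in> einterval 0 L \<Longrightarrow> (\<And>s t. 0 < s \<Longrightarrow> s \<le> t \<Longrightarrow> F t \<le> F s) \<Longrightarrow>
    ennreal (c * (t powr a * d t)) * F t
      \<le> Lq W (lebesgue_on {t/2<..<t}) (\<lambda>v. ennreal (v powr (a - recip W) * d v) * F v)"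
proof -
  let ?I = "einterval 0 L"
  obtain K where K: "0 < K" "\<And>s t. s \<in> ?I \<Longrightarrow> t \<in> ?I \<Longrightarrow> d s \<le> K * max (s / t) (t / s) powr 1 * d t"
    using SV_quotient[OF d zero_less_one] by blast
  define x where "x = a - recip W"
  \<comment> \<open>The factors come from the power weight, from \<open>d\<close> at arguments of
    ratio at most 2 (Potter exponent 1), and from the length t/2 of the interval.\<close>
  define c where "c = 2 powr (- \<bar>x\<bar>) / (2 * K) / 2 powr recip W"
  show thesis
  proof (rule that[of c])
    show "0 < c" using K by (simp add: c_def)
    fix F :: "real \<Rightarrow> ennreal" and t
    assume t: "t \<in> ?I" and anti: "\<And>s t. 0 < s \<Longrightarrow> s \<le> t \<Longrightarrow> F t \<le> F s"
    then have t0: "0 < t" and dt: "0 < d t" using SV_pos[OF d] by (auto simp: einterval_0_iff)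
    let ?y = "2 powr (- \<bar>x\<bar>) * t powr x * (d t / (2 * K))"
    have "c * (t powr a * d t) = (t / 2) powr recip W * ?y"
    proof -
      have "t powr a = t powr recip W * t powr x" by (simp add: x_def powr_add[symmetric])
      then show ?thesis using t0 by (simp add: c_def powr_divide mult_ac)
    qed
    then have "ennreal (c * (t powr a * d t)) * F t = ennreal ((t / 2) powr recip W) * (ennreal ?y * F t)"
      using K dt by (subst ennreal_times_times) auto
    also have "\<dots> = Lq W (lebesgue_on {t/2<..<t}) (\<lambda>_. ennreal ?y * F t)"
      by (rule Lq_const[OF W t0, symmetric])
    also have "\<dots> \<le> Lq W (lebesgue_on {t/2<..<t}) (\<lambda>v. ennreal (v powr (a - recip W) * d v) * F v)"
    proof (rule Lq_mono[OF W])
      fix v assume "v \<in> space (lebesgue_on {t/2<..<t})"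
      then have v: "t / 2 < v" "v < t" by (auto simp: space_restrict_space)
      then have vI: "v \<in> ?I" using t0 by (intro einterval_down[OF t]) auto
      have "max (t / v) (v / t) \<le> 2" using v t0 by (auto simp: field_simps)
      then have "max (t / v) (v / t) powr 1 \<le> 2" using v t0 by (auto simp: max_def)
      then have "K * max (t / v) (v / t) powr 1 * d v \<le> K * 2 * d v"
        using K SV_pos[OF d vI] by (intro mult_right_mono mult_left_mono) auto
      with K(2)[OF t vI] have "d t \<le> K * 2 * d v" by simp
      then have "d t / (2 * K) \<le> d v" using K by (simp add: field_simps)
      then have "?y \<le> v powr (a - recip W) * d v"
        unfolding x_def[symmetric] using K dt by (intro mult_mono powr_lower_half[OF t0 v]) simp_all
      then show "ennreal ?y * F t \<le> ennreal (v powr (a - recip W) * d v) * F v"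
        by (rule mult_mono[OF ennreal_leI anti]) (use v t0 in auto)
    qed simp
    finally show "ennreal (c * (t powr a * d t)) * F t \<le> \<dots>" .
  qed
qed

lemma inverse_weight_cancel:
  assumes "0 < x" "0 \<le> y" "ennreal (y * x) * z \<le> w"
  shows "ennreal y * z \<le> ennreal (inverse x) * w"
proof -
  have "inverse x * (y * x) = y" using assms(1) by simp
  then have "ennreal y * z = ennreal (inverse x) * (ennreal (y * x) * z)"
    using assms ennreal_times_times[of "inverse x" "y * x" z] by (simp only: less_imp_le inverse_nonnegative_iff_nonnegative mult_nonneg_nonneg)
  also have "\<dots> \<le> ennreal (inverse x) * w" using assms(3) by (rule mult_left_mono) simp
  finally show ?thesis .
qed

lemma ennreal_divide_le:
  assumes "0 < c" "ennreal c * x \<le> y"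
  shows "x \<le> ennreal (1 / c) * y"
proof -
  have "x = ennreal (1 / c) * (ennreal c * x)" using assms by (subst ennreal_times_times) auto
  also have "\<dots> \<le> ennreal (1 / c) * y" using assms(2) by (rule mult_left_mono) simp
  finally show ?thesis .
qed

lemma Bnorm_le_wavg_initial:
  assumes r: "0 < r" and W: "0 < W" and b: "b \<in> SV L" and d: "d \<in> SV L"
  obtains C where "0 < C" "\<And>F. F \<in> borel_measurable (lebesgue_on (einterval 0 L)) \<Longrightarrow>
    (\<And>s t. 0 < s \<Longrightarrow> s \<le> t \<Longrightarrow> F t \<le> F s) \<Longrightarrow>
    wavg W a d (\<lambda>t. einterval 0 t) F \<in> borel_measurable (lebesgue_on (einterval 0 L)) \<Longrightarrow>
    Bnorm L p r b F \<le> ennreal C * Bnorm L p r b (wavg W a d (\<lambda>t. einterval 0 t) F)"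
proof -
  let ?I = "einterval 0 L"
  obtain c where c: "0 < c" "\<And>F t. t \<in> ?I \<Longrightarrow> (\<And>s t. 0 < s \<Longrightarrow> s \<le> t \<Longrightarrow> F t \<le> F s) \<Longrightarrow>
    ennreal (c * (t powr a * d t)) * F t
      \<le> Lq W (lebesgue_on {t/2<..<t}) (\<lambda>v. ennreal (v powr (a - recip W) * d v) * F v)"
    using Lq_window_ge[OF W d] by blast
  show thesis
  proof (rule that[of "1 / c"])
    show "0 < 1 / c" using c by simp
    fix F
    assume F: "F \<in> borel_measurable (lebesgue_on ?I)" and anti: "\<And>s t. 0 < s \<Longrightarrow> s \<le> t \<Longrightarrow> F t \<le> F s"
      and m: "wavg W a d (\<lambda>t. einterval 0 t) F \<in> borel_measurable (lebesgue_on ?I)"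
    have "F t \<le> ennreal (1 / c) * wavg W a d (\<lambda>t. einterval 0 t) F t" if t: "t \<in> ?I" for t
    proof (rule ennreal_divide_le[OF c(1)])
      have t0: "0 < t" and dt: "0 < d t" using t SV_pos[OF d t] by (auto simp: einterval_0_iff)
      have sub: "einterval 0 t \<subseteq> ?I" using einterval_down[OF t] by (auto simp: einterval_0_ereal)
      have "ennreal (c * (t powr a * d t)) * F t
          \<le> Lq W (lebesgue_on (einterval 0 t)) (\<lambda>v. ennreal (v powr (a - recip W) * d v) * F v)"
      proof (rule order_trans[OF c(2)[OF t anti] Lq_domain_mono[OF W]])
        show "(\<lambda>v. ennreal (v powr (a - recip W) * d v) * F v) \<in> borel_measurable (lebesgue_on (einterval 0 t))"
          by (rule measurable_lebesgue_on_subset[OF weighted_measurable[OF SV_measurable[OF d] F] sub])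
      qed (use t0 in \<open>auto simp: einterval_0_ereal\<close>)
      then show "ennreal c * F t \<le> wavg W a d (\<lambda>t. einterval 0 t) F t"
        unfolding wavg_def using t0 dt c by (intro inverse_weight_cancel) auto
    qed
    then have "Bnorm L p r b F \<le> Bnorm L p r b (\<lambda>t. ennreal (1 / c) * wavg W a d (\<lambda>t. einterval 0 t) F t)"
      by (intro Bnorm_mono r b F)
    also have "\<dots> = ennreal (1 / c) * Bnorm L p r b (wavg W a d (\<lambda>t. einterval 0 t) F)"
      using c by (intro Bnorm_cmult r b m) simp
    finally show "Bnorm L p r b F \<le> \<dots>" .
  qed
qed

text \<open>The average over \<open>(t, L)\<close> may vanish as \<open>t\<close> tends to \<open>L\<close>, so it is evaluated at \<open>t/2\<close>.\<close>

lemma Bnorm_le_wavg_final: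
  assumes r: "0 < r" and W: "0 < W" and b: "b \<in> SV L" and d: "d \<in> SV L"
  obtains C where "0 < C" "\<And>F. F \<in> borel_measurable (lebesgue_on (einterval 0 L)) \<Longrightarrow>
    (\<And>s t. 0 < s \<Longrightarrow> s \<le> t \<Longrightarrow> F t \<le> F s) \<Longrightarrow>
    wavg W a d (\<lambda>t. einterval t L) F \<in> borel_measurable (lebesgue_on (einterval 0 L)) \<Longrightarrow>
    Bnorm L p r b F \<le> ennreal C * Bnorm L p r b (wavg W a d (\<lambda>t. einterval t L) F)"
proof -
  let ?I = "einterval 0 L"
  obtain c where c: "0 < c" "\<And>F t. t \<in> ?I \<Longrightarrow> (\<And>s t. 0 < s \<Longrightarrow> s \<le> t \<Longrightarrow> F t \<le> F s) \<Longrightarrow>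
    ennreal (c * (t powr a * d t)) * F t
      \<le> Lq W (lebesgue_on {t/2<..<t}) (\<lambda>v. ennreal (v powr (a - recip W) * d v) * F v)"
    using Lq_window_ge[OF W d] by blast
  obtain K where K: "0 < K" "\<And>s t. s \<in> ?I \<Longrightarrow> t \<in> ?I \<Longrightarrow> d s \<le> K * max (s / t) (t / s) powr 1 * d t"
    using SV_quotient[OF d zero_less_one] by blast
  obtain K' where K': "0 < K'" "\<And>\<kappa> G. 0 < \<kappa> \<Longrightarrow> G \<in> borel_measurable (lebesgue_on ?I) \<Longrightarrow>
    Bnorm L p r b (dil L \<kappa> G) \<le> ennreal (K' * \<kappa> powr (- recip p) * max \<kappa> (1 / \<kappa>) powr 1) * Bnorm L p r b G"
    using Bnorm_dil[OF r b zero_less_one] by blast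
  \<comment> \<open>The weight is converted from t to t/2: 2^a from the power and 2K from
    \<open>d\<close>. \<open>D\<close> is the dilation bound at \<kappa> = 1/2.\<close>
  define c' where "c' = c * 2 powr a / (2 * K)"
  define D where "D = K' * (1/2) powr (- recip p) * max (1/2) (1 / (1/2)) powr 1"
  have c': "0 < c'" using c K by (simp add: c'_def)
  show thesis
  proof (rule that[of "1 / c' * D"])
    show "0 < 1 / c' * D" using c' K' by (simp add: D_def)
    fix F
    assume F: "F \<in> borel_measurable (lebesgue_on ?I)" and anti: "\<And>s t. 0 < s \<Longrightarrow> s \<le> t \<Longrightarrow> F t \<le> F s"
      and m: "wavg W a d (\<lambda>t. einterval t L) F \<in> borel_measurable (lebesgue_on ?I)"
    let ?T = "wavg W a d (\<lambda>t. einterval t L) F"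
    have "F t \<le> ennreal (1 / c') * dil L (1/2) ?T t" if t: "t \<in> ?I" for t
    proof (rule ennreal_divide_le[OF c'])
      have t0: "0 < t" using t by (auto simp: einterval_0_iff)
      have hI: "t / 2 \<in> ?I" using t0 by (intro einterval_down[OF t]) auto
      have dt: "0 < d t" "0 < d (t / 2)" using SV_pos[OF d] t hI by auto
      have sub: "einterval (t / 2) L \<subseteq> ?I" using t0 by (auto simp: einterval_iff intro: less_trans[of 0 "ereal (t/2)"])
      have sub': "{t/2<..<t} \<subseteq> einterval (t / 2) L"
        using einterval_down[OF t] t0 by (auto simp: einterval_iff)
      have "max (t / 2 / t) (t / (t / 2)) powr 1 = 2" using t0 by simp
      then have "d (t / 2) \<le> K * 2 * d t" using K(2)[OF hI t] by simp
      then have "d (t / 2) / (2 * K) \<le> d t" using K by (simp add: field_simps)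
      then have "c * (t powr a * (d (t / 2) / (2 * K))) \<le> c * (t powr a * d t)"
        using c by (intro mult_left_mono) auto
      moreover have "c' * ((t / 2) powr a * d (t / 2)) = c * (t powr a * (d (t / 2) / (2 * K)))"
        using t0 by (simp add: c'_def powr_divide)
      ultimately have "ennreal (c' * ((t / 2) powr a * d (t / 2))) * F t \<le> ennreal (c * (t powr a * d t)) * F t"
        by (intro mult_right_mono ennreal_leI) auto
      also have "\<dots> \<le> Lq W (lebesgue_on (einterval (t / 2) L)) (\<lambda>v. ennreal (v powr (a - recip W) * d v) * F v)"
      proof (rule order_trans[OF c(2)[OF t anti] Lq_domain_mono[OF W _ _ sub']])
        show "(\<lambda>v. ennreal (v powr (a - recip W) * d v) * F v) \<in> borel_measurable (lebesgue_on (einterval (t / 2) L))"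
          using measurable_lebesgue_on_subset[OF weighted_measurable[OF SV_measurable[OF d] F] sub] .
      qed auto
      finally have "ennreal c' * F t \<le> ?T (t / 2)"
        unfolding wavg_def using t0 dt c' by (intro inverse_weight_cancel) auto
      then show "ennreal c' * F t \<le> dil L (1/2) ?T t" using hI by (simp add: dil_def)
    qed
    then have "Bnorm L p r b F \<le> Bnorm L p r b (\<lambda>t. ennreal (1 / c') * dil L (1/2) ?T t)"
      by (intro Bnorm_mono r b F)
    also have "\<dots> = ennreal (1 / c') * Bnorm L p r b (dil L (1/2) ?T)"
      using c' by (intro Bnorm_cmult r b dil_measurable m) auto
    also have "\<dots> \<le> ennreal (1 / c') * (ennreal D * Bnorm L p r b ?T)"
      unfolding D_def by (intro mult_left_mono K'(2) m) auto
    also have "\<dots> = ennreal (1 / c' * D) * Bnorm L p r b ?T"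
      using c' K' by (intro ennreal_times_times) (auto simp: D_def)
    finally show "Bnorm L p r b F \<le> ennreal (1 / c' * D) * Bnorm L p r b ?T" .
  qed
qed

section \<open>Equivalent r.i. quasi-norms\<close>

lemma rearr_le_1:
  assumes [measurable]: "g \<in> borel_measurable (lebesgue_on (einterval 0 L))"
    and "\<And>x. x \<in> einterval 0 L \<Longrightarrow> g x \<le> 1"
  shows "rearr L g t \<le> 1"
proof (rule ennreal_le_reals)
  fix s assume s: "0 \<le> s" "ennreal s < rearr L g t"
  show "ennreal s < 1"
  proof (rule ccontr)
    assume "\<not> ennreal s < 1"
    then have "\<not> ennreal s < g x" if "x \<in> einterval 0 L" for x
      using assms(2)[OF that] less_le_trans by blast
    then have "{x \<in> einterval 0 L. ennreal s < g x} = {}" by blast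
    then have "dfun L g s = 0" unfolding dfun_def by (simp only: emeasure_empty)
    with s show False by (simp add: less_rearr_iff)
  qed
qed

text \<open>The rearrangement is at most 1 and vanishes from m on. The first bound controls the norm
  near 0, the second supplies decay for large t.\<close>

lemma maxrearr_indicator_le:
  assumes w: "\<omega> \<in> sets lebesgue" "\<omega> \<subseteq> einterval 0 L" and m: "emeasure lebesgue \<omega> \<le> ennreal m" "0 \<le> m" and t: "0 < t"
  shows "maxrearr L (indicator \<omega>) t \<le> 1" "maxrearr L (indicator \<omega>) t \<le> ennreal (m / t)"
proof -
  let ?g = "indicator \<omega> :: real \<Rightarrow> ennreal"
  have g: "?g \<in> borel_measurable (lebesgue_on (einterval 0 L))"
    using w by (intro measurable_restrict_space1 borel_measurable_indicator) simp
  have 1: "rearr L ?g u \<le> 1" for u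
    by (rule rearr_le_1[OF g]) (auto simp: indicator_def)
  have "maxrearr L ?g t \<le> (\<integral>\<^sup>+ u. 1 \<partial>lebesgue_on {0<..<1::real})"
    unfolding maxrearr_scaled[OF t] by (intro nn_integral_mono 1)
  also have "\<dots> = 1" by (simp add: space_restrict_space emeasure_restrict_space)
  finally show "maxrearr L ?g t \<le> 1" .
  have 2: "rearr L ?g u = 0" if u: "m \<le> u" for u
  proof -
    have "rearr L ?g u \<le> 0"
    proof (rule ennreal_le_reals)
      fix s assume s: "0 \<le> s" "ennreal s < rearr L ?g u"
      then have "ennreal u < dfun L ?g s" by (simp add: less_rearr_iff g)
      also have "dfun L ?g s \<le> emeasure lebesgue \<omega>"
        unfolding dfun_def using w
        by (subst emeasure_restrict_space, simp, blast, intro emeasure_mono) (auto simp: indicator_def split: if_splits)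
      also have "\<dots> \<le> ennreal m" by (rule m)
      also have "\<dots> \<le> ennreal u" using u by (rule ennreal_leI)
      finally show "ennreal s < 0" by simp
    qed
    then show ?thesis by simp
  qed
  have "(\<integral>\<^sup>+ u. rearr L ?g u \<partial>lebesgue_on (einterval 0 t)) = (\<integral>\<^sup>+ u. rearr L ?g u * indicator (einterval 0 t) u \<partial>lebesgue)"
    by (simp add: nn_integral_restrict_space)
  also have "\<dots> \<le> (\<integral>\<^sup>+ u. indicator {0..m} u \<partial>lebesgue)"
  proof (rule nn_integral_mono)
    fix u :: real
    show "rearr L ?g u * indicator (einterval 0 t) u \<le> indicator {0..m} u"
      using 1[of u] 2[of u] by (auto simp: indicator_def einterval_0_iff)
  qed
  also have "\<dots> = emeasure lebesgue {0..m}" by (rule nn_integral_indicator) simp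
  also have "\<dots> = ennreal m" using m by simp
  finally have "maxrearr L ?g t \<le> ennreal m / ennreal t"
    unfolding maxrearr_def by (rule divide_right_mono_ennreal)
  then show "maxrearr L ?g t \<le> ennreal (m / t)" using t m by (simp add: divide_ennreal)
qed

text \<open>Near 0 the averaged rearrangement is at most 1 and the weight itself has finite norm: by
  admissibility if \<open>p\<close> is infinite, otherwise because t^(1/p) beats slow variation.
  Away from 0 the bound m/t gives total exponent 1/p - 1 < 0, which again beats slow
  variation.\<close>

lemma LKnorm_indicator_finite:
  assumes L: "L \<in> {1, \<infinity>}" and r: "0 < r" and b: "b \<in> SV L" and adm: "admissible L p r b" and p: "1 < p"
    and w: "\<omega> \<in> sets lebesgue" "bounded \<omega>" "\<omega> \<subseteq> einterval 0 L"
  shows "LKnorm L p r b (indicator \<omega>) < \<infinity>"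
proof -
  let ?I = "einterval 0 L" and ?F = "maxrearr L (indicator \<omega>)"
  let ?w = "\<lambda>t. t powr (recip p - recip r) * b t"
  have I01: "einterval 0 1 = {0<..<1}" by (rule einterval_0_ereal[of 1, folded one_ereal_def])
  have "1 \<le> L" using L by auto
  then have I1: "{0<..<1} \<subseteq> ?I"
    unfolding I01[symmetric] by (auto simp only: einterval_iff intro: less_le_trans)
  have half: "1/2 \<in> ?I" using I1 by auto
  have p1: "recip p < 1" using recip_less[of 1 p] p by (simp add: recip_1)
  obtain m where m: "0 \<le> m" "emeasure lebesgue \<omega> \<le> ennreal m"
  proof -
    have "emeasure lebesgue \<omega> \<noteq> top"
      using bounded_set_imp_lmeasurable[OF w(2,1)] by (rule fmeasurableD2)
    then have "emeasure lebesgue \<omega> = ennreal (measure lebesgue \<omega>)" by (rule emeasure_eq_ennreal_measure)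
    then show ?thesis using that[of "measure lebesgue \<omega>"] by (simp only: order_refl measure_nonneg)
  qed
  note F = maxrearr_indicator_le[OF w(1,3) m(2,1)]
  have H: "(\<lambda>t. ennreal (?w t) * ?F t) \<in> borel_measurable (lebesgue_on ?I)"
    by (intro Bnorm_measurable b maxrearr_borel_measurable)
  \<comment> \<open>The base point 1/2 lies in (0,L) for both values of \<open>L\<close>, unlike
    1.\<close>
  have sv: "\<exists>K>0. \<forall>t\<in>?I. b t \<le> K * max (t / (1/2)) ((1/2) / t) powr \<epsilon>" if e: "0 < \<epsilon>" for \<epsilon>
  proof -
    obtain K where K: "0 < K" "\<And>s t. s \<in> ?I \<Longrightarrow> t \<in> ?I \<Longrightarrow> b s \<le> K * max (s / t) (t / s) powr \<epsilon> * b t"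
      using SV_quotient[OF b e] by blast
    have "0 < K * b (1/2)" using K SV_pos[OF b half] by simp
    moreover have "\<forall>t\<in>?I. b t \<le> (K * b (1/2)) * max (t / (1/2)) ((1/2) / t) powr \<epsilon>"
      using K(2)[OF _ half] by (simp add: mult_ac)
    ultimately show ?thesis by blast
  qed
  have near: "Lq r (lebesgue_on {0<..<1}) (\<lambda>t. ennreal (?w t)) < \<infinity>"
  proof (cases "p = \<infinity>")
    case True
    then have "Lnorm r 0 1 (\<lambda>t. ennreal (t powr (- recip r) * b t)) < \<infinity>"
      using adm by (auto simp: admissible_def Let_def)
    then show ?thesis using True by (simp add: Lnorm_eq_Lq I01)
  next
    case False
    \<comment> \<open>Half of the exponent 1/p absorbs \<open>b\<close>, the other half gives
      integrability at 0.\<close>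
    define \<epsilon> where "\<epsilon> = recip p / 2"
    have e: "0 < \<epsilon>" using False recip_pos(1)[OF less_trans[OF zero_less_one p]] by (simp add: \<epsilon>_def)
    obtain K where K: "0 < K" "\<forall>t\<in>?I. b t \<le> K * max (t / (1/2)) ((1/2) / t) powr \<epsilon>" using sv[OF e] by blast
    obtain C where C: "0 < C" "\<And>t. 0 < t \<Longrightarrow>
      Lq r (lebesgue_on {0<..<t}) (\<lambda>v. ennreal (v powr (\<epsilon> - recip r))) \<le> ennreal (C * t powr \<epsilon>)"
      using Lq_powr_initial[OF r e] by blast
    have "Lq r (lebesgue_on {0<..<1}) (\<lambda>t. ennreal (?w t)) \<le> Lq r (lebesgue_on {0<..<1}) (\<lambda>t. ennreal (K * 2 powr \<epsilon>) * ennreal (t powr (\<epsilon> - recip r)))"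
    proof (rule Lq_mono[OF r])
      have "(\<lambda>t. ennreal (?w t) * 1) \<in> borel_measurable (lebesgue_on {0<..<1})"
        by (intro weighted_measurable measurable_lebesgue_on_subset[OF SV_measurable[OF b] I1]) simp
      then show "(\<lambda>t. ennreal (?w t)) \<in> borel_measurable (lebesgue_on {0<..<1})" by simp
      fix t :: real assume "t \<in> space (lebesgue_on {0<..<1})"
      then have t: "0 < t" "t < 1" by (auto simp: space_restrict_space)
      have "t * t < 1 * 1" using t by (intro mult_strict_mono) auto
      then have "t / (1/2) \<le> 2 / t" using t by (simp add: pos_le_divide_eq)
      moreover have "(1/2) / t \<le> 2 / t" using t by (intro divide_right_mono) auto
      ultimately have "max (t / (1/2)) ((1/2) / t) \<le> 2 / t" by (rule max.boundedI)
      then have "max (t / (1/2)) ((1/2) / t) powr \<epsilon> \<le> (2 / t) powr \<epsilon>" using t e by (intro powr_mono2) auto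
      then have "K * max (t / (1/2)) ((1/2) / t) powr \<epsilon> \<le> K * (2 / t) powr \<epsilon>"
        using K(1) by (intro mult_left_mono) auto
      moreover have "b t \<le> K * max (t / (1/2)) ((1/2) / t) powr \<epsilon>"
        using t by (intro bspec[OF K(2)] subsetD[OF I1]) simp
      ultimately have "b t \<le> K * (2 / t) powr \<epsilon>" by (rule order_trans[rotated])
      then have "?w t \<le> t powr (recip p - recip r) * (K * (2 / t) powr \<epsilon>)" by (intro mult_left_mono) auto
      also have "\<dots> = K * 2 powr \<epsilon> * t powr (\<epsilon> - recip r)"
      proof -
        have "t powr (recip p - recip r) = t powr \<epsilon> * t powr (\<epsilon> - recip r)"
          by (simp add: powr_add[symmetric] \<epsilon>_def)
        then show ?thesis using t by (simp add: powr_divide)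
      qed
      finally show "ennreal (?w t) \<le> ennreal (K * 2 powr \<epsilon>) * ennreal (t powr (\<epsilon> - recip r))"
        using K by (subst ennreal_mult[symmetric]) (auto intro: ennreal_leI)
    qed
    also have "\<dots> = ennreal (K * 2 powr \<epsilon>) * Lq r (lebesgue_on {0<..<1}) (\<lambda>t. ennreal (t powr (\<epsilon> - recip r)))"
      using K by (intro Lq_cmult r powr_measurable_lebesgue_on) auto
    also have "\<dots> \<le> ennreal (K * 2 powr \<epsilon>) * ennreal (C * 1 powr \<epsilon>)" by (intro mult_left_mono C) auto
    also have "\<dots> < \<infinity>" by (simp add: ennreal_mult_less_top)
    finally show ?thesis .
  qed
  have far: "Lq r (lebesgue_on (?I \<inter> {1/2<..})) (\<lambda>t. ennreal (?w t) * ?F t) < \<infinity>"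
  proof -
    \<comment> \<open>Half of the gap 1 - 1/p absorbs \<open>b\<close>, the other half gives
      integrability at infinity.\<close>
    define \<epsilon> where "\<epsilon> = (1 - recip p) / 2"
    have e: "0 < \<epsilon>" using p1 by (auto simp: \<epsilon>_def)
    obtain K where K: "0 < K" "\<forall>t\<in>?I. b t \<le> K * max (t / (1/2)) ((1/2) / t) powr \<epsilon>" using sv[OF e] by blast
    obtain C where C: "0 < C" "\<And>t. 0 < t \<Longrightarrow>
      Lq r (lebesgue_on {t<..}) (\<lambda>v. ennreal (v powr (- \<epsilon> - recip r))) \<le> ennreal (C * t powr (- \<epsilon>))"
      using Lq_powr_final[OF r e] by blast
    let ?c = "K * 2 powr \<epsilon> * m"
    have "Lq r (lebesgue_on (?I \<inter> {1/2<..})) (\<lambda>t. ennreal (?w t) * ?F t)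
        \<le> Lq r (lebesgue_on (?I \<inter> {1/2<..})) (\<lambda>t. ennreal ?c * ennreal (t powr (- \<epsilon> - recip r)))"
    proof (rule Lq_mono[OF r _ measurable_lebesgue_on_subset[OF H]])
      fix t assume "t \<in> space (lebesgue_on (?I \<inter> {1/2<..}))"
      then have t: "1/2 < t" "0 < t" "t \<in> ?I" by (auto simp: space_restrict_space)
      have "1/2 * (1/2) < t * t" using t by (intro mult_strict_mono) auto
      then have "(1/2) / t \<le> 2 * t" using t by (simp add: pos_divide_le_eq)
      then have "max (t / (1/2)) ((1/2) / t) \<le> 2 * t" by (intro max.boundedI) simp_all
      then have "max (t / (1/2)) ((1/2) / t) powr \<epsilon> \<le> (2 * t) powr \<epsilon>" using t e by (intro powr_mono2) auto
      then have "K * max (t / (1/2)) ((1/2) / t) powr \<epsilon> \<le> K * (2 * t) powr \<epsilon>"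
        using K(1) by (intro mult_left_mono) auto
      moreover have "b t \<le> K * max (t / (1/2)) ((1/2) / t) powr \<epsilon>"
        by (rule bspec[OF K(2) t(3)])
      ultimately have "b t \<le> K * (2 * t) powr \<epsilon>" by (rule order_trans[rotated])
      then have "?w t * (m / t) \<le> t powr (recip p - recip r) * (K * (2 * t) powr \<epsilon>) * (m / t)"
        using t m by (intro mult_right_mono mult_left_mono) auto
      also have "\<dots> = ?c * (t powr (recip p - recip r) * t powr \<epsilon> * t powr (-1))"
      proof -
        have "m / t = m * t powr (-1)" using t by (simp add: powr_minus_divide)
        moreover have "(2 * t) powr \<epsilon> = 2 powr \<epsilon> * t powr \<epsilon>" by (rule powr_mult)
        ultimately show ?thesis by (simp only: mult_ac)
      qed
      also have "t powr (recip p - recip r) * t powr \<epsilon> * t powr (-1) = t powr (- \<epsilon> - recip r)"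
      proof -
        have "recip p - recip r + \<epsilon> + (-1) = - \<epsilon> - recip r" by (simp add: \<epsilon>_def field_simps)
        then show ?thesis by (simp only: powr_add[symmetric])
      qed
      finally have *: "?w t * (m / t) \<le> ?c * t powr (- \<epsilon> - recip r)" .
      have "ennreal (?w t) * ?F t \<le> ennreal (?w t) * ennreal (m / t)"
        using F(2)[OF t(2)] by (rule mult_left_mono) simp
      also have "\<dots> = ennreal (?w t * (m / t))"
        using SV_pos[OF b t(3)] m t by (intro ennreal_mult[symmetric]) auto
      also have "\<dots> \<le> ennreal (?c * t powr (- \<epsilon> - recip r))" using * by (rule ennreal_leI)
      finally show "ennreal (?w t) * ?F t \<le> ennreal ?c * ennreal (t powr (- \<epsilon> - recip r))"
        using K m by (simp add: ennreal_mult)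
    qed simp
    also have "\<dots> = ennreal ?c * Lq r (lebesgue_on (?I \<inter> {1/2<..})) (\<lambda>t. ennreal (t powr (- \<epsilon> - recip r)))"
      using K m by (intro Lq_cmult r powr_measurable_lebesgue_on) auto
    also have "\<dots> \<le> ennreal ?c * ennreal (C * (1/2) powr (- \<epsilon>))"
      by (intro mult_left_mono order_trans[OF Lq_domain_mono C(2)] r powr_measurable_lebesgue_on) auto
    also have "\<dots> < \<infinity>" by (simp add: ennreal_mult_less_top)
    finally show ?thesis .
  qed
  have near': "Lq r (lebesgue_on (?I \<inter> {0<..<1})) (\<lambda>t. ennreal (?w t) * ?F t) < \<infinity>"
  proof -
    have eq: "?I \<inter> {0<..<1} = {0<..<1}" using I1 by auto
    have "Lq r (lebesgue_on {0<..<1}) (\<lambda>t. ennreal (?w t) * ?F t) \<le> Lq r (lebesgue_on {0<..<1}) (\<lambda>t. ennreal (?w t))"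
    proof (rule Lq_mono[OF r _ measurable_lebesgue_on_subset[OF H I1]])
      fix t assume "t \<in> space (lebesgue_on {0<..<1::real})"
      then have "?F t \<le> 1" by (intro F) (auto simp: space_restrict_space)
      then show "ennreal (?w t) * ?F t \<le> ennreal (?w t)"
        using mult_left_mono[of "?F t" 1 "ennreal (?w t)"] by simp
    qed
    then show ?thesis unfolding eq using near by (rule le_less_trans)
  qed
  obtain D where "0 < D" and D: "\<And>(A::real set) B C g. A \<in> sets lebesgue \<Longrightarrow> B \<in> sets lebesgue \<Longrightarrow> C \<in> sets lebesgue \<Longrightarrow> A \<subseteq> B \<union> C \<Longrightarrow>
       g \<in> borel_measurable (lebesgue_on A) \<Longrightarrow>
       Lq r (lebesgue_on A) g \<le> ennreal D * (Lq r (lebesgue_on (A \<inter> B)) g + Lq r (lebesgue_on (A \<inter> C)) g)"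
    using Lq_cover[OF r] by blast
  have "LKnorm L p r b (indicator \<omega>) \<le> ennreal D * (Lq r (lebesgue_on (?I \<inter> {0<..<1})) (\<lambda>t. ennreal (?w t) * ?F t)
      + Lq r (lebesgue_on (?I \<inter> {1/2<..})) (\<lambda>t. ennreal (?w t) * ?F t))"
    unfolding LKnorm_def Bnorm_eq_Lq
  proof (rule D)
    show "?I \<subseteq> {0<..<1} \<union> {1/2<..}"
    proof
      fix x assume "x \<in> ?I"
      then have "0 < x" by (simp add: einterval_0_iff)
      then show "x \<in> {0<..<1} \<union> {1/2<..}" by (cases "x < 1") auto
    qed
  qed (use H in simp_all)
  also have "\<dots> < \<infinity>" using near' far by (simp add: ennreal_mult_less_top)
  finally show "LKnorm L p r b (indicator \<omega>) < \<infinity>" .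
qed

section \<open>Zero criterion and quasi-triangle inequality for \<open>LKnorm\<close>\<close>

lemma MMplus_measurable: "g \<in> MMplus L \<Longrightarrow> g \<in> borel_measurable (lebesgue_on (einterval 0 L))"
  by (simp add: MMplus_def)

lemma modulus_measurable: "f \<in> MM L \<Longrightarrow> modulus f \<in> borel_measurable (lebesgue_on (einterval 0 L))"
  unfolding modulus_def MM_def by measurable

lemma AE_False_iff: "(AE x in M. False) \<longleftrightarrow> emeasure M (space M) = 0"
  by (simp add: ae_filter_eq_bot_iff[symmetric] trivial_limit_def)

lemma dfun_eq_0_iff:
  assumes "g \<in> borel_measurable (lebesgue_on (einterval 0 L))"
  shows "dfun L g s = 0 \<longleftrightarrow> (AE x in lebesgue_on (einterval 0 L). \<not> ennreal s < g x)"
  unfolding dfun_def by (rule AE_iff_measurable[OF level_sets[OF assms], symmetric]) simp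

lemma Lq_neq_0: "0 < q \<Longrightarrow> emeasure M (space M) \<noteq> 0 \<Longrightarrow> g \<in> borel_measurable M \<Longrightarrow>
    (\<And>x. x \<in> space M \<Longrightarrow> g x \<noteq> 0) \<Longrightarrow> Lq q M g \<noteq> 0"
proof
  assume *: "0 < q" "emeasure M (space M) \<noteq> 0" "g \<in> borel_measurable M" "\<And>x. x \<in> space M \<Longrightarrow> g x \<noteq> 0" "Lq q M g = 0"
  then have "AE x in M. g x = 0" by (simp add: Lq_eq_0_iff)
  then have "AE x in M. False" using AE_space by eventually_elim (use *(4) in auto)
  then show False using *(2) by (simp add: AE_False_iff)
qed

text \<open>If \<open>g\<close> is not null, its distribution function at 0 is positive, so the
  rearrangement is positive near 0; then every average over (0,t) is positive, and so is the
  norm.\<close>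

lemma LKnorm_eq_0_iff:
  assumes r: "0 < r" and b: "b \<in> SV L" and L: "0 < L" and g: "g \<in> borel_measurable (lebesgue_on (einterval 0 L))"
  shows "LKnorm L p r b g = 0 \<longleftrightarrow> (AE x in lebesgue_on (einterval 0 L). g x = 0)"
proof
  let ?I = "einterval 0 L"
  assume zero: "AE x in lebesgue_on ?I. g x = 0"
  have "maxrearr L g t = 0" for t
  proof -
    have "dfun L g s = 0" for s
    proof -
      have "AE x in lebesgue_on ?I. \<not> ennreal s < g x" using zero by eventually_elim simp
      then show ?thesis by (simp only: dfun_eq_0_iff[OF g])
    qed
    then have "rearr L g u \<le> 0" for u
      by (intro ennreal_le_reals) (simp add: less_rearr_iff g)
    then show ?thesis by (simp add: maxrearr_def)
  qed
  then show "LKnorm L p r b g = 0" by (simp add: LKnorm_def Bnorm_eq_Lq r)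
next
  let ?I = "einterval 0 L"
  assume LK: "LKnorm L p r b g = 0"
  obtain x0 where x0: "x0 \<in> ?I"
    using L ereal_dense2[of 0 L] by (auto simp: einterval_0_iff)
  have ne: "emeasure (lebesgue_on {0<..<x}) {0<..<x} \<noteq> 0" if "0 < x" for x :: real
    using that by (simp add: emeasure_restrict_space)
  have "dfun L g 0 = 0"
  proof (rule ccontr)
    assume "dfun L g 0 \<noteq> 0"
    then have d0: "0 < dfun L g 0" by (simp add: zero_less_iff_neq_zero)
    have "maxrearr L g t \<noteq> 0" if t: "t \<in> ?I" for t
    proof
      assume "maxrearr L g t = 0"
      have t0: "0 < t" using t by (simp add: einterval_0_iff)
      \<comment> \<open>The measure of the support may be infinite or exceed t, so a positive real
        below both is chosen.\<close>
      obtain y where y: "0 < y" "y \<le> t" "ennreal y \<le> dfun L g 0"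
      proof (cases "dfun L g 0")
        case (real m)
        then show ?thesis using that[of "min m t"] t0 d0 by (auto intro: ennreal_leI)
      qed (use that[of t] t0 in auto)
      have "(\<integral>\<^sup>+ u. rearr L g u \<partial>lebesgue_on (einterval 0 t)) = 0"
        using \<open>maxrearr L g t = 0\<close> by (simp add: maxrearr_def)
      then have "AE u in lebesgue_on {0<..<t}. rearr L g u = 0"
        by (simp add: nn_integral_0_iff_AE rearr_borel_measurable einterval_0_ereal)
      then have "AE u in lebesgue_on {0<..<y}. rearr L g u = 0"
        using y by (auto simp: AE_restrict_space_iff elim!: eventually_mono)
      moreover have "rearr L g u \<noteq> 0" if u: "u \<in> {0<..<y}" for u
      proof -
        have "ennreal u < ennreal y" using u by (intro ennreal_lessI) auto
        then have "ennreal 0 < rearr L g u" using y by (subst less_rearr_iff[OF g]) auto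
        then show ?thesis by simp
      qed
      ultimately have "AE u in lebesgue_on {0<..<y}. u \<notin> {0<..<y}"
        by (auto elim!: eventually_mono)
      then have "AE u in lebesgue_on {0<..<y}. False"
        using AE_space by eventually_elim (auto simp: space_restrict_space)
      then show False using ne[OF y(1)]
        by (simp add: AE_False_iff space_restrict_space)
    qed
    moreover have "emeasure (lebesgue_on ?I) (space (lebesgue_on ?I)) \<noteq> 0"
    proof -
      have "{0<..<x0} \<subseteq> ?I" using einterval_down[OF x0] by auto
      then have "emeasure lebesgue {0<..<x0} \<le> emeasure (lebesgue_on ?I) (space (lebesgue_on ?I))"
        by (subst emeasure_restrict_space, simp, simp, intro emeasure_mono) auto
      moreover have "emeasure lebesgue {0<..<x0} \<noteq> 0" using x0 by (auto simp: einterval_0_iff)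
      ultimately show ?thesis by auto
    qed
    ultimately have "LKnorm L p r b g \<noteq> 0"
      unfolding LKnorm_def Bnorm_eq_Lq
    proof (intro Lq_neq_0 r Bnorm_measurable b maxrearr_borel_measurable)
      fix t assume F: "\<And>t. t \<in> ?I \<Longrightarrow> maxrearr L g t \<noteq> 0" and "t \<in> space (lebesgue_on ?I)"
      then have t: "t \<in> ?I" by simp
      then have "0 < t" by (simp add: einterval_0_iff)
      then show "ennreal (t powr (recip p - recip r) * b t) * maxrearr L g t \<noteq> 0"
        using F[OF t] SV_pos[OF b t] by simp
    qed
    with LK show False by simp
  qed
  then have "AE x in lebesgue_on ?I. \<not> ennreal 0 < g x"
    by (simp only: dfun_eq_0_iff[OF g])
  then show "AE x in lebesgue_on ?I. g x = 0" by eventually_elim simp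
qed

lemma LKnorm_add_le:
  assumes r: "0 < r" and b: "b \<in> SV L"
  obtains C where "0 < C" "\<And>f g. f \<in> borel_measurable (lebesgue_on (einterval 0 L)) \<Longrightarrow>
    g \<in> borel_measurable (lebesgue_on (einterval 0 L)) \<Longrightarrow>
    LKnorm L p r b (\<lambda>x. f x + g x) \<le> ennreal C * (LKnorm L p r b f + LKnorm L p r b g)"
proof -
  let ?I = "einterval 0 L"
  obtain C where C: "0 < C"
    "\<And>(M::real measure) g h. g \<in> borel_measurable M \<Longrightarrow> h \<in> borel_measurable M \<Longrightarrow>
       Lq r M (\<lambda>x. g x + h x) \<le> ennreal C * (Lq r M g + Lq r M h)"
    using Lq_add_le[OF r] by blast
  show thesis
  proof (rule that[of "2 * C"])
    show "0 < 2 * C" using C by simp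
    fix f g :: "real \<Rightarrow> ennreal"
    assume f: "f \<in> borel_measurable (lebesgue_on ?I)" and g: "g \<in> borel_measurable (lebesgue_on ?I)"
    have m: "(\<lambda>t. maxrearr L f t + maxrearr L g t) \<in> borel_measurable (lebesgue_on ?I)" by measurable
    have "LKnorm L p r b (\<lambda>x. f x + g x) \<le> Bnorm L p r b (\<lambda>t. ennreal 2 * (maxrearr L f t + maxrearr L g t))"
      unfolding LKnorm_def
      by (intro Bnorm_mono r b maxrearr_borel_measurable maxrearr_add_le f g) (simp add: einterval_0_iff)
    also have "\<dots> = ennreal 2 * Bnorm L p r b (\<lambda>t. maxrearr L f t + maxrearr L g t)"
      by (intro Bnorm_cmult r b m) simp
    also have "\<dots> \<le> ennreal 2 * (ennreal C * (LKnorm L p r b f + LKnorm L p r b g))"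
      unfolding LKnorm_def Bnorm_eq_Lq distrib_left[of "ennreal (_ * _)"]
      by (intro mult_left_mono C(2) Bnorm_measurable b maxrearr_borel_measurable) simp
    also have "\<dots> = ennreal (2 * C) * (LKnorm L p r b f + LKnorm L p r b g)"
      using C by (intro ennreal_times_times) auto
    finally show "LKnorm L p r b (\<lambda>x. f x + g x) \<le> \<dots>" .
  qed
qed

text \<open>Abstracts from the direction of the intervals \<open>J t\<close>. Condition
  \<open>J_measurable\<close> makes the average a measurable function of t; in both instances it
  follows because \<open>J t\<close> is monotone in t.\<close>

locale weighted_average =
  fixes L :: ereal and p r W :: ennreal and b d :: "real \<Rightarrow> real" and a :: real and J :: "real \<Rightarrow> real set"
  assumes L_pos: "0 < L" and r_pos: "0 < r" and W_pos: "0 < W" and b: "b \<in> SV L" and d: "d \<in> SV L"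
    and J_subset: "\<And>t. t \<in> einterval 0 L \<Longrightarrow> J t \<subseteq> einterval 0 L"
    and J_measurable: "\<And>g. g \<in> borel_measurable (lebesgue_on (einterval 0 L)) \<Longrightarrow>
      (\<lambda>t. Lq W (lebesgue_on (J t)) g) \<in> borel_measurable (lebesgue_on (einterval 0 L))"
begin

abbreviation "T \<equiv> wavg W a d J"
abbreviation "\<rho> h \<equiv> Bnorm L p r b (T h)"
abbreviation "meas h \<equiv> h \<in> borel_measurable (lebesgue_on (einterval 0 L))"

lemma weight_measurable: "meas h \<Longrightarrow> meas (\<lambda>v. ennreal (v powr (a - recip W) * d v) * h v)"
  using SV_measurable[OF d] by (rule weighted_measurable)

lemma weight_measurable_J:
  "meas h \<Longrightarrow> t \<in> einterval 0 L \<Longrightarrow>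
    (\<lambda>v. ennreal (v powr (a - recip W) * d v) * h v) \<in> borel_measurable (lebesgue_on (J t))"
  using weight_measurable J_subset by (rule measurable_lebesgue_on_subset)

lemma T_measurable: assumes "meas h" shows "meas (T h)"
proof -
  have [measurable]: "(\<lambda>t. t powr a) \<in> borel_measurable (lebesgue_on (einterval 0 L))"
    by (intro measurable_restrict_space1 measurable_completion) measurable
  note [measurable] = SV_measurable[OF d] J_measurable[OF weight_measurable[OF assms]]
  show ?thesis unfolding wavg_def[abs_def] by measurable
qed

lemma T_mono:
  assumes "meas h" "\<And>x. x \<in> einterval 0 L \<Longrightarrow> h x \<le> h' x" "t \<in> einterval 0 L"
  shows "T h t \<le> T h' t"
  unfolding wavg_def using assms J_subset[OF assms(3)]
  by (intro mult_left_mono Lq_mono W_pos weight_measurable_J) (auto simp: space_restrict_space)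

lemma \<rho>_mono:
  assumes "meas h" "\<And>x. x \<in> einterval 0 L \<Longrightarrow> h x \<le> h' x"
  shows "\<rho> h \<le> \<rho> h'"
  by (intro Bnorm_mono r_pos b T_measurable T_mono assms)

lemma \<rho>_cmult:
  assumes "meas h" "0 \<le> k"
  shows "\<rho> (\<lambda>x. ennreal k * h x) = ennreal k * \<rho> h"
proof -
  have "T (\<lambda>x. ennreal k * h x) t = ennreal k * T h t" if "t \<in> einterval 0 L" for t
    unfolding wavg_def using Lq_cmult[OF W_pos assms(2) weight_measurable_J[OF assms(1) that]]
    by (simp add: mult.left_commute)
  then have "\<rho> (\<lambda>x. ennreal k * h x) = Bnorm L p r b (\<lambda>t. ennreal k * T h t)" by (rule Bnorm_cong)
  also have "\<dots> = ennreal k * \<rho> h" by (intro Bnorm_cmult r_pos b T_measurable assms)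
  finally show ?thesis .
qed

text \<open>Monotone convergence is applied twice, to the inner norm with exponent \<open>W\<close>
  and to the outer one with exponent \<open>r\<close>.\<close>

lemma \<rho>_SUP:
  assumes m: "\<And>n. meas (H n)" and inc: "\<And>x. x \<in> einterval 0 L \<Longrightarrow> incseq (\<lambda>n. H n x)"
  shows "\<rho> (\<lambda>x. SUP n::nat. H n x) = (SUP n. \<rho> (H n))"
proof -
  have T: "T (\<lambda>x. SUP n. H n x) t = (SUP n. T (H n) t)" if t: "t \<in> einterval 0 L" for t
  proof -
    have "Lq W (lebesgue_on (J t)) (\<lambda>v. SUP n. ennreal (v powr (a - recip W) * d v) * H n v)
        = (SUP n. Lq W (lebesgue_on (J t)) (\<lambda>v. ennreal (v powr (a - recip W) * d v) * H n v))"
      using inc J_subset[OF t]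
      by (intro Lq_SUP W_pos weight_measurable_J m t)
        (auto simp: space_restrict_space incseq_Suc_iff intro!: mult_left_mono)
    then show ?thesis by (simp add: wavg_def SUP_mult_left_ennreal)
  qed
  have "\<rho> (\<lambda>x. SUP n. H n x) = Bnorm L p r b (\<lambda>t. SUP n. T (H n) t)"
    by (rule Bnorm_cong) (rule T)
  also have "\<dots> = (SUP n. \<rho> (H n))"
    unfolding Bnorm_eq_Lq SUP_mult_left_ennreal
    using inc m by (intro Lq_SUP r_pos Bnorm_measurable b T_measurable)
      (auto simp: incseq_Suc_iff intro!: mult_left_mono T_mono)
  finally show ?thesis .
qed

text \<open>Zero criterion, quasi-triangle inequality and finiteness on bounded sets tolerate
  constants and are inherited from \<open>LKnorm\<close> by equivalence. Invariance, homogeneity,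
  monotonicity and the Fatou property are exact, so they are proved for the average itself.\<close>

lemma equiv_ri_quasinorm_wavg:
  assumes L: "L \<in> {1, \<infinity>}" and p: "1 < p" and adm: "admissible L p r b"
    and C: "0 < C" "\<And>g. LKnorm L p r b g \<le> ennreal C * \<rho> (maxrearr L g)"
    and D: "0 < D" "\<And>g. \<rho> (maxrearr L g) \<le> ennreal D * LKnorm L p r b g"
  shows "sim_on (MM L) (\<lambda>f. LKnorm L p r b (modulus f)) (\<lambda>f. \<rho> (maxrearr L (modulus f))) \<and>
    equiv_ri_quasinorm L p r b (\<lambda>g. \<rho> (maxrearr L g))"
proof
  have sim: "sim_on A F G" if c: "0 < c" "0 < c'" and le: "\<And>x. F x \<le> ennreal c * G x" "\<And>x. G x \<le> ennreal c' * F x"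
    for A :: "(real \<Rightarrow> complex) set" and F G c c'
    unfolding sim_on_def
  proof (intro exI conjI ballI)
    fix x
    have "ennreal (1 / c') * G x \<le> ennreal (1 / c') * (ennreal c' * F x)" using le(2) by (rule mult_left_mono) simp
    also have "\<dots> = F x" using c by (subst ennreal_times_times) auto
    finally show "ennreal (1 / c') * G x \<le> F x" .
    have "F x \<le> ennreal c * G x" by (rule le)
    also have "\<dots> \<le> ennreal (max c (1 / c')) * G x" by (intro mult_right_mono ennreal_leI) auto
    finally show "F x \<le> ennreal (max c (1 / c')) * G x" .
  qed (use c in auto)
  show "sim_on (MM L) (\<lambda>f. LKnorm L p r b (modulus f)) (\<lambda>f. \<rho> (maxrearr L (modulus f)))"
    using sim[OF C(1) D(1) C(2) D(2)] .
  let ?N = "\<lambda>g. \<rho> (maxrearr L g)"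
  have mono: "?N f \<le> ?N g" if "meas f" "meas g" "AE x in lebesgue_on (einterval 0 L). f x \<le> g x" for f g
    using that by (intro \<rho>_mono maxrearr_borel_measurable maxrearr_mono)
  show "equiv_ri_quasinorm L p r b ?N"
    unfolding equiv_ri_quasinorm_def
  proof (intro conjI)
    show "sim_on (MM L) (\<lambda>f. ?N (modulus f)) (\<lambda>f. LKnorm L p r b (modulus f))"
      using sim[OF D(1) C(1) D(2) C(2)] .
    show "\<forall>f\<in>MM L. ?N (modulus f) = ?N (rearr L (modulus f))"
    proof
      fix f assume "f \<in> MM L"
      then have "rearr L (rearr L (modulus f)) = rearr L (modulus f)"
        by (intro rearr_rearr modulus_measurable L_pos)
      then have "maxrearr L (rearr L (modulus f)) = maxrearr L (modulus f)"
        by (simp add: maxrearr_def fun_eq_iff)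
      then show "?N (modulus f) = ?N (rearr L (modulus f))" by simp
    qed
    show "\<forall>f\<in>MMplus L. ?N f = 0 \<longleftrightarrow> (AE x in lebesgue_on (einterval 0 L). f x = 0)"
    proof
      fix f assume f: "f \<in> MMplus L"
      have "?N f = 0 \<longleftrightarrow> LKnorm L p r b f = 0" using C(2)[of f] D(2)[of f] by auto
      then show "?N f = 0 \<longleftrightarrow> (AE x in lebesgue_on (einterval 0 L). f x = 0)"
        using LKnorm_eq_0_iff[OF r_pos b L_pos MMplus_measurable[OF f]] by simp
    qed
    show "\<forall>f\<in>MMplus L. \<forall>k\<ge>0. ?N (\<lambda>x. ennreal k * f x) = ennreal k * ?N f"
    proof (intro ballI allI impI)
      fix f and k :: real assume f: "f \<in> MMplus L" and k: "0 \<le> k"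
      show "?N (\<lambda>x. ennreal k * f x) = ennreal k * ?N f"
      \<comment> \<open>\<open>maxrearr_cmult\<close> rests on division by k; for k = 0 the value is
        obtained from the norm of the zero function.\<close>
      proof (cases "k = 0")
        case True
        have "LKnorm L p r b (\<lambda>x. 0) = 0" by (subst LKnorm_eq_0_iff) (auto simp: r_pos b L_pos)
        then have "?N (\<lambda>x. 0) = 0" using D(2)[of "\<lambda>x. 0"] by simp
        then show ?thesis using True by simp
      next
        case False
        then have "maxrearr L (\<lambda>x. ennreal k * f x) = (\<lambda>t. ennreal k * maxrearr L f t)"
          using k by (intro ext maxrearr_cmult MMplus_measurable f) simp
        then show ?thesis using k by (simp add: \<rho>_cmult)
      qed
    qed
    show "\<exists>C::real. C \<ge> 1 \<and> (\<forall>f\<in>MMplus L. \<forall>g\<in>MMplus L. ?N (\<lambda>x. f x + g x) \<le> ennreal C * (?N f + ?N g))"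
    proof -
      obtain B where B: "0 < B" "\<And>f g. meas f \<Longrightarrow> meas g \<Longrightarrow>
        LKnorm L p r b (\<lambda>x. f x + g x) \<le> ennreal B * (LKnorm L p r b f + LKnorm L p r b g)"
        using LKnorm_add_le[OF r_pos b] by blast
      have "?N (\<lambda>x. f x + g x) \<le> ennreal (max 1 (D * (B * C))) * (?N f + ?N g)"
        if "f \<in> MMplus L" "g \<in> MMplus L" for f g
      proof -
        have "?N (\<lambda>x. f x + g x) \<le> ennreal D * LKnorm L p r b (\<lambda>x. f x + g x)" by (rule D)
        also have "\<dots> \<le> ennreal D * (ennreal B * (LKnorm L p r b f + LKnorm L p r b g))"
          using that by (intro mult_left_mono B(2) MMplus_measurable) auto
        also have "\<dots> \<le> ennreal D * (ennreal B * (ennreal C * (?N f + ?N g)))"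
          unfolding distrib_left[of "ennreal C"] by (intro mult_left_mono add_mono C(2)) auto
        also have "\<dots> = ennreal (D * (B * C)) * (?N f + ?N g)"
          using D(1) B(1) C(1) by (simp add: ennreal_times_times)
        also have "\<dots> \<le> ennreal (max 1 (D * (B * C))) * (?N f + ?N g)"
          by (intro mult_right_mono ennreal_leI) auto
        finally show ?thesis .
      qed
      then show ?thesis by (intro exI[of _ "max 1 (D * (B * C))"]) auto
    qed
    show "\<forall>f\<in>MMplus L. \<forall>g\<in>MMplus L. (AE x in lebesgue_on (einterval 0 L). g x \<le> f x) \<longrightarrow> ?N g \<le> ?N f"
      using mono by (auto intro: MMplus_measurable)
    show "\<forall>f\<in>MMplus L. \<forall>F::nat \<Rightarrow> real \<Rightarrow> ennreal.
        (\<forall>n. F n \<in> MMplus L) \<and>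
        (AE x in lebesgue_on (einterval 0 L). incseq (\<lambda>n. F n x) \<and> (\<lambda>n. F n x) \<longlonglongrightarrow> f x) \<and>
        (SUP n. ?N (F n)) < \<infinity> \<longrightarrow>
          ?N f < \<infinity> \<and> incseq (\<lambda>n. ?N (F n)) \<and> (\<lambda>n. ?N (F n)) \<longlonglongrightarrow> ?N f"
    proof (intro ballI allI impI)
      fix f and F :: "nat \<Rightarrow> real \<Rightarrow> ennreal"
      assume f: "f \<in> MMplus L" and *: "(\<forall>n. F n \<in> MMplus L) \<and>
        (AE x in lebesgue_on (einterval 0 L). incseq (\<lambda>n. F n x) \<and> (\<lambda>n. F n x) \<longlonglongrightarrow> f x) \<and> (SUP n. ?N (F n)) < \<infinity>"
      have fm: "meas f" and Fm: "meas (F n)" for n using f * by (auto intro: MMplus_measurable)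
      have AE: "AE x in lebesgue_on (einterval 0 L). incseq (\<lambda>n. F n x) \<and> f x = (SUP n. F n x)"
        using conjunct1[OF conjunct2[OF *]]
        by eventually_elim (auto dest: LIMSEQ_SUP intro: LIMSEQ_unique)
      have up: "AE x in lebesgue_on (einterval 0 L). F n x \<le> F (Suc n) x" for n
        using AE by eventually_elim (auto simp: incseq_Suc_iff)
      have "maxrearr L f = (\<lambda>t. SUP n. maxrearr L (F n) t)"
        by (rule ext, rule maxrearr_SUP[OF fm Fm AE])
      moreover have "incseq (\<lambda>n. maxrearr L (F n) t)" for t
        by (auto simp: incseq_Suc_iff intro!: maxrearr_mono Fm up)
      ultimately have eq: "?N f = (SUP n. ?N (F n))"
        using \<rho>_SUP[of "\<lambda>n. maxrearr L (F n)"] by simp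
      have inc: "incseq (\<lambda>n. ?N (F n))" by (auto simp: incseq_Suc_iff intro!: mono Fm up)
      show "?N f < \<infinity> \<and> incseq (\<lambda>n. ?N (F n)) \<and> (\<lambda>n. ?N (F n)) \<longlonglongrightarrow> ?N f"
        using * inc LIMSEQ_SUP[OF inc] unfolding eq by blast
    qed
    show "\<forall>\<omega>. \<omega> \<in> sets lebesgue \<and> bounded \<omega> \<and> \<omega> \<subseteq> einterval 0 L \<longrightarrow> ?N (indicator \<omega>) < \<infinity>"
    proof (intro allI impI)
      fix \<omega> :: "real set" assume "\<omega> \<in> sets lebesgue \<and> bounded \<omega> \<and> \<omega> \<subseteq> einterval 0 L"
      then have "LKnorm L p r b (indicator \<omega>) < \<infinity>"
        using LKnorm_indicator_finite[OF L r_pos b adm p] by blast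
      then have "ennreal D * LKnorm L p r b (indicator \<omega>) < \<infinity>" by (simp add: ennreal_mult_less_top)
      with D(2) show "?N (indicator \<omega>) < \<infinity>" by (rule le_less_trans)
    qed
  qed
qed

end

theorem theorem36:
  fixes L :: ereal and p r U V W :: ennreal and b d :: "real \<Rightarrow> real"
  assumes "L \<in> {1, \<infinity>}"
    and "0 < p" and "0 < r"
    and "b \<in> SV L"
    and "admissible L p r b"
    and "d \<in> SV L"
    and "0 < U" and "U < \<infinity>" and "0 < V" and "0 < W"
  shows "(1 < p \<and> U < p \<longrightarrow>
            sim_on (MM L) (\<lambda>f. LKnorm L p r b (modulus f))
              (\<lambda>f. Bnorm L p r b (Hup L U W d (maxrearr L (modulus f)))) \<and>
            equiv_ri_quasinorm L p r b (\<lambda>g. Bnorm L p r b (Hup L U W d (maxrearr L g)))) \<and>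
         (1 < p \<and> p < V \<longrightarrow>
            sim_on (MM L) (\<lambda>f. LKnorm L p r b (modulus f))
              (\<lambda>f. Bnorm L p r b (Hlow L V W d (maxrearr L (modulus f)))) \<and>
            equiv_ri_quasinorm L p r b (\<lambda>g. Bnorm L p r b (Hlow L V W d (maxrearr L g))))"
proof (intro conjI[of "_ \<longrightarrow> _"] impI)
  have L0: "0 < L" using assms(1) by auto
  have anti: "maxrearr L g t \<le> maxrearr L g s" if "0 < s" "s \<le> t" for g s t
    using that by (rule maxrearr_antimono)
  {
    assume p: "1 < p \<and> U < p"
    interpret weighted_average L p r W b d "recip U" "\<lambda>t. einterval 0 t"
    proof
      show sub: "einterval 0 t \<subseteq> einterval 0 L" if "t \<in> einterval 0 L" for t :: real
        using einterval_down[OF that] by (auto simp: einterval_0_ereal)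
      show "(\<lambda>t. Lq W (lebesgue_on (einterval 0 t)) g) \<in> borel_measurable (lebesgue_on (einterval 0 L))"
        if g: "g \<in> borel_measurable (lebesgue_on (einterval 0 L))" for g
      proof (rule mono_on_borel_measurable[OF is_interval_einterval])
        fix x y assume "x \<in> einterval 0 L" and y: "y \<in> einterval 0 L" and "x \<le> y"
        then show "Lq W (lebesgue_on (einterval 0 x)) g \<le> Lq W (lebesgue_on (einterval 0 y)) g"
          by (intro Lq_domain_mono assms measurable_lebesgue_on_subset[OF g sub[OF y]]) (auto simp: einterval_0_ereal)
      qed
    qed (use assms L0 in auto)
    \<comment> \<open>Since \<open>J t\<close> lies in (0,L), where the averaged rearrangement is
      its own rearrangement, the operator of the statement coincides with \<open>T\<close>.\<close>
    have eq: "Bnorm L p r b (Hup L U W d (maxrearr L g)) = \<rho> (maxrearr L g)" for g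
    proof (rule Bnorm_cong)
      fix t assume t: "t \<in> einterval 0 L"
      show "Hup L U W d (maxrearr L g) t = T (maxrearr L g) t"
        unfolding Hup_def wavg_def Lnorm_eq_Lq using J_subset[OF t]
        by (intro arg_cong2[where f="(*)"] refl Lq_cong) (auto simp: rearr_maxrearr L0)
    qed
    \<comment> \<open>This is the gap to be quartered, with a = 1/U; for infinite \<open>p\<close>
      it reads 0 < 1/U.\<close>
    have less: "recip p < recip U" using p assms by (intro recip_less) auto
    obtain C where C: "0 < C" "\<And>F. meas F \<Longrightarrow> (\<And>s t. 0 < s \<Longrightarrow> s \<le> t \<Longrightarrow> F t \<le> F s) \<Longrightarrow> meas (T F) \<Longrightarrow>
      Bnorm L p r b F \<le> ennreal C * \<rho> F"
      using Bnorm_le_wavg_initial[OF r_pos W_pos b d] by blast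
    obtain D where D: "0 < D" "\<And>F. meas F \<Longrightarrow> (\<And>s t. 0 < s \<Longrightarrow> s \<le> t \<Longrightarrow> F t \<le> F s) \<Longrightarrow> meas (T F) \<Longrightarrow>
      \<rho> F \<le> ennreal D * Bnorm L p r b F"
      using Bnorm_wavg_initial[OF r_pos W_pos b d less] by blast
    show "sim_on (MM L) (\<lambda>f. LKnorm L p r b (modulus f))
              (\<lambda>f. Bnorm L p r b (Hup L U W d (maxrearr L (modulus f)))) \<and>
            equiv_ri_quasinorm L p r b (\<lambda>g. Bnorm L p r b (Hup L U W d (maxrearr L g)))"
      unfolding eq
    proof (rule equiv_ri_quasinorm_wavg[OF assms(1) conjunct1[OF p] assms(5) C(1) _ D(1)])
      show "LKnorm L p r b g \<le> ennreal C * \<rho> (maxrearr L g)" for g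
        unfolding LKnorm_def by (intro C(2) maxrearr_borel_measurable anti T_measurable)
      show "\<rho> (maxrearr L g) \<le> ennreal D * LKnorm L p r b g" for g
        unfolding LKnorm_def by (intro D(2) maxrearr_borel_measurable anti T_measurable)
    qed
  }
  {
    assume p: "1 < p \<and> p < V"
    interpret weighted_average L p r W b d "recip V" "\<lambda>t. einterval t L"
    proof
      show sub: "einterval t L \<subseteq> einterval 0 L" if "t \<in> einterval 0 L" for t :: real
        using that by (auto simp: einterval_iff)
      show "(\<lambda>t. Lq W (lebesgue_on (einterval t L)) g) \<in> borel_measurable (lebesgue_on (einterval 0 L))"
        if g: "g \<in> borel_measurable (lebesgue_on (einterval 0 L))" for g
      proof (rule antimono_on_borel_measurable[OF is_interval_einterval])
        fix x y assume x: "x \<in> einterval 0 L" and "y \<in> einterval 0 L" and "x \<le> y"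
        then show "Lq W (lebesgue_on (einterval y L)) g \<le> Lq W (lebesgue_on (einterval x L)) g"
          by (intro Lq_domain_mono assms measurable_lebesgue_on_subset[OF g sub[OF x]]) (auto simp: einterval_iff)
      qed
    qed (use assms L0 in auto)
    have eq: "Bnorm L p r b (Hlow L V W d (maxrearr L g)) = \<rho> (maxrearr L g)" for g
    proof (rule Bnorm_cong)
      fix t assume t: "t \<in> einterval 0 L"
      show "Hlow L V W d (maxrearr L g) t = T (maxrearr L g) t"
        unfolding Hlow_def wavg_def Lnorm_eq_Lq using J_subset[OF t]
        by (intro arg_cong2[where f="(*)"] refl Lq_cong) (auto simp: rearr_maxrearr L0)
    qed
    \<comment> \<open>The gap for a = 1/V. Infinite \<open>V\<close> forces finite \<open>p\<close>
      and gives a = 0, which the bound for (t,L) admits.\<close>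
    have less: "recip V < recip p" using p assms by (intro recip_less) auto
    obtain C where C: "0 < C" "\<And>F. meas F \<Longrightarrow> (\<And>s t. 0 < s \<Longrightarrow> s \<le> t \<Longrightarrow> F t \<le> F s) \<Longrightarrow> meas (T F) \<Longrightarrow>
      Bnorm L p r b F \<le> ennreal C * \<rho> F"
      using Bnorm_le_wavg_final[OF r_pos W_pos b d] by blast
    obtain D where D: "0 < D" "\<And>F. meas F \<Longrightarrow> (\<And>s t. 0 < s \<Longrightarrow> s \<le> t \<Longrightarrow> F t \<le> F s) \<Longrightarrow> meas (T F) \<Longrightarrow>
      \<rho> F \<le> ennreal D * Bnorm L p r b F"
      using Bnorm_wavg_final[OF r_pos W_pos b d recip_nonneg less] by blast
    show "sim_on (MM L) (\<lambda>f. LKnorm L p r b (modulus f))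
              (\<lambda>f. Bnorm L p r b (Hlow L V W d (maxrearr L (modulus f)))) \<and>
            equiv_ri_quasinorm L p r b (\<lambda>g. Bnorm L p r b (Hlow L V W d (maxrearr L g)))"
      unfolding eq
    proof (rule equiv_ri_quasinorm_wavg[OF assms(1) conjunct1[OF p] assms(5) C(1) _ D(1)])
      show "LKnorm L p r b g \<le> ennreal C * \<rho> (maxrearr L g)" for g
        unfolding LKnorm_def by (intro C(2) maxrearr_borel_measurable anti T_measurable)
      show "\<rho> (maxrearr L g) \<le> ennreal D * LKnorm L p r b g" for g
        unfolding LKnorm_def by (intro D(2) maxrearr_borel_measurable anti T_measurable)
    qed
  }
qed

end
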